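(* For every positive integer $m$, the density of quadratic fields $K$ with $\mathrm{Gal}(K^{un}/K)\cong H_8^m$ is equal to $0$.
   Context: $H_8$ is the quaternion group of order 8 and $H_8^m$ is its $m$-fold direct power. $K^{un}$ is the maximal unramified extension of $K$ (unramified at all places, including infinite ones). Density is taken with quadratic fields ordered by the absolute value of their discriminants: it is the limit as $X\to\infty$ of the proportion of quadratic fields $K$ with $|\mathrm{disc}\,K|<X$ having the stated property. *)

theory Defs
  imports
    Complex_Main
    "HOL-Algebra.Bij"
    "HOL-Algebra.Embedded_Algebras"
    "HOL-Algebra.Generated_Fields"
    "HOL-Algebra.Ideal_Product"
    "HOL-Algebra.Product_Groups"
    "HOL-Algebra.Algebraic_Closure_Type"
    "Jordan_Normal_Form.Determinant"
begin

text \<open>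
  Number fields are subfields of the complex numbers. Two distinct quadratic subfields are never
  isomorphic, and every quadratic field embeds, so quadratic subfields correspond exactly to
  isomorphism classes of quadratic fields. All algebraic extensions are taken inside the complex
  numbers, which contain an algebraic closure of every such field.
\<close>

abbreviation CC :: "complex ring" where
  "CC \<equiv> ring_of_type_algebra"

abbreviation field_ring :: "complex set \<Rightarrow> complex ring" where
  "field_ring K \<equiv> CC\<lparr>carrier := K\<rparr>"

definition finite_extension :: "complex set \<Rightarrow> complex set \<Rightarrow> bool" where
  "finite_extension K L \<longleftrightarrow>
     subfield K CC \<and> subfield L CC \<and> K \<subseteq> L \<and> ring.finite_dimension CC K L"

definition quadratic_field :: "complex set \<Rightarrow> bool" where
  "quadratic_field K \<longleftrightarrow> subfield K CC \<and> ring.dimension CC 2 \<rat> K"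

definition integers :: "complex set \<Rightarrow> complex ring" where
  "integers K = CC\<lparr>carrier := {x \<in> K. algebraic_int x}\<rparr>"

definition embeddings :: "complex set \<Rightarrow> (complex \<Rightarrow> complex) set" where
  "embeddings K = extensional K \<inter> Ring.ring_hom (field_ring K) CC"

definition integral_basis :: "complex set \<Rightarrow> complex list \<Rightarrow> bool" where
  "integral_basis K bs \<longleftrightarrow>
     bij_betw (\<lambda>c. \<Sum>i<length bs. of_int (c i) * bs ! i)
       ({..<length bs} \<rightarrow>\<^sub>E (UNIV :: int set)) (carrier (integers K))"

text \<open>
  The discriminant is \<open>det (\<sigma>\<^sub>i b\<^sub>j)\<^sup>2\<close> for an integral basis \<open>b\<close> and an enumeration \<open>\<sigma>\<close> of the
  embeddings; for a number field it is an integer that does not depend on these choices.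
\<close>

definition disc :: "complex set \<Rightarrow> int" where
  "disc K = (THE d. \<exists>bs ss. integral_basis K bs \<and> distinct ss \<and> set ss = embeddings K \<and>
     of_int d = (det (mat (length ss) (length bs) (\<lambda>(i, j). (ss ! i) (bs ! j))))\<^sup>2)"

definition ideal_power :: "complex ring \<Rightarrow> complex set \<Rightarrow> nat \<Rightarrow> complex set" where
  "ideal_power R I e = (ideal_prod R I ^^ e) (carrier R)"

text \<open>
  \<open>P\<close> is a nonzero prime of the integers of \<open>L\<close>, lying over the prime \<open>P \<inter> K\<close> of the integers
  of \<open>K\<close>.
\<close>

definition ramification_index :: "complex set \<Rightarrow> complex set \<Rightarrow> complex set \<Rightarrow> nat" where
  "ramification_index K L P =
     (GREATEST e. genideal (integers L) (P \<inter> K) \<subseteq> ideal_power (integers L) P e)"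

text \<open>
  Residue fields of number fields are finite, so residue extensions are automatically separable
  and ramification index 1 is all that is required at the finite places. An infinite place is
  ramified when a real embedding of \<open>K\<close> extends to a non-real embedding of \<open>L\<close>.
\<close>

definition unramified_extension :: "complex set \<Rightarrow> complex set \<Rightarrow> bool" where
  "unramified_extension K L \<longleftrightarrow>
     finite_extension K L \<and>
     (\<forall>P. primeideal P (integers L) \<and> P \<noteq> {0} \<longrightarrow> ramification_index K L P = 1) \<and>
     (\<forall>\<sigma>\<in>embeddings L. \<sigma> ` K \<subseteq> \<real> \<longrightarrow> \<sigma> ` L \<subseteq> \<real>)"

text \<open>The compositum of all finite unramified extensions; it may have infinite degree.\<close>

definition max_unramified :: "complex set \<Rightarrow> complex set" where
  "max_unramified K = generate_field CC (\<Union>{L. unramified_extension K L})"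

definition Gal :: "complex set \<Rightarrow> complex set \<Rightarrow> (complex \<Rightarrow> complex) monoid" where
  "Gal L K = BijGroup L
     \<lparr>carrier := {\<sigma> \<in> Bij L. \<sigma> \<in> Ring.ring_hom (field_ring L) (field_ring L) \<and> (\<forall>x\<in>K. \<sigma> x = x)}\<rparr>"

text \<open>
  The quaternion group \<open>{\<plusminus>1, \<plusminus>i, \<plusminus>j, \<plusminus>k}\<close>, with \<open>(a, b, c, d)\<close> standing for
  \<open>a + b i + c j + d k\<close>.
\<close>

type_synonym quat = "int \<times> int \<times> int \<times> int"

fun quat_mult :: "quat \<Rightarrow> quat \<Rightarrow> quat" where
  "quat_mult (a1, b1, c1, d1) (a2, b2, c2, d2) =
     (a1 * a2 - b1 * b2 - c1 * c2 - d1 * d2,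
      a1 * b2 + b1 * a2 + c1 * d2 - d1 * c2,
      a1 * c2 - b1 * d2 + c1 * a2 + d1 * b2,
      a1 * d2 + b1 * c2 - c1 * b2 + d1 * a2)"

definition quaternion_group :: "quat monoid" where
  "quaternion_group =
     \<lparr>carrier = {(1, 0, 0, 0), (-1, 0, 0, 0), (0, 1, 0, 0), (0, -1, 0, 0),
                 (0, 0, 1, 0), (0, 0, -1, 0), (0, 0, 0, 1), (0, 0, 0, -1)},
      monoid.mult = quat_mult, monoid.one = (1, 0, 0, 0)\<rparr>"

lemma quat_mult_assoc: "quat_mult (quat_mult x y) z = quat_mult x (quat_mult y z)"
  by (cases x; cases y; cases z) (simp add: algebra_simps)

lemma group_quaternion_group: "group quaternion_group"
proof (rule groupI)
  fix x y z
  assume "x \<in> carrier quaternion_group" "y \<in> carrier quaternion_group"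
  then show "x \<otimes>\<^bsub>quaternion_group\<^esub> y \<in> carrier quaternion_group"
    by (auto simp: quaternion_group_def)
qed (auto simp: quaternion_group_def quat_mult_assoc)

lemma order_quaternion_group: "Coset.order quaternion_group = 8"
  by (simp add: Coset.order_def quaternion_group_def)

definition quaternion_power :: "nat \<Rightarrow> (nat \<Rightarrow> quat) monoid" where
  "quaternion_power m = product_group {..<m} (\<lambda>_. quaternion_group)"

definition has_quadratic_density :: "(complex set \<Rightarrow> bool) \<Rightarrow> real \<Rightarrow> bool" where
  "has_quadratic_density P \<delta> \<longleftrightarrow>
     ((\<lambda>x::real.
         real (card {K. quadratic_field K \<and> real_of_int \<bar>disc K\<bar> < x \<and> P K}) /
         real (card {K. quadratic_field K \<and> real_of_int \<bar>disc K\<bar> < x}))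
       \<longlongrightarrow> \<delta>) at_top"

end

theory Submission
  imports
    Defs
    "Jordan_Normal_Form.Char_Poly"
    "HOL-Computational_Algebra.Squarefree"
    "HOL-Number_Theory.Totient"
begin

text \<open>
  A quadratic field \<open>K = \<rat>(\<surd>d)\<close>, \<open>d\<close> squarefree, whose discriminant has many prime factors has many
  unramified quadratic extensions, so \<open>Gal(K\<^sup>u\<^sup>n/K)\<close> is large. A group of order \<open>8\<^sup>m\<close> leaves room for
  boundedly many ramified primes only, and integers with a bounded number of prime factors have
  density 0.

  The extensions come from genus theory. If \<open>p\<^sub>0, p\<close> are distinct odd primes dividing \<open>d\<close> with
  \<open>p\<^sub>0 \<equiv> p mod 4\<close>, then \<open>n = p\<^sub>0 p\<close> is positive and \<open>1 mod 4\<close>, and \<open>K(\<surd>n)\<close> is unramified over \<open>K\<close>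
  (\<open>unramified_sqrt\<close>): away from \<open>n\<close> because it is generated by \<open>(1 + \<surd>n)/2\<close>, a root of a polynomial
  of discriminant \<open>n\<close>, and over the primes dividing \<open>n\<close> because it is also generated by \<open>\<surd>(d/n)\<close>, a root
  of a polynomial of discriminant \<open>4d/n\<close>. Fix \<open>p\<^sub>0\<close> and assign to \<open>p\<close> the set of those elements of the Galois
  group that fix \<open>\<surd>(p\<^sub>0 p)\<close>. For \<open>p \<noteq> q\<close> some automorphism of \<open>K\<^sup>u\<^sup>n\<close> over \<open>K\<close> negates \<open>\<surd>(p q) \<notin> K\<close>,
  so different primes give different subsets, and there are at most \<open>2\<close> to the power \<open>|Gal|\<close> of them
  (\<open>card_congruent_ramified_primes\<close>).

  Three things have to be supplied for this.

  \<^item> Unramifiedness is defined through \<open>P \<inter> K\<close> lying in \<open>P\<close> but not in \<open>P\<^sup>2\<close>. Let \<open>\<tau>\<close> be the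
  conjugation of \<open>L/K\<close>. If \<open>P \<inter> K \<subseteq> P\<^sup>2\<close> and some integer \<open>\<theta>\<close> of \<open>L\<close> has \<open>\<theta> - \<tau> \<theta> \<notin> P\<close>, a trace
  computation gives \<open>P = P\<^sup>2\<close>, which Nakayama's argument excludes, since ideals of rings of integers
  are finitely generated (\<open>unramified_at_prime\<close>, \<open>prime_not_idempotent\<close>).

  \<^item> Automorphisms of \<open>K(\<surd>(p q))\<close> must extend to \<open>K\<^sup>u\<^sup>n\<close>. By Zorn's lemma every homomorphism from a
  ring of algebraic numbers extends to an automorphism of the field of all algebraic numbers
  (\<open>partial_hom_extends\<close>). An automorphism fixing \<open>K\<close> permutes the unramified extensions of \<open>K\<close>
  (\<open>unramified_image\<close>) and hence maps their compositum onto itself.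

  \<^item> Fields are ordered by discriminant, which for squarefree \<open>d\<close> is \<open>d\<close> or \<open>4d\<close> (\<open>disc_eq\<close>). The
  quadratic fields of discriminant below \<open>x\<close> are thus as numerous as \<open>x\<close> up to a constant, and those
  with few ramified primes are \<open>o(x)\<close> by a sieve (\<open>few_odd_prime_factors_density_zero\<close>).
\<close>

section \<open>Finitely generated groups of complex numbers\<close>

interpretation zmod: Modules.module "\<lambda>(c::int) (x::complex). of_int c * x"
  by unfold_locales (auto simp: algebra_simps)

lemma zmod_subspaceI:
  assumes "0 \<in> G" "\<And>x y. x \<in> G \<Longrightarrow> y \<in> G \<Longrightarrow> x + y \<in> G" "\<And>x. x \<in> G \<Longrightarrow> - x \<in> G"
  shows "zmod.subspace G"
proof (rule zmod.subspaceI)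
  fix c :: int and x assume x: "x \<in> G"
  have n: "of_nat n * x \<in> G" for n
    by (induction n) (auto simp: algebra_simps assms(1) intro: assms(2) x)
  show "of_int c * x \<in> G"
  proof (cases c)
    case (nonneg n)
    then show ?thesis using n by simp
  next
    case (neg n)
    then have "of_int c * x = - (of_nat (Suc n) * x)" by (simp only: of_int_minus of_int_of_nat_eq mult_minus_left)
    then show ?thesis using assms(3)[OF n[of "Suc n"]] by (simp only:)
  qed
qed (use assms in auto)

lemma zmod_subspace_mult: "zmod.subspace G \<Longrightarrow> zmod.subspace {y. x * y \<in> G}"
  by (rule zmod.subspaceI)
    (auto simp: zmod.subspace_0 distrib_left zmod.subspace_add mult.left_commute[of x] intro: zmod.subspace_scale)

lemma zmod_span_mult_closed:
  assumes "\<And>s. s \<in> S \<Longrightarrow> x * s \<in> zmod.span T" "y \<in> zmod.span S"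
  shows "x * y \<in> zmod.span T"
proof -
  have "zmod.span S \<subseteq> {y. x * y \<in> zmod.span T}"
    by (rule zmod.span_minimal) (use assms(1) in \<open>auto intro: zmod_subspace_mult\<close>)
  then show ?thesis using assms(2) by auto
qed

text \<open>
  Induction on the number of generators of the ambient group: the coefficients that elements of \<open>G\<close>
  can have at the last generator form an ideal of \<open>\<int>\<close>. An element realising a generator of this
  ideal, together with generators of the subgroup without last coordinate, generates \<open>G\<close>.
\<close>

lemma finitely_generated_zmod_subspace:
  assumes "finite S" "zmod.subspace G" "G \<subseteq> zmod.span S"
  shows "\<exists>T. finite T \<and> T \<subseteq> G \<and> G \<subseteq> zmod.span T"
  using assms
proof (induction S arbitrary: G rule: finite_induct)
  case empty
  then show ?case by (intro exI[of _ "{}"]) auto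
next
  case (insert a S)
  define G' where "G' = G \<inter> zmod.span S"
  have G': "zmod.subspace G'" unfolding G'_def
    using insert.prems(1) by (simp add: zmod.subspace_inter)
  from insert.IH[OF G'] obtain T where T: "finite T" "T \<subseteq> G'" "G' \<subseteq> zmod.span T"
    unfolding G'_def by blast
  define P where "P = (\<lambda>k :: int. \<exists>x\<in>G. x - of_int k * a \<in> zmod.span S)"
  have Pdiff: "P (k - c * l)" if "P k" "P l" for k l c
  proof -
    from that obtain x y where xy: "x \<in> G" "y \<in> G"
      "x - of_int k * a \<in> zmod.span S" "y - of_int l * a \<in> zmod.span S" by (auto simp: P_def)
    have "(x - of_int k * a) - of_int c * (y - of_int l * a) \<in> zmod.span S"
      by (rule zmod.span_diff[OF xy(3) zmod.span_scale[OF xy(4)]])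
    moreover have "(x - of_int k * a) - of_int c * (y - of_int l * a) =
        (x - of_int c * y) - of_int (k - c * l) * a" by (simp add: algebra_simps)
    moreover have "x - of_int c * y \<in> G"
      using xy insert.prems(1) by (intro zmod.subspace_diff zmod.subspace_scale)
    ultimately show ?thesis unfolding P_def by metis
  qed
  have P0: "P 0" unfolding P_def
    using insert.prems(1) zmod.subspace_0 zmod.span_zero by force
  show ?case
  proof (cases "\<exists>k. P k \<and> k \<noteq> 0")
    case False
    have "G \<subseteq> G'"
    proof
      fix x assume x: "x \<in> G"
      then obtain k where "x - of_int k * a \<in> zmod.span S"
        using insert.prems(2) by (auto simp: zmod.span_insert)
      then have "P k" using x by (auto simp: P_def)
      then have "k = 0" using False by auto
      then show "x \<in> G'" using x \<open>x - of_int k * a \<in> zmod.span S\<close> by (simp add: G'_def)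
    qed
    then show ?thesis using T by (intro exI[of _ T]) (auto simp: G'_def)
  next
    case True
    then obtain k where k: "P k" "k \<noteq> 0" by blast
    have "P (0 - 1 * k)" by (rule Pdiff[OF P0 k(1)])
    then have "P (int (nat \<bar>k\<bar>))" using k by (auto simp: abs_if)
    then have ex: "\<exists>n. n > 0 \<and> P (int n)" using k by (intro exI[of _ "nat \<bar>k\<bar>"]) auto
    define n where "n = (LEAST n. n > 0 \<and> P (int n))"
    have n: "n > 0" "P (int n)" unfolding n_def using LeastI_ex[OF ex] by auto
    have least: "\<not> P (int m)" if "m > 0" "m < n" for m
      using not_less_Least[of m "\<lambda>n. n > 0 \<and> P (int n)"] that unfolding n_def by auto
    from n obtain w where w: "w \<in> G" "w - of_int (int n) * a \<in> zmod.span S" by (auto simp: P_def)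
    have "G \<subseteq> zmod.span (insert w T)"
    proof
      fix x assume x: "x \<in> G"
      then obtain k where k: "x - of_int k * a \<in> zmod.span S"
        using insert.prems(2) by (auto simp: zmod.span_insert)
      then have "P k" using x by (auto simp: P_def)
      then have "P (k - (k div int n) * int n)" using n by (intro Pdiff)
      then have "P (k mod int n)" by (simp add: minus_div_mult_eq_mod)
      moreover have "k mod int n = int (nat (k mod int n))" "nat (k mod int n) < n"
        using n by (simp_all add: nat_less_iff)
      ultimately have kmod: "k mod int n = 0"
        using least[of "nat (k mod int n)"] by (metis gr0I int_ops(1))
      define q where "q = k div int n"
      have kq: "k = q * int n" using kmod by (auto simp: q_def)
      have "x - of_int q * w \<in> G"
        using x w insert.prems(1) by (intro zmod.subspace_diff zmod.subspace_scale)
      moreover have "x - of_int q * w \<in> zmod.span S"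
      proof -
        have "(x - of_int k * a) - of_int q * (w - of_int (int n) * a) \<in> zmod.span S"
          by (rule zmod.span_diff[OF k zmod.span_scale[OF w(2)]])
        then show ?thesis by (simp add: kq algebra_simps)
      qed
      ultimately have "x - of_int q * w \<in> zmod.span T" using T by (auto simp: G'_def)
      then show "x \<in> zmod.span (insert w T)" by (auto simp: zmod.span_insert)
    qed
    then show ?thesis using T w by (intro exI[of _ "insert w T"]) (auto simp: G'_def)
  qed
qed

section \<open>Algebraic integers\<close>

text \<open>
  Multiplication by \<open>x\<close> acts on the generators through an integer matrix, and \<open>x\<close> is a root of its
  monic characteristic polynomial.
\<close>

lemma algebraic_int_of_stable_zmod:
  assumes "finite S" "s0 \<in> S" "s0 \<noteq> 0" "\<And>s. s \<in> S \<Longrightarrow> x * s \<in> zmod.span S"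
  shows "algebraic_int (x :: complex)"
proof -
  obtain ws where ws: "set ws = S" "distinct ws" using finite_distinct_list[OF assms(1)] by blast
  define n where "n = length ws"
  have "\<exists>c. x * ws ! i = (\<Sum>j<n. of_int (c j) * ws ! j)" if "i < n" for i
  proof -
    have "x * ws ! i \<in> zmod.span S" using that ws assms(4) by (auto simp: n_def)
    then obtain u where "x * ws ! i = (\<Sum>v\<in>S. of_int (u v) * v)"
      using zmod.span_finite[OF assms(1)] by auto
    also have "\<dots> = (\<Sum>j<n. of_int (u (ws ! j)) * ws ! j)"
      unfolding n_def using ws bij_betw_nth[OF ws(2) refl ws(1)[symmetric]]
      by (intro sum.reindex_bij_betw[symmetric]) auto
    finally show ?thesis by (intro exI[of _ "\<lambda>j. u (ws ! j)"])
  qed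
  then obtain c where c: "\<And>i. i < n \<Longrightarrow> x * ws ! i = (\<Sum>j<n. of_int (c i j) * ws ! j)" by metis
  define A where "A = mat n n (\<lambda>(i, j). c i j)"
  have A: "A \<in> carrier_mat n n" by (simp add: A_def)
  define B where "B = map_mat (of_int :: int \<Rightarrow> complex) A"
  have B: "B \<in> carrier_mat n n" using A by (simp add: B_def)
  define v where "v = vec n (\<lambda>i. ws ! i)"
  have "v \<noteq> 0\<^sub>v n"
  proof
    assume v0: "v = 0\<^sub>v n"
    obtain i where i: "i < n" "ws ! i = s0" using assms(2) ws by (metis in_set_conv_nth n_def)
    then have "v $ i = 0" using v0 by simp
    then show False using i assms(3) by (simp add: v_def)
  qed
  moreover have "B *\<^sub>v v = x \<cdot>\<^sub>v v"
  proof (rule eq_vecI)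
    fix i assume "i < dim_vec (x \<cdot>\<^sub>v v)"
    then have i: "i < n" by (simp add: v_def)
    then have "(B *\<^sub>v v) $ i = (\<Sum>j = 0..<n. of_int (c i j) * ws ! j)"
      by (simp add: B_def A_def v_def scalar_prod_def)
    also have "\<dots> = x * ws ! i" using c[OF i] by (simp add: lessThan_atLeast0)
    finally show "(B *\<^sub>v v) $ i = (x \<cdot>\<^sub>v v) $ i" using i by (simp add: v_def)
  qed (simp add: v_def B_def A_def)
  moreover have "v \<in> carrier_vec n" by (simp add: v_def)
  ultimately have "eigenvector B v x" using B by (auto simp: eigenvector_def)
  then have "eigenvalue B x" by (auto simp: eigenvalue_def)
  then have "poly (char_poly B) x = 0" using eigenvalue_root_char_poly[OF B] by simp
  moreover have "char_poly B = map_poly of_int (char_poly A)"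
    unfolding B_def by (rule of_int_hom.char_poly_hom[OF A])
  moreover have "lead_coeff (char_poly A) = 1" using degree_monic_char_poly[OF A] by simp
  ultimately show ?thesis unfolding algebraic_int_altdef_ipoly by metis
qed

lemma algebraic_int_stable_zmod:
  assumes "algebraic_int (x :: complex)"
  shows "\<exists>S. finite S \<and> 1 \<in> S \<and> (\<forall>s\<in>S. x * s \<in> zmod.span S)"
proof -
  from assms obtain p where p: "poly (map_poly of_int p) x = 0" "lead_coeff p = (1 :: int)"
    by (auto simp: algebraic_int_altdef_ipoly)
  define n where "n = degree p"
  have sum0: "(\<Sum>i\<le>n. of_int (coeff p i) * x ^ i) = 0"
    using p(1) by (simp add: poly_altdef n_def coeff_map_poly)
  have "n \<noteq> 0"
  proof
    assume "n = 0"
    then show False using sum0 p(2) by (simp add: n_def)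
  qed
  define S where "S = (\<lambda>i. x ^ i) ` {..<n}"
  have mem: "x ^ i \<in> zmod.span S" if "i < n" for i
    using that by (intro zmod.span_base) (auto simp: S_def)
  have "x ^ n = - (\<Sum>i<n. of_int (coeff p i) * x ^ i)"
    using sum0 p(2) by (simp add: lessThan_Suc_atMost[symmetric] n_def add_eq_0_iff)
  also have "\<dots> \<in> zmod.span S"
    using mem by (intro zmod.span_neg zmod.span_sum zmod.span_scale) auto
  finally have top: "x ^ n \<in> zmod.span S" .
  have "x * s \<in> zmod.span S" if "s \<in> S" for s
  proof -
    from that obtain i where i: "i < n" "s = x ^ i" by (auto simp: S_def)
    then have "x * s = x ^ Suc i" by simp
    then show ?thesis using mem[of "Suc i"] top i by (cases "Suc i = n") auto
  qed
  moreover have "finite S" "1 \<in> S" using \<open>n \<noteq> 0\<close> by (auto simp: S_def image_iff intro!: bexI[of _ 0])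
  ultimately show ?thesis by blast
qed

text \<open>
  If \<open>S\<close> spans a group stable under \<open>x\<close> and \<open>T\<close> one stable under \<open>y\<close>, the products of their elements
  span a group that is stable under both.
\<close>

lemma algebraic_int_add_mult:
  assumes "algebraic_int (x :: complex)" "algebraic_int y"
  shows "algebraic_int (x + y)" "algebraic_int (x * y)"
proof -
  obtain S where S: "finite S" "1 \<in> S" "\<And>s. s \<in> S \<Longrightarrow> x * s \<in> zmod.span S"
    using algebraic_int_stable_zmod[OF assms(1)] by blast
  obtain T where T: "finite T" "1 \<in> T" "\<And>t. t \<in> T \<Longrightarrow> y * t \<in> zmod.span T"
    using algebraic_int_stable_zmod[OF assms(2)] by blast
  define U where "U = (\<lambda>(s, t). s * t) ` (S \<times> T)"
  have U: "s * t \<in> zmod.span U" if "s \<in> S" "t \<in> T" for s t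
    using that by (intro zmod.span_base) (auto simp: U_def)
  have st: "s * t \<in> zmod.span U" if "s \<in> zmod.span S" "t \<in> zmod.span T" for s t
  proof -
    have "s' * t \<in> zmod.span U" if "s' \<in> S" for s'
      by (rule zmod_span_mult_closed[OF U[OF that] \<open>t \<in> zmod.span T\<close>])
    then show ?thesis
      using zmod_span_mult_closed[of S t U s] that by (simp add: mult.commute)
  qed
  have xU: "x * u \<in> zmod.span U" if "u \<in> U" for u
  proof -
    from that obtain s t where "s \<in> S" "t \<in> T" "u = s * t" by (auto simp: U_def)
    then show ?thesis using st[OF S(3) zmod.span_base] by (simp add: mult.assoc)
  qed
  have yU: "y * u \<in> zmod.span U" if "u \<in> U" for u
  proof -
    from that obtain s t where "s \<in> S" "t \<in> T" "u = s * t" by (auto simp: U_def)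
    then show ?thesis using st[OF zmod.span_base T(3)] by (simp add: mult.left_commute)
  qed
  have fin: "finite U" "1 \<in> U" using S T by (auto simp: U_def intro!: image_eqI[of _ _ "(1, 1)"])
  show "algebraic_int (x + y)"
    by (rule algebraic_int_of_stable_zmod[OF fin])
      (auto simp: distrib_right intro!: zmod.span_add xU yU)
  have "x * (y * u) \<in> zmod.span U" if "u \<in> U" for u
    by (rule zmod_span_mult_closed[OF xU yU[OF that]])
  then show "algebraic_int (x * y)"
    by (intro algebraic_int_of_stable_zmod[OF fin]) (auto simp: mult.assoc)
qed

lemma algebraic_int_diff: "algebraic_int (x :: complex) \<Longrightarrow> algebraic_int y \<Longrightarrow> algebraic_int (x - y)"
  using algebraic_int_add_mult(1)[of x "- y"] by simp

text \<open>
  With \<open>a\<close> the leading coefficient of an integer polynomial of degree \<open>d\<close> that vanishes at \<open>x\<close>,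
  multiplying by \<open>a ^ (d - 1)\<close> turns it into a monic integer polynomial in \<open>a x\<close>.
\<close>

lemma algebraic_imp_algebraic_int_multiple:
  assumes "algebraic (x :: complex)"
  shows "\<exists>n :: int. n \<noteq> 0 \<and> algebraic_int (of_int n * x)"
proof -
  from assms obtain p where p: "p \<noteq> 0" "poly (map_poly of_int p) x = (0::complex)"
    by (elim algebraicE')
  define d where "d = degree p"
  define a where "a = lead_coeff p"
  have a: "a \<noteq> 0" using p by (simp add: a_def)
  have d: "d > 0"
  proof (rule ccontr)
    assume "\<not> d > 0"
    then obtain c where "p = [:c:]" by (metis d_def degree_eq_zeroE gr0I)
    then show False using p by simp
  qed
  define c :: "nat \<Rightarrow> complex" where
    "c = (\<lambda>i. if i = d then 1 else of_int (coeff p i * a ^ (d - 1 - i)))"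
  define q where "q = (\<Sum>i\<le>d. monom (c i) i)"
  have "coeff q i = (if i \<le> d then c i else 0)" for i
    unfolding q_def by (simp add: coeff_sum coeff_monom)
  then have cq: "coeff q i = (if i = d then 1 else if i < d then of_int (coeff p i * a ^ (d - 1 - i)) else 0)" for i
    by (auto simp: c_def)
  have deg: "degree q = d"
  proof (rule antisym)
    show "degree q \<le> d" by (rule degree_le) (auto simp: cq)
    show "d \<le> degree q" by (rule le_degree) (simp add: cq)
  qed
  have "lead_coeff q = 1" using deg cq by simp
  moreover have "\<forall>i. coeff q i \<in> \<int>" by (auto simp: cq)
  moreover have "poly q (of_int a * x) = 0"
  proof -
    have "poly q (of_int a * x) = (\<Sum>i\<le>d. coeff q i * (of_int a * x) ^ i)"
      by (simp add: poly_altdef deg)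
    also have "\<dots> = (\<Sum>i\<le>d. of_int a ^ (d - 1) * (of_int (coeff p i) * x ^ i))"
    proof (rule sum.cong[OF refl])
      fix i assume "i \<in> {..d}"
      then consider "i = d" | "i < d" by force
      then show "coeff q i * (of_int a * x) ^ i = of_int a ^ (d - 1) * (of_int (coeff p i) * x ^ i)"
      proof cases
        case 1
        then have "(of_int a :: complex) ^ i = of_int a ^ (d - 1) * of_int a"
          using d by (metis power_minus_mult)
        then show ?thesis using 1 by (simp add: cq power_mult_distrib a_def d_def)
      next
        case 2
        then have "(of_int a :: complex) ^ (d - 1) = of_int a ^ (d - 1 - i) * of_int a ^ i"
          by (simp add: power_add[symmetric])
        then show ?thesis using 2 by (simp add: cq power_mult_distrib)
      qed
    qed
    also have "\<dots> = of_int a ^ (d - 1) * poly (map_poly of_int p) x"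
      by (simp add: poly_altdef d_def sum_distrib_left)
    finally show ?thesis using p by simp
  qed
  ultimately have "algebraic_int (of_int a * x)" by (rule algebraic_int.intros)
  then show ?thesis using a by blast
qed

lemma algebraic_of_algebraic_int_multiple:
  assumes "n \<noteq> 0" "algebraic_int (of_int n * (x :: complex))"
  shows "algebraic x"
proof -
  from assms obtain p where p: "lead_coeff p = 1" "\<forall>i. coeff p i \<in> \<int>" "poly p (of_int n * x) = 0"
    by (auto elim: algebraic_int.cases)
  define q where "q = pcompose p [:0, of_int n:]"
  have q: "coeff q i = of_int n ^ i * coeff p i" for i
    unfolding q_def by (rule coeff_pcompose_linear)
  have "coeff q (degree p) \<noteq> 0" using q p assms by simp
  then have "q \<noteq> 0" by auto
  moreover have "poly q x = 0" using p by (simp add: q_def poly_pcompose mult.commute)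
  ultimately show ?thesis using q p by (intro algebraicI[of q]) auto
qed

lemma algebraic_add_mult:
  assumes "algebraic (x :: complex)" "algebraic y"
  shows "algebraic (x + y)" "algebraic (x * y)"
proof -
  obtain m where m: "m \<noteq> 0" "algebraic_int (of_int m * x)"
    using algebraic_imp_algebraic_int_multiple[OF assms(1)] by blast
  obtain n where n: "n \<noteq> 0" "algebraic_int (of_int n * y)"
    using algebraic_imp_algebraic_int_multiple[OF assms(2)] by blast
  have "algebraic_int (of_int n * (of_int m * x) + of_int m * (of_int n * y))"
    by (intro algebraic_int_add_mult m n) auto
  then have "algebraic_int (of_int (m * n) * (x + y))" by (simp add: algebra_simps)
  then show "algebraic (x + y)" using m n by (intro algebraic_of_algebraic_int_multiple[of "m * n"]) auto
  have "algebraic_int ((of_int m * x) * (of_int n * y))"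
    by (intro algebraic_int_add_mult m n)
  then have "algebraic_int (of_int (m * n) * (x * y))" by (simp add: algebra_simps)
  then show "algebraic (x * y)" using m n by (intro algebraic_of_algebraic_int_multiple[of "m * n"]) auto
qed

section \<open>Subfields of the complex numbers\<close>

lemma field_CC: "Ring.field CC" by (rule field_from_type_algebra)

interpretation CC: cring CC
  using field_CC by (simp add: Ring.field_def domain_def)

lemma CC_simps [simp]:
  "carrier CC = UNIV" "x \<otimes>\<^bsub>CC\<^esub> y = x * y" "x \<oplus>\<^bsub>CC\<^esub> y = x + y" "\<one>\<^bsub>CC\<^esub> = 1" "\<zero>\<^bsub>CC\<^esub> = 0"
  by (simp_all add: ring_of_type_algebra_def)

lemma CC_a_inv [simp]: "\<ominus>\<^bsub>CC\<^esub> x = - x"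
  by (rule CC.minus_equality) auto

lemma CC_m_inv [simp]: "x \<noteq> 0 \<Longrightarrow> inv\<^bsub>CC\<^esub> x = inverse x"
  by (rule CC.comm_inv_char) auto

lemma subfield_CC_I:
  assumes "1 \<in> K" "\<And>x. x \<in> K \<Longrightarrow> - x \<in> K" "\<And>x y. x \<in> K \<Longrightarrow> y \<in> K \<Longrightarrow> x + y \<in> K"
    "\<And>x y. x \<in> K \<Longrightarrow> y \<in> K \<Longrightarrow> x * y \<in> K" "\<And>x. x \<in> K \<Longrightarrow> x \<noteq> 0 \<Longrightarrow> inverse x \<in> K"
  shows "subfield K CC"
  by (intro field.subfieldI'[OF field_CC] CC.subringI) (use assms in auto)

lemma subfield_CC_D:
  assumes "subfield K CC"
  shows "0 \<in> K" "1 \<in> K" "x \<in> K \<Longrightarrow> - x \<in> K" "x \<in> K \<Longrightarrow> y \<in> K \<Longrightarrow> x + y \<in> K"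
    "x \<in> K \<Longrightarrow> y \<in> K \<Longrightarrow> x - y \<in> K" "x \<in> K \<Longrightarrow> y \<in> K \<Longrightarrow> x * y \<in> K"
    "x \<in> K \<Longrightarrow> inverse x \<in> K" "x \<in> K \<Longrightarrow> y \<in> K \<Longrightarrow> x / y \<in> K"
    "of_int i \<in> K" "numeral w \<in> K" "q \<in> \<rat> \<Longrightarrow> q \<in> K"
proof -
  note S = subringE[OF subfieldE(1)[OF assms]]
  show z: "0 \<in> K" and o: "1 \<in> K" and m: "\<And>x. x \<in> K \<Longrightarrow> - x \<in> K"
    and a: "\<And>x y. x \<in> K \<Longrightarrow> y \<in> K \<Longrightarrow> x + y \<in> K"
    and t: "\<And>x y. x \<in> K \<Longrightarrow> y \<in> K \<Longrightarrow> x * y \<in> K"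
    using S(2,3) S(5)[of x for x] S(6,7) by auto
  show "x \<in> K \<Longrightarrow> y \<in> K \<Longrightarrow> x - y \<in> K" using m a by (metis add_uminus_conv_diff)
  show i: "x \<in> K \<Longrightarrow> inverse x \<in> K" for x
    using CC.subfield_m_inv(1)[OF assms, of x] z by (cases "x = 0") auto
  show d: "x \<in> K \<Longrightarrow> y \<in> K \<Longrightarrow> x / y \<in> K" for x y using t i by (simp add: divide_inverse)
  have n: "of_nat n \<in> K" for n by (induction n) (auto intro: z o a)
  show int: "of_int i \<in> K" for i
    using n m by (cases i rule: int_cases) (force simp del: of_nat_Suc)+
  show "numeral w \<in> K" using n[of "numeral w"] by simp
  show "q \<in> \<rat> \<Longrightarrow> q \<in> K" by (auto elim!: Rats_cases' intro: d int)
qed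

lemma subfield_CC_sum: "subfield K CC \<Longrightarrow> (\<And>i. i \<in> I \<Longrightarrow> f i \<in> K) \<Longrightarrow> sum f I \<in> K"
  by (induction I rule: infinite_finite_induct) (auto intro: subfield_CC_D)

lemma subfield_Rats: "subfield \<rat> CC"
  by (rule subfield_CC_I) auto

lemma ring_hom_field_ring_CC_iff:
  "h \<in> Ring.ring_hom (field_ring E) CC \<longleftrightarrow>
     h 1 = 1 \<and> (\<forall>x\<in>E. \<forall>y\<in>E. h (x * y) = h x * h y \<and> h (x + y) = h x + h y)"
  by (auto simp: Ring.ring_hom_def)

lemma ring_hom_CC_D:
  assumes "h \<in> Ring.ring_hom (field_ring E) CC" "subfield E CC"
  shows "h 1 = 1" "h 0 = 0" "x \<in> E \<Longrightarrow> y \<in> E \<Longrightarrow> h (x + y) = h x + h y"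
    "x \<in> E \<Longrightarrow> y \<in> E \<Longrightarrow> h (x * y) = h x * h y"
    "x \<in> E \<Longrightarrow> h (- x) = - h x" "x \<in> E \<Longrightarrow> y \<in> E \<Longrightarrow> h (x - y) = h x - h y"
    "h (of_int i) = of_int i" "q \<in> \<rat> \<Longrightarrow> h q = q"
    "x \<in> E \<Longrightarrow> h x = 0 \<Longrightarrow> x = 0" "x \<in> E \<Longrightarrow> h (x ^ n) = h x ^ n" "x \<in> E \<Longrightarrow> h (inverse x) = inverse (h x)"
proof -
  note D = subfield_CC_D[OF assms(2)]
  show 1: "h 1 = 1" and a: "\<And>x y. x \<in> E \<Longrightarrow> y \<in> E \<Longrightarrow> h (x + y) = h x + h y"
    and m: "\<And>x y. x \<in> E \<Longrightarrow> y \<in> E \<Longrightarrow> h (x * y) = h x * h y"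
    using assms(1) by (auto simp: ring_hom_field_ring_CC_iff)
  show 0: "h 0 = 0" using a[of 0 0] D by simp
  show n: "h (- x) = - h x" if "x \<in> E" for x
    using a[of x "-x"] D that 0 by (simp add: add_eq_0_iff)
  show "x \<in> E \<Longrightarrow> y \<in> E \<Longrightarrow> h (x - y) = h x - h y" using a[of x "-y"] n[of y] D by simp
  have nat: "h (of_nat k) = of_nat k" for k
    using D(9)[of "int k" for k] by (induction k) (auto simp: 0 1 a D)
  show int: "h (of_int i) = of_int i" for i
    using nat n D(9)[of "int k" for k] by (cases i rule: int_cases) (auto simp del: of_nat_Suc)
  show inv: "h (inverse x) = inverse (h x)" if "x \<in> E" for x
  proof (cases "x = 0")
    case False
    then have "h x * h (inverse x) = 1" using m[of x "inverse x"] D that 1 by simp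
    then show ?thesis by (metis inverse_unique)
  qed (simp add: 0)
  show "x \<in> E \<Longrightarrow> h x = 0 \<Longrightarrow> x = 0"
    using m[of x "inverse x"] D 1 by (cases "x = 0") auto
  show "h q = q" if q: "q \<in> \<rat>"
  proof -
    from q obtain i j where "q = of_int i / of_int j" by (auto elim!: Rats_cases')
    then have "h q = h (of_int i) * inverse (h (of_int j))" using m D inv by (simp add: divide_inverse)
    then show ?thesis using int \<open>q = _\<close> by (simp add: divide_inverse)
  qed
  show "x \<in> E \<Longrightarrow> h (x ^ n) = h x ^ n"
  proof (induction n)
    case (Suc n)
    have "x ^ n \<in> E" using Suc.prems by (induction n) (auto intro: D)
    then show ?case using Suc m by simp
  qed (simp add: 1)
qed

lemma ring_hom_CC_sum:
  assumes "h \<in> Ring.ring_hom (field_ring E) CC" "subfield E CC" "\<And>i. i \<in> I \<Longrightarrow> f i \<in> E"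
  shows "h (sum f I) = (\<Sum>i\<in>I. h (f i))"
  using assms(3)
  by (induction I rule: infinite_finite_induct)
    (auto simp: ring_hom_CC_D[OF assms(1,2)] subfield_CC_sum[OF assms(2)])

lemma subfield_CC_power: "subfield E CC \<Longrightarrow> x \<in> E \<Longrightarrow> x ^ n \<in> E"
  by (induction n) (auto intro: subfield_CC_D)

lemma ring_hom_CC_poly:
  assumes "h \<in> Ring.ring_hom (field_ring E) CC" "subfield E CC" "x \<in> E"
  shows "h (poly (map_poly of_int p) x) = poly (map_poly of_int p) (h x)"
proof -
  have "h (poly (map_poly of_int p) x) = h (\<Sum>i\<le>degree p. of_int (coeff p i) * x ^ i)"
    by (simp add: poly_altdef)
  also have "\<dots> = (\<Sum>i\<le>degree p. of_int (coeff p i) * h x ^ i)"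
  proof -
    have mem: "of_int (coeff p i) \<in> E" "x ^ i \<in> E" for i
      using subfield_CC_D(9)[OF assms(2)] subfield_CC_power[OF assms(2,3)] by auto
    then have "h (\<Sum>i\<le>degree p. of_int (coeff p i) * x ^ i) =
        (\<Sum>i\<le>degree p. h (of_int (coeff p i) * x ^ i))"
      by (intro ring_hom_CC_sum[OF assms(1,2)] subfield_CC_D(6)[OF assms(2)])
    also have "\<dots> = (\<Sum>i\<le>degree p. of_int (coeff p i) * h x ^ i)"
      using mem assms(3) by (intro sum.cong refl) (simp add: ring_hom_CC_D[OF assms(1,2)])
    finally show ?thesis .
  qed
  finally show ?thesis by (simp add: poly_altdef)
qed

lemma ring_hom_CC_algebraic_int:
  assumes "h \<in> Ring.ring_hom (field_ring E) CC" "subfield E CC" "x \<in> E" "algebraic_int x"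
  shows "algebraic_int (h x)"
proof -
  from assms(4) obtain p where p: "poly (map_poly of_int p) x = 0" "lead_coeff p = (1 :: int)"
    by (auto simp: algebraic_int_altdef_ipoly)
  then have "poly (map_poly of_int p) (h x) = 0"
    using ring_hom_CC_poly[OF assms(1-3), of p] ring_hom_CC_D(2)[OF assms(1,2)] by simp
  then show ?thesis unfolding algebraic_int_altdef_ipoly using p(2) by blast
qed

lemma ring_hom_CC_inj_on:
  assumes "h \<in> Ring.ring_hom (field_ring E) CC" "subfield E CC"
  shows "inj_on h E"
proof (rule inj_onI)
  fix x y assume "x \<in> E" "y \<in> E" "h x = h y"
  then have "h (x - y) = 0" "x - y \<in> E"
    using ring_hom_CC_D[OF assms] subfield_CC_D[OF assms(2)] by auto
  then have "x - y = 0" using ring_hom_CC_D(9)[OF assms] by blast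
  then show "x = y" by simp
qed

lemma line_extension_CC: "CC.line_extension K a E = {k * a + e | k e. k \<in> K \<and> e \<in> E}"
  by (auto simp: CC.line_extension_def set_add_def set_mult_def r_coset_def)

lemma dimension_Suc_CC_D:
  assumes "CC.dimension (Suc n) K E"
  shows "\<exists>v E'. v \<notin> E' \<and> CC.dimension n K E' \<and> E = {k * v + e | k e. k \<in> K \<and> e \<in> E'}"
  using assms by (cases rule: CC.dimension.cases) (use line_extension_CC in blast)

lemma dimension_0_CC_D: "CC.dimension 0 K E \<Longrightarrow> E = {0}"
  by (cases rule: CC.dimension.cases) auto

section \<open>Quadratic extensions\<close>

text \<open>
  The extension \<open>F(t)\<close> for a square root \<open>t\<close> of an element of \<open>F\<close>, not in \<open>F\<close>. It serves twice: over
  \<open>\<rat>\<close> for the quadratic fields themselves, and over a quadratic field for its unramified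
  quadratic extensions.
\<close>

locale quadratic_extension =
  fixes F :: "complex set" and t :: complex
  assumes F: "subfield F CC" and square: "t * t \<in> F" and not_in: "t \<notin> F"
begin

definition E :: "complex set" where "E = {a + b * t | a b. a \<in> F \<and> b \<in> F}"

lemmas FD = subfield_CC_D[OF F]

lemma E_I: "a \<in> F \<Longrightarrow> b \<in> F \<Longrightarrow> a + b * t \<in> E" by (auto simp: E_def)

lemma E_cases: assumes "x \<in> E" obtains a b where "a \<in> F" "b \<in> F" "x = a + b * t"
  using assms by (auto simp: E_def)

lemma coordinates_unique:
  assumes "a + b * t = a' + b' * t" "a \<in> F" "b \<in> F" "a' \<in> F" "b' \<in> F"
  shows "a = a' \<and> b = b'"
proof -
  have "(b - b') * t = a' - a" using assms(1) by (simp add: algebra_simps)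
  then have "b \<noteq> b' \<Longrightarrow> t = (a' - a) / (b - b')" by (simp add: field_simps)
  then have "b = b'" using not_in assms FD by metis
  then show ?thesis using assms by simp
qed

lemma F_subset: "F \<subseteq> E"
  using E_I[of x 0 for x] FD by auto

lemma t_in: "t \<in> E" using E_I[of 0 1] FD by auto

lemma norm_nonzero:
  assumes "a \<in> F" "b \<in> F" "a + b * t \<noteq> 0"
  shows "a * a - b * b * (t * t) \<noteq> 0"
proof
  assume "a * a - b * b * (t * t) = 0"
  then have "(a + b * t) * (a + (- b) * t) = 0" by (simp add: algebra_simps)
  then have "a + (- b) * t = 0 + 0 * t" using assms by simp
  then have "a = 0 \<and> - b = 0" using assms FD by (intro coordinates_unique) auto
  then show False using assms by simp
qed

lemma E_subfield: "subfield E CC"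
proof (rule subfield_CC_I)
  show "1 \<in> E" using E_I[of 1 0] FD by simp
  show "- x \<in> E" if "x \<in> E" for x
  proof -
    from that obtain a b where ab: "a \<in> F" "b \<in> F" "x = a + b * t" by (rule E_cases)
    then have "- x = (- a) + (- b) * t" by simp
    then show ?thesis using ab FD by (auto simp only: intro!: E_I)
  qed
  show "x + y \<in> E" if "x \<in> E" "y \<in> E" for x y
  proof -
    from \<open>x \<in> E\<close> obtain a b where ab: "a \<in> F" "b \<in> F" "x = a + b * t" by (rule E_cases)
    from \<open>y \<in> E\<close> obtain c d where cd: "c \<in> F" "d \<in> F" "y = c + d * t" by (rule E_cases)
    have "x + y = (a + c) + (b + d) * t" using ab cd by (simp add: algebra_simps)
    then show ?thesis using ab cd FD by (auto simp only: intro!: E_I)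
  qed
  show "x * y \<in> E" if "x \<in> E" "y \<in> E" for x y
  proof -
    from \<open>x \<in> E\<close> obtain a b where ab: "a \<in> F" "b \<in> F" "x = a + b * t" by (rule E_cases)
    from \<open>y \<in> E\<close> obtain c d where cd: "c \<in> F" "d \<in> F" "y = c + d * t" by (rule E_cases)
    have "x * y = (a * c + b * d * (t * t)) + (a * d + b * c) * t"
      using ab cd by (simp add: algebra_simps)
    then show ?thesis using ab cd FD square by (auto simp only: intro!: E_I)
  qed
  show "inverse x \<in> E" if "x \<in> E" "x \<noteq> 0" for x
  proof -
    from \<open>x \<in> E\<close> obtain a b where ab: "a \<in> F" "b \<in> F" "x = a + b * t" by (rule E_cases)
    define n where "n = a * a - b * b * (t * t)"
    have n: "n \<noteq> 0" "n \<in> F" using norm_nonzero[of a b] ab that FD square by (auto simp: n_def)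
    have "x * (a / n + (- b / n) * t) = n * (1 / n)"
      unfolding ab(3) n_def by (simp add: divide_inverse algebra_simps)
    also have "\<dots> = 1" using n by simp
    finally have "x * (a / n + (- b / n) * t) = 1" .
    then have "inverse x = a / n + (- b / n) * t" by (rule inverse_unique)
    then show ?thesis using ab n FD by (auto simp only: intro!: E_I)
  qed
qed

lemmas ED = subfield_CC_D[OF E_subfield]

definition conj :: "complex \<Rightarrow> complex" where
  "conj x = (THE y. \<exists>a\<in>F. \<exists>b\<in>F. x = a + b * t \<and> y = a - b * t)"

lemma conj_eq: assumes "a \<in> F" "b \<in> F" shows "conj (a + b * t) = a - b * t"
  unfolding conj_def
proof (rule the_equality)
  fix y assume "\<exists>a'\<in>F. \<exists>b'\<in>F. a + b * t = a' + b' * t \<and> y = a' - b' * t"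
  then show "y = a - b * t" using coordinates_unique assms by blast
qed (use assms in blast)

lemma conj_t: "conj t = - t" using conj_eq[of 0 1] FD by simp

lemma conj_F: "x \<in> F \<Longrightarrow> conj x = x" using conj_eq[of x 0] FD by simp

lemma conj_in: "x \<in> E \<Longrightarrow> conj x \<in> E"
  by (metis E_cases E_I FD(3) conj_eq mult_minus_left add_uminus_conv_diff)

lemma conj_conj: assumes "x \<in> E" shows "conj (conj x) = x"
proof -
  from assms obtain a b where ab: "a \<in> F" "b \<in> F" "x = a + b * t" by (rule E_cases)
  then show ?thesis using conj_eq[of a b] conj_eq[of a "-b"] FD by simp
qed

lemma trace_in: assumes "x \<in> E" shows "x + conj x \<in> F"
proof -
  from assms obtain a b where ab: "a \<in> F" "b \<in> F" "x = a + b * t" by (rule E_cases)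
  then show ?thesis using conj_eq[of a b] FD by simp
qed

lemma conj_add: assumes "x \<in> E" "y \<in> E" shows "conj (x + y) = conj x + conj y"
proof -
  from \<open>x \<in> E\<close> obtain a b where ab: "a \<in> F" "b \<in> F" "x = a + b * t" by (rule E_cases)
  from \<open>y \<in> E\<close> obtain c d where cd: "c \<in> F" "d \<in> F" "y = c + d * t" by (rule E_cases)
  have "x + y = (a + c) + (b + d) * t" using ab cd by (simp add: algebra_simps)
  moreover have "a + c \<in> F" "b + d \<in> F" using ab cd FD by auto
  ultimately have "conj (x + y) = (a + c) - (b + d) * t" by (simp only: conj_eq)
  also have "\<dots> = (a - b * t) + (c - d * t)" by (simp add: algebra_simps)
  also have "\<dots> = conj x + conj y" using ab cd by (simp only: conj_eq)
  finally show ?thesis .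
qed

lemma conj_mult: assumes "x \<in> E" "y \<in> E" shows "conj (x * y) = conj x * conj y"
proof -
  from \<open>x \<in> E\<close> obtain a b where ab: "a \<in> F" "b \<in> F" "x = a + b * t" by (rule E_cases)
  from \<open>y \<in> E\<close> obtain c d where cd: "c \<in> F" "d \<in> F" "y = c + d * t" by (rule E_cases)
  have "x * y = (a * c + b * d * (t * t)) + (a * d + b * c) * t"
    using ab cd by (simp add: algebra_simps)
  moreover have "a * c + b * d * (t * t) \<in> F" "a * d + b * c \<in> F" using ab cd FD square by auto
  ultimately have "conj (x * y) = (a * c + b * d * (t * t)) - (a * d + b * c) * t"
    by (simp only: conj_eq)
  also have "\<dots> = (a - b * t) * (c - d * t)" by (simp add: algebra_simps)
  also have "\<dots> = conj x * conj y" using ab cd by (simp only: conj_eq)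
  finally show ?thesis .
qed

lemma conj_hom: "conj \<in> Ring.ring_hom (field_ring E) CC"
  using conj_F[of 1] FD by (auto simp: ring_hom_field_ring_CC_iff conj_add conj_mult)

lemma conj_algebraic_int: "x \<in> E \<Longrightarrow> algebraic_int x \<Longrightarrow> algebraic_int (conj x)"
  by (rule ring_hom_CC_algebraic_int[OF conj_hom E_subfield])

lemma dimension_2: "CC.dimension 2 F E"
proof -
  have "CC.dimension (Suc 0) F (CC.line_extension F 1 {0})"
    using CC.dimension.Suc_dim[of 1 "{0}" 0 F] CC.dimension.zero_dim[of F] by simp
  moreover have "CC.line_extension F 1 {0} = F" by (auto simp: line_extension_CC)
  ultimately have "CC.dimension (Suc 0) F F" by simp
  then have "CC.dimension (Suc (Suc 0)) F (CC.line_extension F t F)"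
    by (intro CC.dimension.Suc_dim) (auto simp: not_in)
  moreover have "CC.line_extension F t F = E"
    by (auto simp: line_extension_CC E_def add.commute)
  ultimately show ?thesis by (simp add: numeral_2_eq_2)
qed

lemma finite_extension: "finite_extension F E"
  using dimension_2 F E_subfield F_subset CC.finite_dimensionI by (auto simp: finite_extension_def)

end

section \<open>Quadratic fields\<close>

abbreviation rt :: "int \<Rightarrow> complex" where "rt d \<equiv> csqrt (of_int d)"

lemma rt_square: "rt d * rt d = of_int d"
  by (metis power2_csqrt power2_eq_square)

text \<open>
  Only squares of units divide a squarefree integer, so the denominator of \<open>B\<close> is a unit.
\<close>

lemma rational_int_square:
  fixes d :: int and B :: complex
  assumes d: "squarefree d" and B: "B \<in> \<rat>" "of_int d * B\<^sup>2 \<in> \<int>"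
  shows "B \<in> \<int>"
proof -
  from B(1) obtain u v :: int where uv: "v > 0" "coprime u v" "B = of_int u / of_int v"
    by (rule Rats_cases')
  from B(2) obtain m where "of_int d * B\<^sup>2 = (of_int m :: complex)" by (auto elim: Ints_cases)
  then have "(of_int (d * u\<^sup>2) :: complex) = of_int (m * v\<^sup>2)"
    using uv(1) unfolding uv(3) by (simp add: power_divide divide_eq_eq)
  then have "d * u\<^sup>2 = m * v\<^sup>2" by (simp only: of_int_eq_iff)
  then have "v\<^sup>2 dvd d * u\<^sup>2" by simp
  moreover have "coprime (v\<^sup>2) (u\<^sup>2)" using uv by (simp add: coprime_commute)
  ultimately have "v\<^sup>2 dvd d" by (simp add: coprime_dvd_mult_left_iff)
  then have "v dvd 1" using d by (auto dest: squarefreeD)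
  then have "v = 1" using uv by simp
  then show ?thesis using uv by simp
qed

lemma rt_irrational:
  assumes "squarefree d" "d \<noteq> 1"
  shows "rt d \<notin> \<rat>"
proof
  assume "rt d \<in> \<rat>"
  then have "rt d \<in> \<int>"
    by (intro rational_algebraic_int_is_int algebraic_int_csqrt algebraic_int_of_int)
  then obtain k where "rt d = of_int k" by (auto elim: Ints_cases)
  then have "(of_int (k * k) :: complex) = of_int d" using rt_square[of d] by simp
  then have "d = k * k" by (simp only: of_int_eq_iff)
  then have "k dvd 1" using assms(1) by (intro squarefreeD) (auto simp: power2_eq_square)
  then have "k = 1 \<or> k = - 1" by auto
  then have "k * k = 1" by auto
  then show False using assms \<open>d = k * k\<close> by simp
qed

locale radicand =
  fixes d :: int
  assumes squarefree: "squarefree d" and not_1: "d \<noteq> 1"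
begin

sublocale quadratic_extension \<rat> "rt d"
proof (rule quadratic_extension.intro)
  show "rt d * rt d \<in> \<rat>" by (simp only: rt_square Rats_of_int)
qed (use rt_irrational[OF squarefree not_1] subfield_Rats in auto)

lemma d_nonzero: "d \<noteq> 0" using squarefree by auto

lemma quadratic_field: "quadratic_field E"
  using E_subfield dimension_2 by (simp add: quadratic_field_def)

text \<open>
  Kummer theory for a quadratic field: the square of \<open>a + b \<surd>d\<close> is rational only if \<open>a = 0\<close> or \<open>b = 0\<close>.
\<close>

lemma rt_in_imp:
  assumes "rt k \<in> E"
  shows "(\<exists>q \<in> \<rat>. of_int k = (q * q :: complex)) \<or> (\<exists>q \<in> \<rat>. of_int k = (of_int d * (q * q) :: complex))"
proof -
  from assms obtain a b where ab: "a \<in> \<rat>" "b \<in> \<rat>" "rt k = a + b * rt d" by (rule E_cases)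
  have "of_int k = (a + b * rt d) * (a + b * rt d)" using rt_square[of k] ab by simp
  also have "\<dots> = (a * a + of_int d * (b * b)) + (2 * a * b) * rt d"
    using rt_square[of d] by (simp add: algebra_simps)
  finally have eq: "(a * a + of_int d * (b * b)) + (2 * a * b) * rt d = of_int k + 0 * rt d" by simp
  have "a * a + of_int d * (b * b) = of_int k \<and> 2 * a * b = 0"
    using ab by (intro coordinates_unique[OF eq]) auto
  then show ?thesis using ab by (metis mult_eq_0_iff add_0 add_0_right mult_zero_right zero_neq_numeral)
qed

end

abbreviation quad_field :: "int \<Rightarrow> complex set" where
  "quad_field d \<equiv> quadratic_extension.E \<rat> (rt d)"

text \<open>
  By Kummer theory \<open>d\<close> is \<open>c\<close> times the square of a rational number. As \<open>c\<close> is squarefree, this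
  number is an integer, and as \<open>d\<close> is squarefree, it is \<open>\<plusminus>1\<close>.
\<close>

lemma quad_field_inject:
  assumes "squarefree c" "c \<noteq> 1" "squarefree d" "d \<noteq> 1" "quad_field c = quad_field d"
  shows "c = d"
proof -
  interpret c: radicand c by unfold_locales (use assms in auto)
  interpret d: radicand d by unfold_locales (use assms in auto)
  have "rt d \<in> c.E" using assms(5) d.t_in by simp
  from c.rt_in_imp[OF this] have "\<exists>q \<in> \<rat>. of_int d = (of_int c * (q * q) :: complex)"
  proof
    assume "\<exists>q\<in>\<rat>. of_int d = (q * q :: complex)"
    then obtain q :: complex where q: "q \<in> \<rat>" "of_int d = q * q" by blast
    have "(q - rt d) * (q + rt d) = q * q - rt d * rt d" by (simp add: algebra_simps)
    also have "\<dots> = 0" by (simp only: rt_square q(2)[symmetric] diff_self)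
    finally have "(q - rt d) * (q + rt d) = 0" .
    then have "rt d = q \<or> rt d = - q" by (auto simp: add_eq_0_iff)
    then have "rt d \<in> \<rat>" using q(1) by auto
    then show ?thesis using d.not_in by contradiction
  qed
  then obtain q :: complex where q: "q \<in> \<rat>" "of_int d = of_int c * (q * q)" by blast
  have "q \<in> \<int>"
  proof (rule rational_int_square[OF assms(1) q(1)])
    have "of_int c * q\<^sup>2 = of_int d" using q(2) by (simp add: power2_eq_square)
    then show "of_int c * q\<^sup>2 \<in> \<int>" by simp
  qed
  then obtain m where "q = of_int m" by (auto elim: Ints_cases)
  then have "(of_int d :: complex) = of_int (c * (m * m))" using q by simp
  then have "d = c * (m * m)" by (simp only: of_int_eq_iff)
  then have "m dvd 1" using assms(3) by (intro squarefreeD[of d]) (auto simp: power2_eq_square)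
  then have "m = 1 \<or> m = - 1" by auto
  then have "m * m = 1" by auto
  have "d = c * (m * m)" by fact
  also have "\<dots> = c" using \<open>m * m = 1\<close> by (simp only: mult_1_right)
  finally show ?thesis by (rule sym)
qed

lemma quadratic_field_imp:
  assumes "quadratic_field K"
  shows "\<exists>d. squarefree d \<and> d \<noteq> 1 \<and> K = quad_field d"
proof -
  have K: "subfield K CC" and dim: "CC.dimension 2 \<rat> K"
    using assms by (auto simp: quadratic_field_def)
  note KD = subfield_CC_D[OF K]
  from dimension_Suc_CC_D[OF dim[unfolded numeral_2_eq_2]] obtain v U where
    v: "v \<notin> U" "CC.dimension (Suc 0) \<rat> U" "K = {k * v + e | k e. k \<in> \<rat> \<and> e \<in> U}"
    by blast
  from dimension_Suc_CC_D[OF v(2)] obtain u V where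
    u: "u \<notin> V" "CC.dimension 0 \<rat> V" "U = {k * u + e | k e. k \<in> \<rat> \<and> e \<in> V}"
    by blast
  have V: "V = {0}" by (rule dimension_0_CC_D[OF u(2)])
  have U: "U = {k * u | k. k \<in> \<rat>}" unfolding u(3) V by simp
  have uv: "u \<noteq> 0" "v \<notin> {k * u | k. k \<in> \<rat>}" using u(1) v(1) unfolding U V by simp_all
  have K_iff: "x \<in> K \<longleftrightarrow> (\<exists>k\<in>\<rat>. \<exists>l\<in>\<rat>. x = k * v + l * u)" for x
    unfolding v(3) U by blast
  have "u = 0 * v + 1 * u" "v = 1 * v + 0 * u" by simp_all
  then have uK: "u \<in> K" and vK: "v \<in> K" unfolding K_iff by (meson Rats_0 Rats_1)+
  define w where "w = v / u"
  have wK: "w \<in> K" using uK vK KD by (simp add: w_def)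
  have wnot: "w \<notin> \<rat>"
  proof
    assume "w \<in> \<rat>"
    moreover have "v = w * u" using uv(1) by (simp add: w_def)
    ultimately show False using uv(2) by blast
  qed
  have Kw: "K = {a + b * w | a b. a \<in> \<rat> \<and> b \<in> \<rat>}"
  proof
    show "{a + b * w | a b. a \<in> \<rat> \<and> b \<in> \<rat>} \<subseteq> K" using KD wK by auto
    show "K \<subseteq> {a + b * w | a b. a \<in> \<rat> \<and> b \<in> \<rat>}"
    proof
      fix x assume "x \<in> K"
      then have "x * u \<in> K" using uK KD by simp
      then obtain k l where kl: "k \<in> \<rat>" "l \<in> \<rat>" "x * u = k * v + l * u" using K_iff by blast
      have "x = (x * u) / u" using uv(1) by simp
      also have "\<dots> = l + k * w" unfolding kl(3) w_def using uv(1) by (simp add: add_divide_distrib)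
      finally show "x \<in> {a + b * w | a b. a \<in> \<rat> \<and> b \<in> \<rat>}" using kl(1,2) by blast
    qed
  qed
  have "w * w \<in> K" using wK KD by simp
  then obtain a b where ab: "a \<in> \<rat>" "b \<in> \<rat>" "w * w = a + b * w" unfolding Kw by auto
  \<comment> \<open>Completing the square turns \<open>w\<close> into a square root of a rational number.\<close>
  define r where "r = b * b + 4 * a"
  have r_Rats: "r \<in> \<rat>" using ab by (simp add: r_def)
  have "(2 * w - b) * (2 * w - b) = 4 * (w * w) - 4 * b * w + b * b" by (simp add: algebra_simps)
  also have "\<dots> = r" unfolding ab(3) r_def by (simp add: algebra_simps)
  finally have r: "(2 * w - b) * (2 * w - b) = r" .
  from r_Rats obtain m n :: int where mn: "n > 0" "r = of_int m / of_int n" by (rule Rats_cases')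
  define N where "N = m * n"
  define d where "d = squarefree_part N"
  define f where "f = square_part N"
  have N: "N = d * f\<^sup>2" unfolding d_def f_def by (rule squarefree_decompose)
  define s where "s = of_int n * (2 * w - b)"
  have s2: "s * s = of_int N"
  proof -
    have "s * s = of_int n * of_int n * ((2 * w - b) * (2 * w - b))"
      unfolding s_def by (simp only: mult_ac)
    also have "\<dots> = of_int N" unfolding r mn(2) N_def using mn(1) by simp
    finally show ?thesis .
  qed
  have s_not: "s \<notin> \<rat>"
  proof
    assume "s \<in> \<rat>"
    then have "(s / of_int n + b) / 2 \<in> \<rat>" using ab by auto
    moreover have "(s / of_int n + b) / 2 = w" using mn by (simp add: s_def)
    ultimately show False using wnot by simp
  qed
  have f0: "f \<noteq> 0"
  proof
    assume "f = 0"
    then have "s * s = 0" unfolding s2 N by simp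
    then show False using s_not by simp
  qed
  have "(s / of_int f) * (s / of_int f) = (s * s) / (of_int f * of_int f)" by simp
  also have "\<dots> = of_int d" unfolding s2 N using f0 by (simp add: power2_eq_square)
  finally have sf: "(s / of_int f) * (s / of_int f) = of_int d" .
  have "(s / of_int f - rt d) * (s / of_int f + rt d) = (s / of_int f) * (s / of_int f) - rt d * rt d"
    by (simp add: algebra_simps)
  also have "\<dots> = 0" unfolding sf rt_square by simp
  finally have "(s / of_int f - rt d) * (s / of_int f + rt d) = 0" .
  then have rts: "rt d = s / of_int f \<or> rt d = - (s / of_int f)" by (auto simp: add_eq_0_iff)
  have sq: "squarefree d" by (simp add: d_def)
  have d1: "d \<noteq> 1"
  proof
    assume "d = 1"
    then have "s = of_int f \<or> s = - of_int f" using rts f0 by (auto simp: field_simps add_eq_0_iff)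
    then show False using s_not by auto
  qed
  interpret radicand d using sq d1 by unfold_locales
  have "w \<in> E"
  proof -
    have "of_int f * rt d \<in> E" using t_in ED by simp
    then have "s \<in> E" using rts f0 ED(3)[of "of_int f * rt d"] by auto
    moreover have "b \<in> E" using F_subset ab by blast
    ultimately have "(s / of_int n + b) / 2 \<in> E" using ED(4,8,9,10) by blast
    moreover have "(s / of_int n + b) / 2 = w" using mn by (simp add: s_def)
    ultimately show ?thesis by simp
  qed
  then have "K \<subseteq> E" unfolding Kw using ED by auto
  moreover have "E \<subseteq> K"
  proof -
    have "s \<in> K" using KD wK ab by (simp add: s_def)
    then have "rt d \<in> K" using rts KD by auto
    then show ?thesis unfolding E_def using KD by auto
  qed
  ultimately show ?thesis using sq d1 by blast
qed

section \<open>Integers and discriminants of quadratic fields\<close>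

lemma det_mat_2:
  fixes f :: "nat \<times> nat \<Rightarrow> complex"
  shows "det (mat 2 2 f) = f (0, 0) * f (1, 1) - f (0, 1) * f (1, 0)"
proof -
  have "det (mat 2 2 f) = (\<Sum>j<2. mat 2 2 f $$ (0, j) * cofactor (mat 2 2 f) 0 j)"
    by (rule laplace_expansion_row) auto
  also have "\<dots> = f (0, 0) * f (1, 1) - f (0, 1) * f (1, 0)"
  proof -
    have "cofactor (mat 2 2 f) 0 0 = f (1, 1)" "cofactor (mat 2 2 f) 0 1 = - f (1, 0)"
      unfolding cofactor_def by (auto simp: det_single mat_delete_def)
    then show ?thesis by (simp add: numeral_2_eq_2 lessThan_Suc)
  qed
  finally show ?thesis .
qed

text \<open>
  Integral bases are given by a bijection on extensional coefficient functions. Integrality,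
  generation and independence are easier to use with arbitrary coefficient functions.
\<close>

lemma integral_basis_iff:
  "integral_basis K bs \<longleftrightarrow>
     (\<forall>c :: nat \<Rightarrow> int. (\<Sum>i<length bs. of_int (c i) * bs ! i) \<in> carrier (integers K)) \<and>
     (\<forall>x \<in> carrier (integers K). \<exists>c :: nat \<Rightarrow> int. x = (\<Sum>i<length bs. of_int (c i) * bs ! i)) \<and>
     (\<forall>c :: nat \<Rightarrow> int. (\<Sum>i<length bs. of_int (c i) * bs ! i) = 0 \<longrightarrow> (\<forall>i<length bs. c i = 0))"
  (is "?L \<longleftrightarrow> ?A \<and> ?B \<and> ?C")
proof -
  let ?n = "length bs"
  let ?f = "\<lambda>c :: nat \<Rightarrow> int. \<Sum>i<?n. of_int (c i) * bs ! i"
  let ?P = "{..<?n} \<rightarrow>\<^sub>E (UNIV :: int set)"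
  have restr: "?f (restrict c {..<?n}) = ?f c" "restrict c {..<?n} \<in> ?P" for c
    by (rule sum.cong) auto
  have img: "?f ` ?P = range ?f"
  proof
    show "range ?f \<subseteq> ?f ` ?P"
    proof (rule image_subsetI)
      fix c show "?f c \<in> ?f ` ?P"
        using restr[of c] by (intro image_eqI[of _ _ "restrict c {..<?n}"]) simp_all
    qed
  qed blast
  have inj: "inj_on ?f ?P \<longleftrightarrow> ?C"
  proof
    assume inj: "inj_on ?f ?P"
    show ?C
    proof (intro allI impI)
      fix c :: "nat \<Rightarrow> int" and i assume c: "?f c = 0" and i: "i < ?n"
      have "?f (restrict c {..<?n}) = ?f (restrict (\<lambda>_. 0) {..<?n})"
        unfolding restr(1) using c by simp
      then have "restrict c {..<?n} = restrict (\<lambda>_. 0) {..<?n}"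
        using inj restr(2) by (meson inj_onD)
      then show "c i = 0" using i by (metis lessThan_iff restrict_apply')
    qed
  next
    assume C: ?C
    show "inj_on ?f ?P"
    proof (rule inj_onI)
      fix c e assume ce: "c \<in> ?P" "e \<in> ?P" "?f c = ?f e"
      have "?f (\<lambda>i. c i - e i) = 0" using ce(3) by (simp add: left_diff_distrib sum_subtractf)
      then have "\<forall>i<?n. c i - e i = 0" using C[THEN spec, of "\<lambda>i. c i - e i"] by (rule rev_mp)
      then show "c = e" using ce by (intro PiE_ext[of c "{..<?n}" _ e]) auto
    qed
  qed
  have "?L \<longleftrightarrow> inj_on ?f ?P \<and> range ?f = carrier (integers K)"
    unfolding integral_basis_def bij_betw_def img ..
  also have "range ?f = carrier (integers K) \<longleftrightarrow> ?A \<and> ?B" by (auto simp: set_eq_iff image_iff)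
  finally show ?thesis unfolding inj by blast
qed

lemma carrier_integers: "x \<in> carrier (integers K) \<longleftrightarrow> x \<in> K \<and> algebraic_int x"
  by (simp add: integers_def)

lemma rational_algebraic_int_eq_of_int:
  "a \<in> \<rat> \<Longrightarrow> algebraic_int a \<Longrightarrow> \<exists>m. a = (of_int m :: complex)"
  by (meson Ints_cases rational_algebraic_int_is_int)

lemma half_one_plus_sqrt_algebraic_int:
  assumes "n mod 4 = 1"
  shows "algebraic_int ((1 + rt n) / 2)"
proof -
  define k where "k = n div 4"
  have n: "n = 4 * k + 1" using assms unfolding k_def by presburger
  have "(1 + w) / 2 * ((1 + w) / 2) - (1 + w) / 2 = (w * w - 1) / 4" for w :: complex
    by (simp add: field_simps)
  from this[of "rt n"] have "(1 + rt n) / 2 * ((1 + rt n) / 2) - (1 + rt n) / 2 = (of_int n - 1) / 4"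
    unfolding rt_square .
  also have "\<dots> = of_int k" unfolding n by simp
  finally have eq: "(1 + rt n) / 2 * ((1 + rt n) / 2) - (1 + rt n) / 2 = of_int k" .
  have "poly [:- of_int k, - 1, 1:] ((1 + rt n) / 2) = ((1 + rt n) / 2 * ((1 + rt n) / 2) - (1 + rt n) / 2) - of_int k"
    by (simp add: algebra_simps)
  also have "\<dots> = 0" unfolding eq by simp
  finally show ?thesis
    by (intro algebraic_int.intros[of "[:- of_int k, - 1, 1:]"]) (auto simp: coeff_pCons split: nat.splits)
qed

context radicand
begin

definition gen :: complex where
  "gen = (if d mod 4 = 1 then (1 + rt d) / 2 else rt d)"

definition D :: int where "D = (if d mod 4 = 1 then d else 4 * d)"

lemma gen_in: "gen \<in> E"
  unfolding gen_def using t_in ED by auto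

lemma conj_gen_diff: "(conj gen - gen)\<^sup>2 = of_int D"
proof -
  have "conj ((1 + rt d) / 2) = (1 - rt d) / 2"
    using conj_eq[of "1 / 2" "1 / 2"] by (simp add: add_divide_distrib diff_divide_distrib)
  moreover have "rt d ^ 2 = of_int d" by simp
  ultimately show ?thesis
    using conj_t by (simp add: gen_def D_def power2_eq_square diff_divide_distrib add_divide_distrib)
qed

lemma gen_algebraic_int: "algebraic_int gen"
  by (simp add: gen_def half_one_plus_sqrt_algebraic_int algebraic_int_csqrt)

lemma gen_coordinates_unique:
  assumes "of_int m + of_int n * gen = of_int m' + of_int n' * gen"
  shows "m = m' \<and> n = n'"
proof (cases "d mod 4 = 1")
  case True
  have "of_int m + of_int n * gen = (of_int m + of_int n / 2) + of_int n / 2 * rt d" for m n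
    using True by (simp add: gen_def distrib_left add_divide_distrib)
  then have "(of_int m + of_int n / 2) + of_int n / 2 * rt d = (of_int m' + of_int n' / 2) + of_int n' / 2 * rt d"
    using assms by metis
  then have "of_int m + of_int n / 2 = of_int m' + (of_int n' / 2 :: complex) \<and> of_int n / 2 = (of_int n' / 2 :: complex)"
    by (rule coordinates_unique) auto
  then show ?thesis by auto
next
  case False
  then have "of_int m + of_int n * rt d = of_int m' + of_int n' * rt d"
    using assms by (simp add: gen_def)
  then have "of_int m = (of_int m' :: complex) \<and> of_int n = (of_int n' :: complex)"
    by (rule coordinates_unique) auto
  then show ?thesis by auto
qed

text \<open>
  Trace and norm of \<open>x = a + b \<surd>d\<close> are integers, so \<open>A = 2a\<close> and \<open>B = 2b\<close> are integers with
  \<open>A\<^sup>2 \<equiv> d B\<^sup>2 mod 4\<close>. As \<open>d\<close> is not divisible by 4, this forces \<open>A\<close> and \<open>B\<close> to have equal parity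
  when \<open>d \<equiv> 1 mod 4\<close> and to be even otherwise.
\<close>

lemma carrier_integers_iff:
  "x \<in> carrier (integers E) \<longleftrightarrow> (\<exists>m n :: int. x = of_int m + of_int n * gen)"
proof
  assume "\<exists>m n :: int. x = of_int m + of_int n * gen"
  then obtain m n :: int where x: "x = of_int m + of_int n * gen" by blast
  have "algebraic_int x" unfolding x
    by (intro algebraic_int_add_mult algebraic_int_of_int gen_algebraic_int)
  moreover have "x \<in> E" unfolding x using ED gen_in by auto
  ultimately show "x \<in> carrier (integers E)" by (simp add: carrier_integers)
next
  assume "x \<in> carrier (integers E)"
  then have xE: "x \<in> E" and xi: "algebraic_int x" by (auto simp: carrier_integers)
  from xE obtain a b where ab: "a \<in> \<rat>" "b \<in> \<rat>" "x = a + b * rt d" by (rule E_cases)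
  have cx: "conj x = a - b * rt d" unfolding ab(3) by (rule conj_eq[OF ab(1,2)])
  have ci: "algebraic_int (conj x)" by (rule conj_algebraic_int[OF xE xi])
  have "x + conj x = 2 * a" unfolding cx unfolding ab(3) by simp
  then have "algebraic_int (2 * a)" using algebraic_int_add_mult(1)[OF xi ci] by simp
  then obtain A where A: "2 * a = of_int A"
    using rational_algebraic_int_eq_of_int[of "2 * a"] ab(1) by auto
  have "x * conj x = a * a - b * b * (rt d * rt d)"
    unfolding cx unfolding ab(3) by (simp add: algebra_simps)
  then have xc: "x * conj x = a * a - b * b * of_int d" unfolding rt_square .
  then have "a * a - b * b * of_int d \<in> \<rat>" "algebraic_int (a * a - b * b * of_int d)"
    using algebraic_int_add_mult(2)[OF xi ci] ab by auto
  then obtain N where N: "a * a - b * b * of_int d = of_int N"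
    using rational_algebraic_int_eq_of_int by blast
  have "of_int d * (2 * b)\<^sup>2 = (2 * a) * (2 * a) - 4 * (a * a - b * b * of_int d)"
    by (simp add: power2_eq_square)
  also have "\<dots> = of_int (A * A - 4 * N)" unfolding A N by simp
  finally have dB: "of_int d * (2 * b)\<^sup>2 = of_int (A * A - 4 * N)" .
  have "2 * b \<in> \<int>"
    by (rule rational_int_square[OF squarefree]) (use ab dB in auto)
  then obtain B where B: "2 * b = of_int B" by (auto elim: Ints_cases)
  have "(of_int (d * B\<^sup>2) :: complex) = of_int (A * A - 4 * N)" using dB unfolding B by simp
  then have key: "d * B\<^sup>2 = A * A - 4 * N" by (simp only: of_int_eq_iff)
  have aA: "a = of_int A / 2" and bB: "b = of_int B / 2" using A B by (auto simp: field_simps)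
  show "\<exists>m n :: int. x = of_int m + of_int n * gen"
  proof (cases "d mod 4 = 1")
    case True
    then have "odd d" by presburger
    have "even (d * B\<^sup>2) \<longleftrightarrow> even (A * A)" unfolding key by simp
    then have "even (A - B)" using \<open>odd d\<close> by auto
    then obtain m where m: "A = B + 2 * m" by (metis evenE add.commute diff_add_cancel)
    have "x = of_int m + of_int B * gen"
      using True unfolding ab(3) aA bB m by (simp add: gen_def add_divide_distrib algebra_simps)
    then show ?thesis by blast
  next
    case False
    have "\<not> 2\<^sup>2 dvd d" using squarefreeD[OF squarefree, of 2] by auto
    then have d4: "d mod 4 = 2 \<or> d mod 4 = 3" using False by (simp add: dvd_eq_mod_eq_0) presburger
    have evB: "even B"
    proof (rule ccontr)
      assume "odd B"
      then obtain k where "B = 2 * k + 1" by (rule oddE)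
      then have "d * B\<^sup>2 = d + 4 * (d * (k * k + k))" by (simp add: power2_eq_square algebra_simps)
      then have "A * A = d + 4 * (d * (k * k + k) + N)" using key by simp
      then have "(A * A) mod 4 = (d + 4 * (d * (k * k + k) + N)) mod 4" by (rule arg_cong)
      also have "\<dots> = d mod 4" by (rule mod_mult_self2)
      finally have m: "(A * A) mod 4 = d mod 4" .
      show False
      proof (cases "even A")
        case True
        then obtain j where "A = 2 * j" by (rule evenE)
        then have "(A * A) mod 4 = 0" by simp
        then show False using m d4 by simp
      next
        case False
        then obtain j where "A = 2 * j + 1" by (rule oddE)
        then have "A * A = 1 + 4 * (j * j + j)" by (simp add: algebra_simps)
        then have "(A * A) mod 4 = (1 + 4 * (j * j + j)) mod 4" by (rule arg_cong)
        also have "\<dots> = 1 mod 4" by (rule mod_mult_self2)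
        finally have "(A * A) mod 4 = 1" by simp
        then show False using m d4 by simp
      qed
    qed
    have "even (d * B\<^sup>2) \<longleftrightarrow> even (A * A)" unfolding key by simp
    then have "even A" using evB by auto
    then obtain m n where "A = 2 * m" "B = 2 * n" using evB by (auto elim!: evenE)
    then have "x = of_int m + of_int n * gen" using False unfolding ab(3) aA bB by (simp add: gen_def)
    then show ?thesis by blast
  qed
qed

lemma conj_int_combination: "conj (of_int m + of_int n * gen) = of_int m + of_int n * conj gen"
  using gen_in ED by (simp add: conj_add conj_mult conj_F)

lemma embeddings_eq: "embeddings E = {restrict id E, restrict conj E}"
proof
  show "{restrict id E, restrict conj E} \<subseteq> embeddings E"
    by (auto simp: embeddings_def ring_hom_field_ring_CC_iff ED conj_add conj_mult conj_F)
  show "embeddings E \<subseteq> {restrict id E, restrict conj E}"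
  proof
    fix h assume "h \<in> embeddings E"
    then have ext: "h \<in> extensional E" and hom: "h \<in> Ring.ring_hom (field_ring E) CC"
      by (auto simp: embeddings_def)
    note h = ring_hom_CC_D[OF hom E_subfield]
    have "h (rt d * rt d) = h (rt d) * h (rt d)" using t_in by (simp only: h(4))
    then have "h (rt d) * h (rt d) = rt d * rt d" unfolding rt_square h(7) ..
    then have "h (rt d) = rt d \<or> h (rt d) = - rt d" by (simp only: square_eq_iff)
    moreover have lin: "h (a + b * rt d) = a + b * h (rt d)" if "a \<in> \<rat>" "b \<in> \<rat>" for a b
    proof -
      have "a \<in> E" "b \<in> E" using F_subset that by auto
      then show ?thesis using h(3,4,8) ED t_in that by simp
    qed
    ultimately consider "\<And>x. x \<in> E \<Longrightarrow> h x = x" | "\<And>x. x \<in> E \<Longrightarrow> h x = conj x"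
    proof (elim disjE)
      assume that1: "(\<And>x. x \<in> E \<Longrightarrow> h x = x) \<Longrightarrow> thesis" and "h (rt d) = rt d"
      then have "h x = x" if "x \<in> E" for x
        using that by (elim E_cases) (simp only: lin)
      then show thesis by (rule that1)
    next
      assume that2: "(\<And>x. x \<in> E \<Longrightarrow> h x = conj x) \<Longrightarrow> thesis" and "h (rt d) = - rt d"
      then have "h x = conj x" if "x \<in> E" for x
        using that by (elim E_cases) (simp only: lin conj_eq mult_minus_right add_uminus_conv_diff)
      then show thesis by (rule that2)
    qed
    then show "h \<in> {restrict id E, restrict conj E}"
    proof cases
      case 1
      then have "h = restrict id E" using ext by (intro extensionalityI[OF ext]) auto
      then show ?thesis by simp
    next
      case 2
      then have "h = restrict conj E" using ext by (intro extensionalityI[OF ext]) auto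
      then show ?thesis by simp
    qed
  qed
qed

lemma embeddings_distinct: "restrict id E \<noteq> restrict conj E"
proof
  assume "restrict id E = restrict conj E"
  then have "rt d = conj (rt d)" using t_in by (metis id_apply restrict_apply')
  then have "rt d = 0" using conj_t by simp
  then show False using d_nonzero by simp
qed

text \<open>
  The discriminant is defined as the only value attained at any integral basis of any length, so
  bases of a wrong length, for which the determinant of the non-square matrix is 0 by convention,
  have to be excluded.
\<close>

lemma integral_basis_length:
  assumes "integral_basis E bs"
  shows "length bs = 2"
proof -
  note B = assms[unfolded integral_basis_iff]
  note B1 = B[THEN conjunct1, THEN spec]
  note B3 = B[THEN conjunct2, THEN conjunct2, THEN spec, THEN mp, THEN spec, THEN mp]
  let ?n = "length bs"
  have gen_combination: "\<exists>c :: nat \<Rightarrow> int. of_int m + of_int n * gen = (\<Sum>i<?n. of_int (c i) * bs ! i)" for m n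
    using B carrier_integers_iff by blast
  have coord: "\<exists>m n. bs ! i = of_int m + of_int n * gen" if "i < ?n" for i
  proof -
    have "(\<Sum>j<?n. of_int (if j = i then 1 else 0 :: int) * bs ! j) \<in> carrier (integers E)"
      by (rule B1)
    moreover have "(\<Sum>j<?n. of_int (if j = i then 1 else 0 :: int) * bs ! j) = bs ! i"
    proof -
      have "(\<Sum>j<?n. of_int (if j = i then 1 else 0 :: int) * bs ! j) = (\<Sum>j<?n. if j = i then bs ! j else 0)"
        by (rule sum.cong) auto
      then show ?thesis using that by simp
    qed
    ultimately show ?thesis using carrier_integers_iff by simp
  qed
  have "?n \<noteq> 0"
  proof
    assume "?n = 0"
    then show False using gen_combination[of 1 0] by simp
  qed
  moreover have "?n \<noteq> 1"
  proof
    assume n1: "?n = 1"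
    then obtain c e :: int where ce: "1 = of_int c * bs ! 0" "gen = of_int e * bs ! 0"
      using gen_combination[of 1 0] gen_combination[of 0 1] by auto
    then have "of_int e + of_int 0 * gen = of_int 0 + of_int c * gen"
      by (metis add.left_neutral add.right_neutral mult.left_commute mult.right_neutral mult_zero_left of_int_0)
    then have "c = 0" using gen_coordinates_unique by blast
    then show False using ce by simp
  qed
  moreover have "\<not> ?n \<ge> 3"
  proof
    assume n3: "?n \<ge> 3"
    then have lens: "0 < ?n" "1 < ?n" "2 < ?n" by linarith+
    then obtain m0 n0 m1 n1 m2 n2 where b: "bs ! 0 = of_int m0 + of_int n0 * gen"
      "bs ! 1 = of_int m1 + of_int n1 * gen" "bs ! 2 = of_int m2 + of_int n2 * gen"
      using coord by meson
    \<comment> \<open>Three vectors of rank two satisfy a relation whose coefficients are the entries of a cross product.\<close>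
    have rel: "c0 = 0 \<and> c1 = 0 \<and> c2 = 0"
      if "c0 * m0 + c1 * m1 + c2 * m2 = 0" "c0 * n0 + c1 * n1 + c2 * n2 = 0" for c0 c1 c2
    proof -
      define c where "c = (\<lambda>i :: nat. if i = 0 then c0 else if i = 1 then c1 else if i = 2 then c2 else 0)"
      have "(\<Sum>i<?n. of_int (c i) * bs ! i) = (\<Sum>i\<in>{0,1,2}. of_int (c i) * bs ! i)"
        using n3 by (intro sum.mono_neutral_right) (auto simp: c_def)
      also have "\<dots> = of_int c0 * bs ! 0 + of_int c1 * bs ! 1 + of_int c2 * bs ! 2"
        by (simp add: c_def)
      also have "\<dots> = of_int (c0 * m0 + c1 * m1 + c2 * m2) + of_int (c0 * n0 + c1 * n1 + c2 * n2) * gen"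
        unfolding b of_int_add of_int_mult by (simp only: algebra_simps)
      also have "\<dots> = 0" unfolding that by simp
      finally have "c i = 0" if "i < ?n" for i using that by (rule B3)
      then have "c 0 = 0" "c 1 = 0" "c 2 = 0" using lens by blast+
      then show ?thesis by (simp add: c_def)
    qed
    \<comment> \<open>If the cross product vanishes, the first two vectors are proportional, which gives relations
      between these two alone.\<close>
    have "m0 * n1 - m1 * n0 = 0"
      using rel[of "m1 * n2 - m2 * n1" "m2 * n0 - m0 * n2" "m0 * n1 - m1 * n0"] by (simp add: algebra_simps)
    then have "n1 = 0 \<and> - n0 = 0 \<and> (0 :: int) = 0" "m1 = 0 \<and> - m0 = 0 \<and> (0 :: int) = 0"
      by (intro rel; simp add: algebra_simps)+
    then have "(1 :: int) = 0 \<and> (0 :: int) = 0 \<and> (0 :: int) = 0" by (intro rel) auto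
    then show False by simp
  qed
  ultimately show ?thesis by linarith
qed

lemma integral_basis_gen: "integral_basis E [1, gen]"
proof -
  have sum: "(\<Sum>i<length [1, gen]. of_int (c i) * [1, gen] ! i) = of_int (c 0) + of_int (c 1) * gen"
    for c :: "nat \<Rightarrow> int"
    by (simp add: numeral_2_eq_2 lessThan_Suc)
  show ?thesis unfolding integral_basis_iff sum
  proof (intro conjI allI ballI impI)
    fix x assume "x \<in> carrier (integers E)"
    then obtain m n :: int where "x = of_int m + of_int n * gen" using carrier_integers_iff by blast
    then show "\<exists>c :: nat \<Rightarrow> int. x = of_int (c 0) + of_int (c 1) * gen"
      by (intro exI[of _ "\<lambda>i. if i = 0 then m else n"]) simp
  next
    fix c :: "nat \<Rightarrow> int" and i
    assume c: "of_int (c 0) + of_int (c 1) * gen = 0" and i: "i < length [1, gen]"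
    have "of_int (c 0) + of_int (c 1) * gen = of_int 0 + of_int 0 * gen" using c by simp
    then have "c 0 = 0 \<and> c 1 = 0" by (rule gen_coordinates_unique)
    then show "c i = 0" using i by (auto simp: less_Suc_eq)
  qed (use carrier_integers_iff in blast)
qed

text \<open>
  Two integral bases differ by an integer matrix of determinant \<open>\<plusminus>1\<close>, and interchanging the two
  embeddings changes the sign of the determinant; neither affects the square.
\<close>

lemma discriminant_of_basis:
  assumes bs: "integral_basis E bs" and ss: "distinct ss" "set ss = embeddings E"
  shows "(det (mat (length ss) (length bs) (\<lambda>(i, j). (ss ! i) (bs ! j))))\<^sup>2 = of_int D"
proof -
  have lb: "length bs = 2" by (rule integral_basis_length[OF bs])
  have "length ss = card (set ss)" using ss(1) by (simp add: distinct_card)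
  also have "\<dots> = 2" unfolding ss(2) embeddings_eq using embeddings_distinct by simp
  finally have ls: "length ss = 2" .
  define x where "x = bs ! 0"
  define y where "y = bs ! 1"
  have sum: "(\<Sum>i<length bs. of_int (c i) * bs ! i) = of_int (c 0) * x + of_int (c 1) * y" for c :: "nat \<Rightarrow> int"
    unfolding lb by (simp add: numeral_2_eq_2 lessThan_Suc x_def y_def)
  note B = bs[unfolded integral_basis_iff sum]
  have "x \<in> carrier (integers E)"
    using B[THEN conjunct1, THEN spec, of "\<lambda>i. if i = 0 then 1 else 0"] by simp
  then obtain m1 n1 where x: "x = of_int m1 + of_int n1 * gen" using carrier_integers_iff by auto
  have "y \<in> carrier (integers E)"
    using B[THEN conjunct1, THEN spec, of "\<lambda>i. if i = 0 then 0 else 1"] by simp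
  then obtain m2 n2 where y: "y = of_int m2 + of_int n2 * gen" using carrier_integers_iff by auto
  have "of_int 1 + of_int 0 * gen \<in> carrier (integers E)" using carrier_integers_iff by blast
  then obtain p1 q1 :: int where 1: "of_int 1 + of_int 0 * gen = of_int p1 * x + of_int q1 * y" using B by blast
  have "of_int 0 + of_int 1 * gen \<in> carrier (integers E)" using carrier_integers_iff by blast
  then obtain p2 q2 :: int where 2: "of_int 0 + of_int 1 * gen = of_int p2 * x + of_int q2 * y" using B by blast
  have combine: "of_int p * x + of_int q * y = of_int (p * m1 + q * m2) + of_int (p * n1 + q * n2) * gen" for p q
    unfolding x y of_int_add of_int_mult by (simp only: algebra_simps)
  have "of_int 1 + of_int 0 * gen = of_int (p1 * m1 + q1 * m2) + of_int (p1 * n1 + q1 * n2) * gen"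
    using 1 unfolding combine .
  then have e1: "1 = p1 * m1 + q1 * m2" "0 = p1 * n1 + q1 * n2"
    using gen_coordinates_unique by blast+
  have "of_int 0 + of_int 1 * gen = of_int (p2 * m1 + q2 * m2) + of_int (p2 * n1 + q2 * n2) * gen"
    using 2 unfolding combine .
  then have e2: "0 = p2 * m1 + q2 * m2" "1 = p2 * n1 + q2 * n2"
    using gen_coordinates_unique by blast+
  have "(m1 * n2 - m2 * n1) * (p1 * q2 - p2 * q1) =
      (p1 * m1 + q1 * m2) * (p2 * n1 + q2 * n2) - (p2 * m1 + q2 * m2) * (p1 * n1 + q1 * n2)"
    by (simp add: algebra_simps)
  also have "\<dots> = 1" unfolding e1[symmetric] e2[symmetric] by simp
  finally have "m1 * n2 - m2 * n1 = 1 \<or> m1 * n2 - m2 * n1 = - 1"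
    by (auto simp: zmult_eq_1_iff)
  then have unit: "(m1 * n2 - m2 * n1)\<^sup>2 = 1" by auto
  have xE: "x \<in> E" "y \<in> E" unfolding x y using gen_in ED by auto
  have "det (mat (length ss) (length bs) (\<lambda>(i, j). (ss ! i) (bs ! j))) =
      (ss ! 0) x * (ss ! 1) y - (ss ! 0) y * (ss ! 1) x"
    unfolding ls lb det_mat_2 by (simp add: x_def y_def)
  moreover have "(ss ! 0 = restrict id E \<and> ss ! 1 = restrict conj E) \<or>
      (ss ! 0 = restrict conj E \<and> ss ! 1 = restrict id E)"
  proof -
    have mem: "ss ! 0 \<in> set ss" "ss ! 1 \<in> set ss" using ls by auto
    have "ss ! 0 \<noteq> ss ! 1" using ls ss(1) by (simp add: nth_eq_iff_index_eq)
    then show ?thesis using mem unfolding ss(2) embeddings_eq by auto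
  qed
  ultimately have "det (mat (length ss) (length bs) (\<lambda>(i, j). (ss ! i) (bs ! j))) = x * conj y - y * conj x \<or>
      det (mat (length ss) (length bs) (\<lambda>(i, j). (ss ! i) (bs ! j))) = - (x * conj y - y * conj x)"
    using xE by (elim disjE) (simp_all add: mult.commute)
  then have "(det (mat (length ss) (length bs) (\<lambda>(i, j). (ss ! i) (bs ! j))))\<^sup>2 =
      (x * conj y - y * conj x)\<^sup>2"
    by (elim disjE) (simp_all only: power2_minus)
  also have "\<dots> = (of_int (m1 * n2 - m2 * n1) * (conj gen - gen))\<^sup>2"
  proof -
    have "(a + b * g) * (a' + b' * g') - (a' + b' * g) * (a + b * g') = (a * b' - a' * b) * (g' - g)"
      for a b a' b' g g' :: complex by (simp add: algebra_simps)
    then show ?thesis unfolding x y conj_int_combination of_int_diff of_int_mult by (rule arg_cong)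
  qed
  also have "\<dots> = of_int ((m1 * n2 - m2 * n1)\<^sup>2) * (conj gen - gen)\<^sup>2"
    by (simp only: power_mult_distrib of_int_power)
  also have "\<dots> = of_int D" unfolding unit conj_gen_diff by simp
  finally show ?thesis .
qed

lemma disc_eq: "disc E = D"
  unfolding disc_def
proof (rule the_equality)
  let ?ss = "[restrict id E, restrict conj E]"
  have ss: "distinct ?ss" "set ?ss = embeddings E"
    using embeddings_distinct embeddings_eq by auto
  show "\<exists>bs ss. integral_basis E bs \<and> distinct ss \<and> set ss = embeddings E \<and>
      of_int D = (det (mat (length ss) (length bs) (\<lambda>(i, j). (ss ! i) (bs ! j))))\<^sup>2"
    using integral_basis_gen ss discriminant_of_basis[OF integral_basis_gen ss] by metis
next
  fix d' assume "\<exists>bs ss. integral_basis E bs \<and> distinct ss \<and> set ss = embeddings E \<and>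
      of_int d' = (det (mat (length ss) (length bs) (\<lambda>(i, j). (ss ! i) (bs ! j))))\<^sup>2"
  then have "(of_int d' :: complex) = of_int D" using discriminant_of_basis by metis
  then show "d' = D" by simp
qed

lemma disc_bounds: "\<bar>d\<bar> \<le> \<bar>disc E\<bar>" "\<bar>disc E\<bar> \<le> 4 * \<bar>d\<bar>"
  by (auto simp: disc_eq D_def abs_mult)

end

section \<open>Automorphisms of the field of algebraic numbers\<close>

abbreviation Alg :: "complex set" where "Alg \<equiv> {x. algebraic x}"

lemma subfield_Alg: "subfield Alg CC"
  by (rule subfield_CC_I) (auto intro: algebraic_add_mult)

text \<open>
  A homomorphism into \<open>\<complex>\<close> defined on some ring of algebraic numbers, represented by its graph: a
  subring of \<open>\<complex> \<times> \<complex>\<close> that is single-valued at 0, and therefore everywhere. For graphs, extension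
  is inclusion, as Zorn's lemma wants it.
\<close>

definition partial_hom :: "(complex \<times> complex) set \<Rightarrow> bool" where
  "partial_hom R \<longleftrightarrow> (1, 1) \<in> R \<and> (\<forall>a b. (a, b) \<in> R \<longrightarrow> (- a, - b) \<in> R) \<and>
     (\<forall>a b c d. (a, b) \<in> R \<longrightarrow> (c, d) \<in> R \<longrightarrow> (a + c, b + d) \<in> R \<and> (a * c, b * d) \<in> R) \<and>
     (\<forall>b. (0, b) \<in> R \<longrightarrow> b = 0) \<and> (\<forall>a b. (a, b) \<in> R \<longrightarrow> algebraic a)"

lemma partial_homD:
  assumes "partial_hom R"
  shows "(1, 1) \<in> R" "(a, b) \<in> R \<Longrightarrow> (- a, - b) \<in> R"
    "(a, b) \<in> R \<Longrightarrow> (c, d) \<in> R \<Longrightarrow> (a + c, b + d) \<in> R"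
    "(a, b) \<in> R \<Longrightarrow> (c, d) \<in> R \<Longrightarrow> (a * c, b * d) \<in> R"
    "(0, b) \<in> R \<Longrightarrow> b = 0" "(a, b) \<in> R \<Longrightarrow> algebraic a"
  using assms by (auto simp: partial_hom_def)

lemma partial_hom_0: "partial_hom R \<Longrightarrow> (0, 0) \<in> R"
  using partial_homD(3)[of R 1 1 "-1" "-1"] partial_homD(1,2)[of R] by simp

lemma partial_hom_diff:
  "partial_hom R \<Longrightarrow> (a, b) \<in> R \<Longrightarrow> (c, d) \<in> R \<Longrightarrow> (a - c, b - d) \<in> R"
  using partial_homD(3)[of R a b "-c" "-d"] partial_homD(2)[of R] by simp

lemma partial_hom_unique:
  assumes "partial_hom R" "(a, b) \<in> R" "(a, c) \<in> R"
  shows "b = c"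
  using partial_hom_diff[OF assms] partial_homD(5)[OF assms(1), of "b - c"] by simp

lemma partial_hom_of_int:
  assumes "partial_hom R"
  shows "(of_int i, of_int i) \<in> R"
proof -
  have nat: "(of_nat n, of_nat n) \<in> R" for n
    by (induction n) (auto intro: partial_hom_0 partial_homD assms)
  show ?thesis
  proof (cases i)
    case (nonneg n)
    then show ?thesis using nat[of n] by simp
  next
    case (neg n)
    then show ?thesis using partial_homD(2)[OF assms nat[of "Suc n"]] by (simp only: of_int_minus of_int_of_nat_eq)
  qed
qed

lemma partial_hom_sum:
  assumes "partial_hom R" "\<And>i. i \<in> I \<Longrightarrow> (f i, g i) \<in> R"
  shows "(sum f I, sum g I) \<in> R"
  using assms(2)
  by (induction I rule: infinite_finite_induct) (auto intro: partial_hom_0 partial_homD assms(1))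

lemma partial_hom_power: "partial_hom R \<Longrightarrow> (a, b) \<in> R \<Longrightarrow> (a ^ n, b ^ n) \<in> R"
  by (induction n) (auto intro: partial_homD)

lemma partial_hom_poly:
  assumes "partial_hom R" "(a, b) \<in> R"
  shows "(poly (map_poly of_int p) a, poly (map_poly of_int p) b) \<in> R"
  unfolding poly_altdef
  by (auto intro!: partial_hom_sum partial_homD(4) partial_hom_power partial_hom_of_int assms)

text \<open>
  A nonzero algebraic \<open>a\<close> is a root of an integer polynomial \<open>p\<close> with \<open>p(0) \<noteq> 0\<close>. If \<open>a\<close> were mapped
  to 0, then \<open>p(a) = 0\<close> would be mapped to \<open>p(0)\<close>.
\<close>

lemma partial_hom_injective:
  assumes "partial_hom R" "(a, 0) \<in> R"
  shows "a = 0"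
proof (rule ccontr)
  assume "a \<noteq> 0"
  then obtain p where p: "coeff p 0 \<noteq> 0" "poly (map_poly of_int p) a = 0"
    using algebraicE'_nonzero[OF partial_homD(6)[OF assms]] by metis
  have "(poly (map_poly of_int p) a, poly (map_poly of_int p) 0) \<in> R"
    by (rule partial_hom_poly[OF assms])
  then have "poly (map_poly of_int p) 0 = (0 :: complex)"
    unfolding p(2) by (rule partial_homD(5)[OF assms(1)])
  then show False using p(1) by (simp add: poly_0_coeff_0)
qed

text \<open>
  The graph of the homomorphism of polynomial rings that the partial homomorphism \<open>R\<close> induces.
\<close>

definition coeff_pair :: "(complex \<times> complex) set \<Rightarrow> complex poly \<Rightarrow> complex poly \<Rightarrow> bool" where
  "coeff_pair R p q \<longleftrightarrow> (\<forall>i. (coeff p i, coeff q i) \<in> R)"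

definition adjoin :: "(complex \<times> complex) set \<Rightarrow> complex \<Rightarrow> complex \<Rightarrow> (complex \<times> complex) set" where
  "adjoin R \<alpha> \<beta> = {(poly p \<alpha>, poly q \<beta>) | p q. coeff_pair R p q}"

lemma coeff_pair_ops:
  assumes R: "partial_hom R" and pq: "coeff_pair R p q" "coeff_pair R p' q'"
  shows "coeff_pair R (p + p') (q + q')"
    "coeff_pair R (p - p') (q - q')" "coeff_pair R (p * p') (q * q')"
  using pq partial_homD[OF R] partial_hom_diff[OF R]
  by (auto simp: coeff_pair_def coeff_mult intro!: partial_hom_sum[OF R])

lemma coeff_pair_smult:
  "partial_hom R \<Longrightarrow> (a, b) \<in> R \<Longrightarrow> coeff_pair R p q \<Longrightarrow> coeff_pair R (smult a p) (smult b q)"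
  by (auto simp: coeff_pair_def partial_homD)

lemma coeff_pair_uminus: "partial_hom R \<Longrightarrow> coeff_pair R p q \<Longrightarrow> coeff_pair R (- p) (- q)"
  by (auto simp: coeff_pair_def partial_homD)

lemma coeff_pair_monom: "partial_hom R \<Longrightarrow> (a, b) \<in> R \<Longrightarrow> coeff_pair R (monom a n) (monom b n)"
  by (auto simp: coeff_pair_def coeff_monom partial_hom_0)

lemma coeff_pair_eq_0_iff:
  assumes R: "partial_hom R" and pq: "coeff_pair R p q"
  shows "coeff p i = 0 \<longleftrightarrow> coeff q i = 0"
  using pq partial_homD(5)[OF R] partial_hom_injective[OF R] unfolding coeff_pair_def by metis

text \<open>
  This is what makes the map \<open>p(\<alpha>) \<mapsto> q(\<beta>)\<close> well defined, where \<open>f\<close> is a polynomial of least degree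
  over the domain of \<open>R\<close> with root \<open>\<alpha>\<close>, and \<open>\<beta>\<close> is a root of its image \<open>g\<close>. The domain is only a
  ring, so \<open>p\<close> is reduced modulo \<open>f\<close> by pseudo-division: it is multiplied by the leading coefficient
  of \<open>f\<close> before the leading terms are cancelled, and \<open>q\<close> undergoes the same steps with \<open>g\<close>.
\<close>

lemma coeff_pair_common_root:
  assumes R: "partial_hom R" and fg: "coeff_pair R f g" "f \<noteq> 0" "poly f \<alpha> = 0" "poly g \<beta> = 0"
    and minimal: "\<And>p q. coeff_pair R p q \<Longrightarrow> p \<noteq> 0 \<Longrightarrow> poly p \<alpha> = 0 \<Longrightarrow> degree f \<le> degree p"
    and pq: "coeff_pair R p q" "poly p \<alpha> = 0"
  shows "poly q \<beta> = 0"
  using pq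
proof (induction "degree p" arbitrary: p q rule: less_induct)
  case less
  show ?case
  proof (cases "p = 0")
    case True
    then have "q = 0" using coeff_pair_eq_0_iff[OF R less.prems(1)] by (intro poly_eqI) simp
    then show ?thesis by simp
  next
    case False
    have deg: "degree f \<le> degree p" by (rule minimal[OF less.prems(1) False less.prems(2)])
    have deg_f: "degree f > 0"
    proof (rule ccontr)
      assume "\<not> degree f > 0"
      then obtain c where "f = [:c:]" by (metis degree_eq_zeroE gr0I)
      then show False using fg by simp
    qed
    define k where "k = degree p - degree f"
    define a where "a = lead_coeff f"
    define a' where "a' = coeff g (degree f)"
    define c where "c = lead_coeff p"
    define c' where "c' = coeff q (degree p)"
    define p1 where "p1 = smult a p - monom c k * f"
    define q1 where "q1 = smult a' q - monom c' k * g"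
    have aa: "(a, a') \<in> R" and cc: "(c, c') \<in> R"
      using fg(1) less.prems(1) by (auto simp: coeff_pair_def a_def a'_def c_def c'_def)
    have pair1: "coeff_pair R p1 q1" unfolding p1_def q1_def
      by (intro coeff_pair_ops[OF R] coeff_pair_smult[OF R] coeff_pair_monom[OF R] aa cc less.prems(1) fg(1))
    have root1: "poly p1 \<alpha> = 0" using fg less.prems by (simp add: p1_def)
    have "degree p1 \<le> degree p" unfolding p1_def
    proof (rule degree_diff_le)
      have "degree (monom c k * f) \<le> degree (monom c k) + degree f" by (rule degree_mult_le)
      also have "\<dots> \<le> k + degree f" by (simp add: degree_monom_le)
      also have "\<dots> = degree p" using deg by (simp add: k_def)
      finally show "degree (monom c k * f) \<le> degree p" .
    qed (rule degree_smult_le)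
    moreover have "coeff p1 (degree p) = 0"
    proof -
      have "degree p = degree f + k" using deg by (simp add: k_def)
      then have "coeff (monom c k * f) (degree p) = c * coeff f (degree f)"
        by (simp add: coeff_monom_mult)
      then show ?thesis by (simp add: p1_def a_def c_def)
    qed
    ultimately have "p1 = 0 \<or> degree p1 < degree p" by (rule eq_zero_or_degree_less)
    then have "degree p1 < degree p" using deg deg_f by auto
    from less.hyps[OF this pair1 root1] have "poly q1 \<beta> = 0" .
    then have "a' * poly q \<beta> = 0" using fg by (simp add: q1_def)
    moreover have "a' \<noteq> 0"
      using coeff_pair_eq_0_iff[OF R fg(1), of "degree f"] fg(2) by (simp add: a'_def)
    ultimately show ?thesis by simp
  qed
qed

lemma partial_hom_adjoin:
  assumes R: "partial_hom R" and \<alpha>: "algebraic \<alpha>"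
  shows "\<exists>\<beta>. partial_hom (adjoin R \<alpha> \<beta>)"
proof -
  \<comment> \<open>\<open>f\<close> plays the role of the minimal polynomial of \<open>\<alpha>\<close> over the domain of \<open>R\<close>, and \<open>\<beta>\<close> is
    any root of its image \<open>g\<close>.\<close>
  define Q where "Q = (\<lambda>n. \<exists>f g. coeff_pair R f g \<and> f \<noteq> 0 \<and> poly f \<alpha> = 0 \<and> degree f = n)"
  from \<alpha> obtain p where p: "p \<noteq> 0" "poly (map_poly of_int p) \<alpha> = 0" by (rule algebraicE')
  have "coeff_pair R (map_poly of_int p) (map_poly of_int p)"
    by (auto simp: coeff_pair_def coeff_map_poly intro: partial_hom_of_int[OF R])
  then have exQ: "\<exists>n. Q n" unfolding Q_def using p by (metis of_int_poly_hom.hom_0_iff)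
  have "Q (LEAST n. Q n)" using exQ by (rule LeastI_ex)
  then obtain f g where fg: "coeff_pair R f g" "f \<noteq> 0" "poly f \<alpha> = 0" "degree f = (LEAST n. Q n)"
    unfolding Q_def by blast
  have minimal: "degree f \<le> degree p" if "coeff_pair R p q" "p \<noteq> 0" "poly p \<alpha> = 0" for p q
    unfolding fg(4) using that by (intro Least_le) (auto simp: Q_def)
  have "degree f \<noteq> 0"
  proof
    assume "degree f = 0"
    then obtain c where "f = [:c:]" by (rule degree_eq_zeroE)
    then show False using fg by simp
  qed
  moreover have "coeff g (degree f) \<noteq> 0"
    using coeff_pair_eq_0_iff[OF R fg(1), of "degree f"] fg(2) by simp
  then have "degree f \<le> degree g" by (rule le_degree)
  ultimately have "\<not> constant (poly g)" by (simp add: constant_degree)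
  then obtain \<beta> where \<beta>: "poly g \<beta> = 0" using fundamental_theorem_of_algebra by blast
  have root: "poly q \<beta> = 0" if "coeff_pair R p q" "poly p \<alpha> = 0" for p q
    by (rule coeff_pair_common_root[OF R fg(1-3) \<beta> minimal that])
  have alg: "algebraic (poly p \<alpha>)" if "coeff_pair R p q" for p q
  proof -
    have "poly p \<alpha> \<in> Alg" unfolding poly_altdef
      using that partial_homD(6)[OF R] \<alpha>
      by (intro subfield_CC_sum[OF subfield_Alg] subfield_CC_D(6)[OF subfield_Alg] subfield_CC_power[OF subfield_Alg])
        (auto simp: coeff_pair_def)
    then show ?thesis by simp
  qed
  have adj: "(poly p \<alpha>, poly q \<beta>) \<in> adjoin R \<alpha> \<beta>" if "coeff_pair R p q" for p q
    using that by (auto simp: adjoin_def)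
  have "partial_hom (adjoin R \<alpha> \<beta>)"
    unfolding partial_hom_def
  proof (intro conjI allI impI)
    show "(1, 1) \<in> adjoin R \<alpha> \<beta>"
      using adj[OF coeff_pair_monom[OF R partial_homD(1)[OF R], of 0]] by simp
    show "(- a, - b) \<in> adjoin R \<alpha> \<beta>" if "(a, b) \<in> adjoin R \<alpha> \<beta>" for a b
    proof -
      from that obtain p q where pq: "coeff_pair R p q" "a = poly p \<alpha>" "b = poly q \<beta>" by (auto simp: adjoin_def)
      then show ?thesis using adj[OF coeff_pair_uminus[OF R pq(1)]] by simp
    qed
    fix a b c d assume ab: "(a, b) \<in> adjoin R \<alpha> \<beta>" and cd: "(c, d) \<in> adjoin R \<alpha> \<beta>"
    from ab obtain p q where pq: "coeff_pair R p q" "a = poly p \<alpha>" "b = poly q \<beta>" by (auto simp: adjoin_def)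
    from cd obtain p' q' where pq': "coeff_pair R p' q'" "c = poly p' \<alpha>" "d = poly q' \<beta>" by (auto simp: adjoin_def)
    show "(a + c, b + d) \<in> adjoin R \<alpha> \<beta>"
      using adj[OF coeff_pair_ops(1)[OF R pq(1) pq'(1)]] pq pq' by simp
    show "(a * c, b * d) \<in> adjoin R \<alpha> \<beta>"
      using adj[OF coeff_pair_ops(3)[OF R pq(1) pq'(1)]] pq pq' by simp
  next
    show "b = 0" if "(0, b) \<in> adjoin R \<alpha> \<beta>" for b using that root by (auto simp: adjoin_def)
    show "algebraic a" if "(a, b) \<in> adjoin R \<alpha> \<beta>" for a b using that alg by (auto simp: adjoin_def)
  qed
  then show ?thesis by blast
qed

lemma adjoin_superset: "partial_hom R \<Longrightarrow> R \<subseteq> adjoin R \<alpha> \<beta>"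
proof
  fix x assume R: "partial_hom R" and x: "x \<in> R"
  obtain a b where ab: "x = (a, b)" by (cases x)
  have "coeff_pair R (monom a 0) (monom b 0)" using R x ab by (simp add: coeff_pair_monom)
  then show "x \<in> adjoin R \<alpha> \<beta>" unfolding adjoin_def ab
    by (intro CollectI exI[of _ "monom a 0"] exI[of _ "monom b 0"]) (simp add: poly_monom)
qed

lemma adjoin_contains: "partial_hom R \<Longrightarrow> (\<alpha>, \<beta>) \<in> adjoin R \<alpha> \<beta>"
proof -
  assume R: "partial_hom R"
  have "coeff_pair R (monom 1 1) (monom 1 1)" by (rule coeff_pair_monom[OF R partial_homD(1)[OF R]])
  then show ?thesis unfolding adjoin_def
    by (intro CollectI exI[of _ "monom 1 1"]) (simp add: poly_monom)
qed

definition Alg_automorphism :: "(complex \<Rightarrow> complex) \<Rightarrow> bool" where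
  "Alg_automorphism \<sigma> \<longleftrightarrow> \<sigma> \<in> Ring.ring_hom (field_ring Alg) CC \<and> bij_betw \<sigma> Alg Alg"

text \<open>
  A maximal extension is total because an element outside its domain could be adjoined. It is
  surjective because it maps the finite set of roots of an integer polynomial injectively to itself.
\<close>

theorem partial_hom_extends:
  assumes R0: "partial_hom R0"
  shows "\<exists>\<sigma>. Alg_automorphism \<sigma> \<and> (\<forall>a b. (a, b) \<in> R0 \<longrightarrow> \<sigma> a = b)"
proof -
  define Hs where "Hs = {R. partial_hom R \<and> R0 \<subseteq> R}"
  have "\<exists>M\<in>Hs. \<forall>N\<in>Hs. M \<subseteq> N \<longrightarrow> N = M"
  proof (rule subset_Zorn_nonempty)
    show "Hs \<noteq> {}" using R0 by (auto simp: Hs_def)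
    fix Ch assume ne: "Ch \<noteq> {}" and chain: "subset.chain Hs Ch"
    then have hom: "partial_hom R" and sup: "R0 \<subseteq> R" if "R \<in> Ch" for R
      using that by (auto simp: Hs_def subset_chain_def)
    have common: "\<exists>R\<in>Ch. x \<in> R \<and> y \<in> R" if "x \<in> \<Union> Ch" "y \<in> \<Union> Ch" for x y
    proof -
      from that obtain R S where RS: "R \<in> Ch" "x \<in> R" "S \<in> Ch" "y \<in> S" by blast
      then have "R \<subseteq> S \<or> S \<subseteq> R" using chain by (auto simp: subset_chain_def)
      then show ?thesis using RS by blast
    qed
    have "partial_hom (\<Union> Ch)"
      unfolding partial_hom_def
    proof (intro conjI allI impI)
      show "(1, 1) \<in> \<Union> Ch" using ne hom partial_homD(1) by blast
      show "(- a, - b) \<in> \<Union> Ch" if "(a, b) \<in> \<Union> Ch" for a b using that hom partial_homD(2) by blast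
      fix a b c d assume "(a, b) \<in> \<Union> Ch" "(c, d) \<in> \<Union> Ch"
      then obtain R where R: "R \<in> Ch" "(a, b) \<in> R" "(c, d) \<in> R" using common by blast
      show "(a + c, b + d) \<in> \<Union> Ch" using R partial_homD(3)[OF hom[OF R(1)]] by blast
      show "(a * c, b * d) \<in> \<Union> Ch" using R partial_homD(4)[OF hom[OF R(1)]] by blast
    next
      show "b = 0" if "(0, b) \<in> \<Union> Ch" for b using that hom partial_homD(5) by blast
      show "algebraic a" if "(a, b) \<in> \<Union> Ch" for a b using that hom partial_homD(6) by blast
    qed
    moreover have "R0 \<subseteq> \<Union> Ch" using ne sup by blast
    ultimately show "\<Union> Ch \<in> Hs" by (simp add: Hs_def)
  qed
  then obtain M where M: "partial_hom M" "R0 \<subseteq> M"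
    and maximal: "\<And>N. partial_hom N \<Longrightarrow> M \<subseteq> N \<Longrightarrow> N = M"
    by (auto simp: Hs_def)
  have total: "\<exists>\<beta>. (\<alpha>, \<beta>) \<in> M" if \<alpha>: "algebraic \<alpha>" for \<alpha>
  proof -
    obtain \<beta> where \<beta>: "partial_hom (adjoin M \<alpha> \<beta>)" using partial_hom_adjoin[OF M(1) \<alpha>] by blast
    have "adjoin M \<alpha> \<beta> = M" by (rule maximal[OF \<beta> adjoin_superset[OF M(1)]])
    then show ?thesis using adjoin_contains[OF M(1), of \<alpha> \<beta>] by auto
  qed
  then obtain \<sigma> where \<sigma>: "\<And>\<alpha>. algebraic \<alpha> \<Longrightarrow> (\<alpha>, \<sigma> \<alpha>) \<in> M" by metis
  have eq: "\<sigma> a = b" if "(a, b) \<in> M" for a b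
    by (rule partial_hom_unique[OF M(1) \<sigma>[OF partial_homD(6)[OF M(1) that]] that])
  have hom: "\<sigma> \<in> Ring.ring_hom (field_ring Alg) CC"
    unfolding ring_hom_field_ring_CC_iff
  proof (intro conjI ballI)
    show "\<sigma> 1 = 1" by (rule eq[OF partial_homD(1)[OF M(1)]])
    fix x y assume "x \<in> Alg" "y \<in> Alg"
    then have xy: "(x, \<sigma> x) \<in> M" "(y, \<sigma> y) \<in> M" using \<sigma> by auto
    show "\<sigma> (x * y) = \<sigma> x * \<sigma> y" by (rule eq[OF partial_homD(4)[OF M(1) xy]])
    show "\<sigma> (x + y) = \<sigma> x + \<sigma> y" by (rule eq[OF partial_homD(3)[OF M(1) xy]])
  qed
  have inj: "inj_on \<sigma> Alg" by (rule ring_hom_CC_inj_on[OF hom subfield_Alg])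
  have root: "poly (map_poly of_int p) (\<sigma> x) = 0"
    if "algebraic x" "poly (map_poly of_int p) x = 0" for p x
    using ring_hom_CC_poly[OF hom subfield_Alg, of x p] ring_hom_CC_D(2)[OF hom subfield_Alg] that by simp
  have "\<sigma> ` Alg = Alg"
  proof
    show "\<sigma> ` Alg \<subseteq> Alg"
    proof (rule image_subsetI)
      fix x assume "x \<in> Alg"
      then have x: "algebraic x" by simp
      then obtain p where p: "p \<noteq> 0" "poly (map_poly of_int p) x = 0" by (rule algebraicE')
      show "\<sigma> x \<in> Alg" using root[OF x p(2)] p(1)
        by (auto intro!: algebraicI[of "map_poly of_int p"] simp: coeff_map_poly)
    qed
    show "Alg \<subseteq> \<sigma> ` Alg"
    proof
      fix y assume "y \<in> Alg"
      then have "algebraic y" by simp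
      then obtain p where p: "p \<noteq> 0" "poly (map_poly of_int p) y = 0" by (rule algebraicE')
      \<comment> \<open>The roots of a polynomial over the integers are finitely many and permuted.\<close>
      define Z where "Z = {z :: complex. poly (map_poly of_int p) z = 0}"
      have Z: "finite Z" unfolding Z_def using p(1) by (intro poly_roots_finite) simp
      have ZA: "Z \<subseteq> Alg" using p(1)
        by (auto simp: Z_def intro!: algebraicI[of "map_poly of_int p"] simp: coeff_map_poly)
      have "\<sigma> ` Z \<subseteq> Z" using root ZA by (auto simp: Z_def)
      then have "\<sigma> ` Z = Z" using Z inj_on_subset[OF inj ZA] by (intro endo_inj_surj)
      moreover have "y \<in> Z" using p by (simp add: Z_def)
      ultimately show "y \<in> \<sigma> ` Alg" using ZA by blast
    qed
  qed
  then have "bij_betw \<sigma> Alg Alg" using inj by (simp add: bij_betw_def)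
  then show ?thesis using hom eq M(2) unfolding Alg_automorphism_def by blast
qed

lemma (in quadratic_extension) conj_extends:
  assumes "F \<subseteq> Alg"
  shows "\<exists>\<sigma>. Alg_automorphism \<sigma> \<and> (\<forall>x\<in>E. \<sigma> x = conj x)"
proof -
  have "algebraic (t * t)" using assms square by auto
  then have "algebraic t"
    by (rule algebraic_root[where p = "monom 1 2"]) (auto simp: poly_monom power2_eq_square degree_monom_eq)
  then have EA: "E \<subseteq> Alg" using assms by (auto simp: E_def intro!: algebraic_add_mult)
  define R where "R = {(x, y). x \<in> E \<and> y = conj x}"
  have mem: "(a, b) \<in> R \<longleftrightarrow> a \<in> E \<and> b = conj a" for a b by (simp add: R_def)
  have "partial_hom R"
    unfolding partial_hom_def
  proof (intro conjI allI impI)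
    show "(1, 1) \<in> R" unfolding mem using ED(2) conj_F[OF FD(2)] by simp
    show "(- a, - b) \<in> R" if "(a, b) \<in> R" for a b
      using that ED(3) ring_hom_CC_D(5)[OF conj_hom E_subfield] unfolding mem by simp
    show "(a + c, b + d) \<in> R" "(a * c, b * d) \<in> R" if "(a, b) \<in> R" "(c, d) \<in> R" for a b c d
      using that ED(4,6) conj_add conj_mult unfolding mem by simp_all
    show "b = 0" if "(0, b) \<in> R" for b
      using that conj_F[OF FD(1)] unfolding mem by simp
    show "algebraic a" if "(a, b) \<in> R" for a b
      using that EA unfolding mem by auto
  qed
  from partial_hom_extends[OF this] show ?thesis unfolding mem by blast
qed

section \<open>Rings of integers and their prime ideals\<close>

lemma integers_simps [simp]:
  "x \<otimes>\<^bsub>integers K\<^esub> y = x * y" "x \<oplus>\<^bsub>integers K\<^esub> y = x + y" "\<one>\<^bsub>integers K\<^esub> = 1" "\<zero>\<^bsub>integers K\<^esub> = 0"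
  by (simp_all add: integers_def)

lemma integers_closed:
  assumes "subfield K CC"
  shows "0 \<in> carrier (integers K)" "1 \<in> carrier (integers K)" "of_int i \<in> carrier (integers K)"
    "x \<in> carrier (integers K) \<Longrightarrow> - x \<in> carrier (integers K)"
    "x \<in> carrier (integers K) \<Longrightarrow> y \<in> carrier (integers K) \<Longrightarrow> x + y \<in> carrier (integers K)"
    "x \<in> carrier (integers K) \<Longrightarrow> y \<in> carrier (integers K) \<Longrightarrow> x - y \<in> carrier (integers K)"
    "x \<in> carrier (integers K) \<Longrightarrow> y \<in> carrier (integers K) \<Longrightarrow> x * y \<in> carrier (integers K)"
  using subfield_CC_D[OF assms]
  by (auto simp: carrier_integers intro: algebraic_int_add_mult algebraic_int_diff)

lemma cring_integers:
  assumes "subfield K CC"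
  shows "cring (integers K)"
proof -
  have "subring (carrier (integers K)) CC"
    by (rule CC.subringI) (use integers_closed[OF assms] in auto)
  then have "subcring (carrier (integers K)) CC" by (rule CC.subcringI')
  then have "cring (CC\<lparr>carrier := carrier (integers K)\<rparr>)" by (simp add: CC.subcring_iff)
  then show ?thesis by (simp add: integers_def)
qed

lemma ideal_integers_D:
  assumes "ideal P (integers K)" "subfield K CC"
  shows "P \<subseteq> carrier (integers K)" "0 \<in> P" "x \<in> P \<Longrightarrow> y \<in> P \<Longrightarrow> x + y \<in> P"
    "x \<in> P \<Longrightarrow> a \<in> carrier (integers K) \<Longrightarrow> a * x \<in> P"
    "x \<in> P \<Longrightarrow> a \<in> carrier (integers K) \<Longrightarrow> x * a \<in> P"
    "x \<in> P \<Longrightarrow> - x \<in> P" "x \<in> P \<Longrightarrow> y \<in> P \<Longrightarrow> x - y \<in> P"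
proof -
  interpret ideal P "integers K" by fact
  show "P \<subseteq> carrier (integers K)" "0 \<in> P" and add: "\<And>x y. x \<in> P \<Longrightarrow> y \<in> P \<Longrightarrow> x + y \<in> P"
    and l: "\<And>x a. x \<in> P \<Longrightarrow> a \<in> carrier (integers K) \<Longrightarrow> a * x \<in> P"
    and "\<And>x a. x \<in> P \<Longrightarrow> a \<in> carrier (integers K) \<Longrightarrow> x * a \<in> P"
    using a_subset I_l_closed I_r_closed additive_subgroup.zero_closed[OF is_additive_subgroup]
      additive_subgroup.a_closed[OF is_additive_subgroup] by auto
  show neg: "- x \<in> P" if "x \<in> P" for x
    using l[OF that, of "-1"] integers_closed(3)[OF assms(2), of "-1"] by simp
  show "x \<in> P \<Longrightarrow> y \<in> P \<Longrightarrow> x - y \<in> P" using add neg by (metis add_uminus_conv_diff)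
qed

lemma prime_integers_D:
  assumes "primeideal P (integers K)"
  shows "ideal P (integers K)" "1 \<notin> P"
    "x \<in> carrier (integers K) \<Longrightarrow> y \<in> carrier (integers K) \<Longrightarrow> x * y \<in> P \<Longrightarrow> x \<in> P \<or> y \<in> P"
proof -
  interpret primeideal P "integers K" by fact
  show "ideal P (integers K)" by (rule is_ideal)
  show "1 \<notin> P" using one_imp_carrier I_notcarr by auto
  show "x \<in> carrier (integers K) \<Longrightarrow> y \<in> carrier (integers K) \<Longrightarrow> x * y \<in> P \<Longrightarrow> x \<in> P \<or> y \<in> P"
    using I_prime[of x y] by simp
qed

lemma poly_of_int_poly_pCons:
  "poly (map_poly of_int (pCons c q)) x = of_int c + x * poly (map_poly of_int q) (x :: complex)"
  by (cases "pCons c q = 0") (auto simp: map_poly_pCons)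

locale integral_prime =
  fixes K P :: "complex set"
  assumes K: "subfield K CC" and prime: "primeideal P (integers K)" and nonzero: "P \<noteq> {0}"
begin

abbreviation "OK \<equiv> carrier (integers K)"

lemmas O = integers_closed[OF K]
lemmas P_ideal = prime_integers_D(1)[OF prime]
lemmas PI = ideal_integers_D[OF P_ideal K]
lemmas P_one = prime_integers_D(2)[OF prime]
lemmas P_prime = prime_integers_D(3)[OF prime]

lemma O_poly: "x \<in> OK \<Longrightarrow> poly (map_poly of_int p) x \<in> OK"
  by (induction p) (auto simp: O)

text \<open>
  Every nonzero \<open>y \<in> P\<close> is a root of an integer polynomial with nonzero constant coefficient, and this
  coefficient is a multiple of \<open>y\<close>.
\<close>

lemma contains_nonzero_int: "\<exists>n :: nat. n > 0 \<and> of_nat n \<in> P"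
proof -
  obtain y where y: "y \<in> P" "y \<noteq> 0" using nonzero PI(2) by auto
  then have yO: "y \<in> OK" using PI(1) by blast
  then have "algebraic y" by (auto simp: carrier_integers)
  then obtain p where p: "coeff p 0 \<noteq> 0" "poly (map_poly of_int p) y = 0"
    using algebraicE'_nonzero[OF _ y(2)] by metis
  obtain c q where cq: "p = pCons c q" by (rule pCons_cases)
  have "of_int c + y * poly (map_poly of_int q) y = 0"
    using p(2) unfolding cq poly_of_int_poly_pCons .
  then have "of_int c = - (y * poly (map_poly of_int q) y)" by (simp add: add_eq_0_iff)
  then have "of_int c \<in> P" using PI(5,6) y O_poly[OF yO] by simp
  then have "of_int (- c) \<in> P" using PI(6) by fastforce
  then have "of_nat (nat \<bar>c\<bar>) \<in> P" using \<open>of_int c \<in> P\<close> by (cases "c \<ge> 0") auto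
  moreover have "nat \<bar>c\<bar> > 0" using p(1) by (simp add: cq)
  ultimately show ?thesis by blast
qed

text \<open>
  Let \<open>l\<close> be the least positive integer in \<open>P\<close> and \<open>g\<close> the gcd of \<open>c\<close> and \<open>l\<close>. As \<open>P\<close> is prime, it
  contains \<open>g\<close> or \<open>l/g\<close>. The first would put \<open>c\<close> into \<open>P\<close>, the second contradicts the choice of \<open>l\<close>
  unless \<open>g = 1\<close>; so \<open>c\<close> is invertible modulo \<open>l\<close>.
\<close>

lemma int_invertible:
  assumes c: "of_int c \<notin> P"
  shows "\<exists>u :: int. of_int (u * c - 1) \<in> P"
proof -
  define l where "l = (LEAST n :: nat. n > 0 \<and> of_nat n \<in> P)"
  have l: "l > 0" "of_nat l \<in> P"
    using LeastI_ex[OF contains_nonzero_int] by (simp_all add: l_def)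
  have least: "of_nat m \<notin> P" if "m > 0" "m < l" for m
    using that not_less_Least[of m "\<lambda>n. n > 0 \<and> of_nat n \<in> P"] unfolding l_def by auto
  define g where "g = gcd c (int l)"
  have g: "g > 0" using l by (simp add: g_def)
  obtain u v where uv: "u * c + v * int l = g" unfolding g_def by (metis bezout_int)
  have "g = 1"
  proof (rule ccontr)
    assume "g \<noteq> 1"
    have "g dvd int l" by (simp add: g_def)
    then obtain h where h: "int l = g * h" by (rule dvdE)
    have h0: "h > 0" using h l g by (metis of_nat_0_less_iff zero_less_mult_pos)
    have "of_int g * of_int h = (of_nat l :: complex)" using h by (metis of_int_mult of_int_of_nat_eq)
    then have "of_int g \<in> P \<or> of_int h \<in> P" using P_prime[of "of_int g" "of_int h"] l O by simp
    then show False
    proof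
      assume gP: "of_int g \<in> P"
      obtain k where "c = g * k" unfolding g_def by (metis gcd_dvd1 dvdE)
      then have "of_int c \<in> P" using PI(5)[OF gP O(3)] by simp
      then show False using c by simp
    next
      assume hP: "of_int h \<in> P"
      have "g \<ge> 2" using g \<open>g \<noteq> 1\<close> by simp
      then have "h < g * h" using h0 by simp
      then have "nat h < l" using h h0 by linarith
      moreover have "of_nat (nat h) \<in> P" using hP h0 by simp
      ultimately show False using least[of "nat h"] h0 by simp
    qed
  qed
  then have "u * c - 1 = - (v * int l)" using uv by simp
  then have "of_int (u * c - 1) = - (of_int v * (of_nat l :: complex))" by simp
  moreover have "of_int v * of_nat l \<in> P" by (rule PI(4)[OF l(2) O(3)])
  ultimately show ?thesis using PI(6) by metis
qed

text \<open>
  Nonzero primes are maximal. In an integral equation for \<open>x\<close>, reduced modulo \<open>P\<close>, powers of \<open>x\<close> can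
  be cancelled until the constant coefficient is not in \<open>P\<close>. That coefficient is an integer, hence
  invertible modulo \<open>P\<close>, and modulo \<open>P\<close> it is a multiple of \<open>x\<close>.
\<close>

lemma invertible_mod_prime:
  assumes x: "x \<in> OK" "x \<notin> P"
  shows "\<exists>s\<in>OK. s * x - 1 \<in> P"
proof -
  have step: "\<exists>s\<in>OK. s * x - 1 \<in> P"
    if "poly (map_poly of_int p) x \<in> P" "\<exists>i. of_int (coeff p i) \<notin> P" for p
    using that
  proof (induction p)
    case 0
    then show ?case using PI(2) by simp
  next
    case (pCons c q)
    define y where "y = poly (map_poly of_int q) x"
    have yO: "y \<in> OK" unfolding y_def by (rule O_poly[OF x(1)])
    have cxy: "of_int c + x * y \<in> P"
      using pCons.prems(1) unfolding poly_of_int_poly_pCons y_def .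
    show ?case
    proof (cases "of_int c \<in> P")
      case True
      have "of_int c + x * y - of_int c \<in> P" by (rule PI(7)[OF cxy True])
      then have "x * y \<in> P" by simp
      then have "y \<in> P" using P_prime[OF x(1) yO] x(2) by simp
      moreover have "\<exists>i. of_int (coeff q i) \<notin> P"
      proof -
        from pCons.prems(2) obtain i where i: "of_int (coeff (pCons c q) i) \<notin> P" by blast
        then obtain j where "i = Suc j" using True by (cases i) auto
        then show ?thesis using i by auto
      qed
      ultimately show ?thesis using pCons.IH unfolding y_def by blast
    next
      case False
      then obtain u where u: "of_int (u * c - 1) \<in> P" using int_invertible by blast
      have "of_int u * (of_int c + x * y) - of_int (u * c - 1) \<in> P"
        by (rule PI(7)[OF PI(4)[OF cxy O(3)] u])
      then have "- (of_int u * (of_int c + x * y) - of_int (u * c - 1)) \<in> P" by (rule PI(6))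
      moreover have "- (of_int u * (of_int c + x * y) - of_int (u * c - 1)) = (- of_int u * y) * x - 1"
        by (simp add: algebra_simps)
      moreover have "- of_int u * y \<in> OK" using O(7)[OF O(4)[OF O(3)] yO] .
      ultimately show ?thesis by metis
    qed
  qed
  have "algebraic_int x" using x by (simp add: carrier_integers)
  then obtain p where p: "poly (map_poly of_int p) x = 0" "lead_coeff p = (1 :: int)"
    by (auto simp: algebraic_int_altdef_ipoly)
  show ?thesis
  proof (rule step[of p])
    show "poly (map_poly of_int p) x \<in> P" unfolding p(1) by (rule PI(2))
    have "(of_int (lead_coeff p) :: complex) \<notin> P" unfolding p(2) using P_one by simp
    then show "\<exists>i. of_int (coeff p i) \<notin> P" by blast
  qed
qed

text \<open>
  If \<open>r\<close> inverts \<open>s\<close> modulo \<open>P\<close>, then \<open>x = r s x - (r s - 1) x\<close>, where the last term is a product of two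
  elements of \<open>P\<close>.
\<close>

lemma mem_ideal_of_mult:
  assumes Q: "ideal Q (integers K)" and x: "x \<in> P" "s \<in> OK" "s \<notin> P" "s * x \<in> Q"
    and PP: "\<And>x y. x \<in> P \<Longrightarrow> y \<in> P \<Longrightarrow> x * y \<in> Q"
  shows "x \<in> Q"
proof -
  obtain r where r: "r \<in> OK" "r * s - 1 \<in> P" using invertible_mod_prime[OF x(2,3)] by blast
  have "r * (s * x) - (r * s - 1) * x \<in> Q"
    by (rule ideal_integers_D(7)[OF Q K ideal_integers_D(4)[OF Q K x(4) r(1)] PP[OF r(2) x(1)]])
  then show ?thesis by (simp add: algebra_simps)
qed

text \<open>
  The sums \<open>\<Sum> c\<^sub>j x\<^sub>j\<close> with coefficients in \<open>I\<close>, by recursion on the list of the \<open>x\<^sub>j\<close>, which is the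
  recursion of the elimination of generators below.
\<close>

fun combinations :: "complex set \<Rightarrow> complex list \<Rightarrow> complex set" where
  "combinations I [] = {0}"
| "combinations I (x # xs) = {c * x + y | c y. c \<in> I \<and> y \<in> combinations I xs}"

lemma combinations_add:
  assumes "ideal I (integers K)" "u \<in> combinations I xs" "v \<in> combinations I xs"
  shows "u + v \<in> combinations I xs"
  using assms(2,3)
proof (induction xs arbitrary: u v)
  case (Cons x xs)
  from Cons.prems obtain c y c' y' where
    *: "u = c * x + y" "c \<in> I" "y \<in> combinations I xs" "v = c' * x + y'" "c' \<in> I" "y' \<in> combinations I xs"
    by auto
  have "u + v = (c + c') * x + (y + y')" using * by (simp add: algebra_simps)
  moreover have "c + c' \<in> I" using * ideal_integers_D(3)[OF assms(1) K] by blast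
  ultimately show ?case using Cons.IH[OF *(3,6)] by auto
qed simp

lemma combinations_scale:
  assumes "a \<in> OK" "\<And>c. c \<in> I \<Longrightarrow> a * c \<in> J" "u \<in> combinations I xs"
  shows "a * u \<in> combinations J xs"
  using assms(3)
proof (induction xs arbitrary: u)
  case (Cons x xs)
  from Cons.prems obtain c y where *: "u = c * x + y" "c \<in> I" "y \<in> combinations I xs" by auto
  have "a * u = (a * c) * x + a * y" using * by (simp add: algebra_simps)
  then show ?case using assms(2)[OF *(2)] Cons.IH[OF *(3)] by auto
qed simp

lemma combinations_mono: "I \<subseteq> J \<Longrightarrow> combinations I xs \<subseteq> combinations J xs"
  by (induction xs) auto

lemma ideal_OK: "ideal OK (integers K)"
  using ring.oneideal[OF cring.axioms(1)[OF cring_integers[OF K]]] .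

lemma combinations_zero: "0 \<in> I \<Longrightarrow> 0 \<in> combinations I xs"
  by (induction xs) (auto intro: exI[of _ 0])

lemma combinations_base: "x \<in> set xs \<Longrightarrow> x \<in> combinations OK xs"
proof (induction xs)
  case (Cons y ys)
  show ?case
  proof (cases "x = y")
    case True
    have "1 * y + 0 \<in> combinations OK (y # ys)"
      unfolding combinations.simps using O(2) combinations_zero[OF O(1), of ys] by blast
    then show ?thesis using True by simp
  next
    case False
    then have "x \<in> combinations OK ys" using Cons by auto
    then have "0 * y + x \<in> combinations OK (y # ys)"
      unfolding combinations.simps using O(1) by blast
    then show ?thesis by simp
  qed
qed simp

text \<open>
  If \<open>P = P\<^sup>2\<close>, Nakayama's argument yields \<open>s \<equiv> 1 mod P\<close> with \<open>s P = 0\<close>. As \<open>P\<close> contains a nonzero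
  element, \<open>s = 0\<close> and \<open>1 \<in> P\<close>.
\<close>

lemma prime_not_idempotent:
  assumes fg: "finite S" "OK \<subseteq> zmod.span S"
    and square: "P \<subseteq> ideal_prod (integers K) P P"
  shows False
proof -
  have "zmod.subspace P" by (rule zmod_subspaceI[OF PI(2,3,6)])
  moreover have "P \<subseteq> zmod.span S" by (rule subset_trans[OF PI(1) fg(2)])
  ultimately have "\<exists>T. finite T \<and> T \<subseteq> P \<and> P \<subseteq> zmod.span T"
    by (rule finitely_generated_zmod_subspace[OF fg(1)])
  then obtain T where T: "finite T" "T \<subseteq> P" "P \<subseteq> zmod.span T" by blast
  obtain ts where ts: "set ts = T" using finite_list[OF T(1)] by blast
  have "zmod.span T \<subseteq> combinations OK ts"
  proof (rule zmod.span_minimal)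
    show "T \<subseteq> combinations OK ts" using combinations_base ts by blast
    show "zmod.subspace (combinations OK ts)"
    proof (rule zmod_subspaceI)
      show "0 \<in> combinations OK ts" by (rule combinations_zero[OF O(1)])
      show "u + v \<in> combinations OK ts" if "u \<in> combinations OK ts" "v \<in> combinations OK ts" for u v
        by (rule combinations_add[OF ideal_OK that])
      show "- u \<in> combinations OK ts" if "u \<in> combinations OK ts" for u
        using combinations_scale[of "-1" OK OK u ts] that O(4) O(2) by fastforce
    qed
  qed
  then have start: "\<forall>p\<in>P. 1 * p \<in> combinations OK ts" using T(3) by auto
  \<comment> \<open>Nakayama: generators are eliminated one by one at the cost of a multiplier \<open>s \<equiv> 1\<close> mod \<open>P\<close>.\<close>
  have elim: "\<exists>s\<in>OK. s - 1 \<in> P \<and> (\<forall>p\<in>P. s * p = 0)"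
    if "s \<in> OK" "s - 1 \<in> P" "\<forall>p\<in>P. s * p \<in> combinations OK xs" "set xs \<subseteq> P" for s xs
    using that
  proof (induction xs arbitrary: s)
    case Nil
    then show ?case by auto
  next
    case (Cons x xs)
    \<comment> \<open>Here \<open>P = P\<^sup>2\<close> enters: it moves the coefficients from the ring into \<open>P\<close>, so that the
      coefficient of \<open>x\<close> in \<open>s x\<close> can be absorbed into \<open>s\<close>.\<close>
    have sP: "s * q \<in> combinations P (x # xs)" if "q \<in> ideal_prod (integers K) P P" for q
      using that
    proof (induction q rule: ideal_prod.induct)
      case (prod i j)
      have "j * (s * i) \<in> combinations P (x # xs)"
      proof (rule combinations_scale)
        show "j \<in> OK" using prod(2) PI(1) by blast
        show "j * c \<in> P" if "c \<in> OK" for c by (rule PI(5)[OF prod(2) that])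
        show "s * i \<in> combinations OK (x # xs)" using Cons.prems(3) prod(1) by blast
      qed
      moreover have "j * (s * i) = s * (i * j)" by simp
      ultimately show ?case by simp
    next
      case (sum s1 s2)
      then have "s * s1 + s * s2 \<in> combinations P (x # xs)"
        using combinations_add[OF P_ideal] by blast
      then show ?case by (simp add: distrib_left)
    qed
    have xP: "x \<in> P" using Cons.prems(4) by simp
    have "s * x \<in> combinations P (x # xs)" using sP square xP by blast
    then obtain c y where cy: "s * x = c * x + y" "c \<in> P" "y \<in> combinations P xs" by auto
    have yO: "y \<in> combinations OK xs" using cy(3) combinations_mono[OF PI(1)] by blast
    have cO: "c \<in> OK" using cy(2) PI(1) by blast
    have sc: "s - c \<in> OK" by (rule O(6)[OF Cons.prems(1) cO])
    define s' where "s' = (s - c) * s"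
    have "s' \<in> OK" unfolding s'_def by (rule O(7)[OF sc Cons.prems(1)])
    moreover have "s' - 1 \<in> P"
    proof -
      have eq: "s' - 1 = (s - 1) * s + (s - 1) - c * s" unfolding s'_def by (simp add: algebra_simps)
      show ?thesis unfolding eq
        by (rule PI(7)[OF PI(3)[OF PI(5)[OF Cons.prems(2,1)] Cons.prems(2)] PI(5)[OF cy(2) Cons.prems(1)]])
    qed
    moreover have "\<forall>p\<in>P. s' * p \<in> combinations OK xs"
    proof
      fix p assume "p \<in> P"
      then have "s * p \<in> combinations OK (x # xs)" using Cons.prems(3) by blast
      then obtain b z where bz: "s * p = b * x + z" "b \<in> OK" "z \<in> combinations OK xs" by auto
      have "s' * p = (s - c) * (s * p)" by (simp add: s'_def)
      also have "\<dots> = b * (s * x - c * x) + (s - c) * z" unfolding bz(1) by (simp add: algebra_simps)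
      also have "s * x - c * x = y" unfolding cy(1) by simp
      finally have "s' * p = b * y + (s - c) * z" .
      moreover have "b * y \<in> combinations OK xs"
        by (rule combinations_scale[OF bz(2) _ yO]) (rule O(7)[OF bz(2)])
      moreover have "(s - c) * z \<in> combinations OK xs"
        by (rule combinations_scale[OF sc _ bz(3)]) (rule O(7)[OF sc])
      ultimately show "s' * p \<in> combinations OK xs" using combinations_add[OF ideal_OK] by simp
    qed
    ultimately show ?case using Cons.IH[of s'] Cons.prems(4) by simp
  qed
  have "(1 :: complex) - 1 \<in> P" using PI(2) by simp
  from elim[OF O(2) this start] obtain s where s: "s - 1 \<in> P" "\<forall>p\<in>P. s * p = 0" using ts T(2) by blast
  obtain y where "y \<in> P" "y \<noteq> 0" using nonzero PI(2) by auto
  then have "s = 0" using s(2) by auto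
  then have "1 \<in> P" using PI(6)[OF s(1)] by simp
  then show False using P_one by simp
qed

end

lemma ideal_power_ideal:
  assumes K: "subfield K CC" and P: "ideal P (integers K)"
  shows "ideal (ideal_power (integers K) P e) (integers K)"
proof -
  interpret cring "integers K" by (rule cring_integers[OF K])
  show ?thesis unfolding ideal_power_def
    by (induction e) (auto intro: oneideal ideal_prod_is_ideal P)
qed

lemma genideal_subset_iff:
  assumes K: "subfield K CC" and I: "ideal I (integers K)" and S: "S \<subseteq> carrier (integers K)"
  shows "genideal (integers K) S \<subseteq> I \<longleftrightarrow> S \<subseteq> I"
proof -
  interpret cring "integers K" by (rule cring_integers[OF K])
  show ?thesis using genideal_self[OF S] genideal_minimal[OF I] by blast
qed

text \<open>
  The powers of \<open>P\<close> decrease, so the second power decides whether 1 is the greatest exponent.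
\<close>

lemma ramification_index_1:
  assumes L: "subfield L CC" and P: "ideal P (integers L)"
    and not_sub: "\<not> P \<inter> K \<subseteq> ideal_power (integers L) P 2"
  shows "ramification_index K L P = 1"
proof -
  interpret cring "integers L" by (rule cring_integers[OF L])
  have pow_ideal: "ideal (ideal_power (integers L) P e) (integers L)" for e
    by (rule ideal_power_ideal[OF L P])
  have Suc: "ideal_power (integers L) P (Suc e) = ideal_prod (integers L) P (ideal_power (integers L) P e)" for e
    by (simp add: ideal_power_def)
  have dec: "ideal_power (integers L) P (Suc e) \<subseteq> ideal_power (integers L) P e" for e
    unfolding Suc using ideal_prod_inter[OF P pow_ideal] by blast
  have PL: "P \<inter> K \<subseteq> carrier (integers L)" using ideal_integers_D(1)[OF P L] by blast
  have one: "ideal_power (integers L) P 1 = P"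
    using ideal_prod_one[OF P] by (simp add: ideal_power_def)
  show ?thesis
    unfolding ramification_index_def
  proof (rule Greatest_equality)
    show "genideal (integers L) (P \<inter> K) \<subseteq> ideal_power (integers L) P 1"
      unfolding one genideal_subset_iff[OF L P PL] by blast
    fix e assume "genideal (integers L) (P \<inter> K) \<subseteq> ideal_power (integers L) P e"
    then have e: "P \<inter> K \<subseteq> ideal_power (integers L) P e"
      unfolding genideal_subset_iff[OF L pow_ideal PL] .
    show "e \<le> 1"
    proof (rule ccontr)
      assume "\<not> e \<le> 1"
      then have "2 \<le> e" by simp
      have "ideal_power (integers L) P e \<subseteq> ideal_power (integers L) P 2"
        by (rule lift_Suc_antimono_le[of "ideal_power (integers L) P", OF dec \<open>2 \<le> e\<close>])
      then show False using e not_sub by blast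
    qed
  qed
qed

section \<open>Unramified quadratic extensions\<close>

context quadratic_extension
begin

abbreviation "OE \<equiv> carrier (integers E)"

lemma conj_OE: "x \<in> OE \<Longrightarrow> conj x \<in> OE"
  by (simp add: carrier_integers conj_in conj_algebraic_int)

lemma trace_F: "x \<in> OE \<Longrightarrow> x + conj x \<in> F"
  by (simp add: carrier_integers trace_in)

text \<open>
  For an integer \<open>x = a + b t\<close> of \<open>F(t)\<close>, both \<open>2 a = x + x'\<close> and \<open>2 b t\<^sup>2 = (x - x') t\<close> are integers
  of \<open>F\<close>.
\<close>

lemma integers_finitely_generated:
  assumes S: "finite S" "carrier (integers F) \<subseteq> zmod.span S" and t: "algebraic_int t"
  shows "\<exists>S'. finite S' \<and> OE \<subseteq> zmod.span S'"
proof -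
  have t0: "t \<noteq> 0" using not_in FD(1) by auto
  define S' where "S' = (\<lambda>s. 1 / 2 * s) ` S \<union> (\<lambda>s. t / (2 * (t * t)) * s) ` S"
  have "OE \<subseteq> zmod.span S'"
  proof
    fix x assume x: "x \<in> OE"
    then obtain a b where ab: "a \<in> F" "b \<in> F" "x = a + b * t" by (auto simp: carrier_integers elim: E_cases)
    have cx: "conj x = a - b * t" unfolding ab(3) by (rule conj_eq[OF ab(1,2)])
    have ai: "algebraic_int x" "algebraic_int (conj x)"
      using x conj_OE by (auto simp: carrier_integers)
    have "x + conj x = 2 * a" unfolding cx unfolding ab(3) by simp
    then have "algebraic_int (2 * a)" using algebraic_int_add_mult(1)[OF ai] by (simp only:)
    then have "2 * a \<in> carrier (integers F)"
      using ab(1) FD(6,10) by (simp add: carrier_integers)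
    then have "2 * a \<in> zmod.span S" using S by blast
    then have a: "1 / 2 * (2 * a) \<in> zmod.span S'"
      by (rule zmod_span_mult_closed[rotated]) (auto simp: S'_def intro: zmod.span_base)
    have "(x - conj x) * t = 2 * b * (t * t)" unfolding cx unfolding ab(3) by simp
    then have "algebraic_int (2 * b * (t * t))"
      using algebraic_int_add_mult(2)[OF algebraic_int_diff[OF ai] t] by (simp only:)
    then have "2 * b * (t * t) \<in> carrier (integers F)"
      using ab(2) FD(6,10) square by (simp add: carrier_integers)
    then have "2 * b * (t * t) \<in> zmod.span S" using S by blast
    then have "t / (2 * (t * t)) * (2 * b * (t * t)) \<in> zmod.span S'"
      by (rule zmod_span_mult_closed[rotated]) (auto simp: S'_def intro: zmod.span_base)
    moreover have "t / (2 * (t * t)) * (2 * b * (t * t)) = b * t" using t0 by simp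
    ultimately have bt: "b * t \<in> zmod.span S'" by (simp only:)
    have "1 / 2 * (2 * a) = a" by simp
    then show "x \<in> zmod.span S'" using zmod.span_add[OF a bt] unfolding ab(3) by (simp only:)
  qed
  moreover have "finite S'" using S(1) by (simp add: S'_def)
  ultimately show ?thesis by blast
qed

text \<open>
  Write \<open>x'\<close> for the conjugate of \<open>x\<close> and suppose that \<open>P \<inter> F \<subseteq> P\<^sup>2\<close>; then every \<open>x \<in> P\<close> is in \<open>P\<^sup>2\<close>.
  If \<open>P\<close> is stable under conjugation, the traces of elements of \<open>P\<close> lie in \<open>P \<inter> F\<close>, and
  \<open>(\<theta> - \<theta>') x = Tr(\<theta> x) - \<theta>' Tr(x)\<close> lies in \<open>P\<^sup>2\<close>, where \<open>\<theta> - \<theta>' \<notin> P\<close> can be cancelled.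
  Otherwise choose \<open>z \<in> P\<close> with \<open>z' \<notin> P\<close> and put \<open>s = z'\<^sup>2\<close>. Then \<open>Tr(s x) = s x + z\<^sup>2 x'\<close> lies in
  \<open>P \<inter> F\<close>, and \<open>z\<^sup>2 x'\<close> in \<open>P\<^sup>2\<close>, so \<open>s x \<in> P\<^sup>2\<close> with \<open>s \<notin> P\<close>. In both cases \<open>P = P\<^sup>2\<close> follows.
\<close>

lemma unramified_at_prime:
  assumes P: "primeideal P (integers E)" "P \<noteq> {0}"
    and fg: "finite S" "OE \<subseteq> zmod.span S"
    and \<theta>: "\<theta> \<in> OE" "\<theta> - conj \<theta> \<notin> P"
  shows "ramification_index F E P = 1"
proof (rule ramification_index_1[OF E_subfield prime_integers_D(1)[OF P(1)]])
  interpret integral_prime E P by (rule integral_prime.intro[OF E_subfield P])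
  define Q where "Q = ideal_power (integers E) P 2"
  have Q: "ideal Q (integers E)" unfolding Q_def by (rule ideal_power_ideal[OF E_subfield P_ideal])
  note QI = ideal_integers_D[OF Q E_subfield]
  have one: "ideal_prod (integers E) P OE = P"
    using ring.ideal_prod_one[OF cring.axioms(1)[OF cring_integers[OF E_subfield]] P_ideal] by simp
  have Q_eq: "Q = ideal_prod (integers E) P P"
    by (simp add: Q_def ideal_power_def numeral_2_eq_2 one)
  have PP: "x * y \<in> Q" if "x \<in> P" "y \<in> P" for x y
    using ideal_prod.prod[OF that, of "integers E"] by (simp add: Q_eq)
  show "\<not> P \<inter> F \<subseteq> ideal_power (integers E) P 2"
  proof
    assume "P \<inter> F \<subseteq> ideal_power (integers E) P 2"
    then have sub: "x \<in> Q" if "x \<in> P" "x \<in> F" for x using that by (auto simp: Q_def)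
    have "P \<subseteq> Q"
    proof
      fix x assume x: "x \<in> P"
      then have xO: "x \<in> OE" using PI(1) by blast
      have xE: "x \<in> E" "\<theta> \<in> E" using xO \<theta> by (auto simp: carrier_integers)
      show "x \<in> Q"
      proof (cases "\<forall>y\<in>P. conj y \<in> P")
        case True
        have tr: "y + conj y \<in> Q" if "y \<in> P" for y
        proof (rule sub)
          show "y + conj y \<in> P" using that True PI(3) by blast
          show "y + conj y \<in> F" using that PI(1) trace_F by blast
        qed
        have "\<theta> * x + conj (\<theta> * x) - conj \<theta> * (x + conj x) \<in> Q"
          using QI(7)[OF tr[OF PI(4)[OF x \<theta>(1)]] QI(4)[OF tr[OF x] conj_OE[OF \<theta>(1)]]] .
        moreover have "\<theta> * x + conj (\<theta> * x) - conj \<theta> * (x + conj x) = (\<theta> - conj \<theta>) * x"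
          unfolding conj_mult[OF xE(2,1)] by (simp add: algebra_simps)
        ultimately have "(\<theta> - conj \<theta>) * x \<in> Q" by simp
        then show ?thesis
          by (intro mem_ideal_of_mult[OF Q x _ \<theta>(2) _ PP] O(6)[OF \<theta>(1) conj_OE[OF \<theta>(1)]])
      next
        case False
        then obtain z where z: "z \<in> P" "conj z \<notin> P" by blast
        have zO: "z \<in> OE" "conj z \<in> OE" using z(1) PI(1) conj_OE by blast+
        have zE: "z \<in> E" "conj z \<in> E" using zO by (auto simp: carrier_integers)
        define s where "s = conj z * conj z"
        have s: "s \<in> OE" "s \<notin> P"
          using O(7)[OF zO(2,2)] P_prime[OF zO(2,2)] z(2) by (auto simp: s_def)
        have cs: "conj (s * x) = conj x * (z * z)"
          using xE zE ED by (simp add: s_def conj_mult conj_conj)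
        have c2: "conj x * (z * z) \<in> Q" by (rule QI(4)[OF PP[OF z(1,1)] conj_OE[OF xO]])
        have "Q \<subseteq> P"
          using ring.ideal_prod_inter[OF cring.axioms(1)[OF cring_integers[OF E_subfield]] P_ideal P_ideal]
          by (auto simp: Q_eq)
        then have "s * x + conj (s * x) \<in> P" unfolding cs using PI(3)[OF PI(4)[OF x s(1)]] c2 by blast
        moreover have "s * x + conj (s * x) \<in> F" by (rule trace_F[OF O(7)[OF s(1) xO]])
        ultimately have "s * x + conj x * (z * z) \<in> Q" using sub unfolding cs by blast
        then have "s * x + conj x * (z * z) - conj x * (z * z) \<in> Q" using c2 by (rule QI(7))
        then have "s * x \<in> Q" by simp
        then show ?thesis by (rule mem_ideal_of_mult[OF Q x s _ PP])
      qed
    qed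
    then have "P \<subseteq> ideal_prod (integers E) P P" by (simp only: Q_eq)
    then show False by (rule prime_not_idempotent[OF fg])
  qed
qed

end

section \<open>Conjugates of unramified extensions\<close>

text \<open>
  Transitivity of finiteness over the rationals, phrased with integer spans and denominators: if
  \<open>T\<close> spans \<open>K\<close> over the rationals, the elements of a basis of \<open>E\<close> over \<open>K\<close> times those of \<open>T\<close>
  span \<open>E\<close>.
\<close>

lemma dimension_common_denominator:
  assumes T: "finite T" "T \<subseteq> K" "0 \<in> K" "\<And>k. k \<in> K \<Longrightarrow> \<exists>n :: int. n \<noteq> 0 \<and> of_int n * k \<in> zmod.span T"
    and "CC.dimension n K E"
  shows "0 \<in> E \<and> (\<exists>S. finite S \<and> S \<subseteq> E \<and> (\<forall>v\<in>E. \<exists>n :: int. n \<noteq> 0 \<and> of_int n * v \<in> zmod.span S))"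
  using assms(5)
proof (induction n arbitrary: E)
  case 0
  then have "E = {0}" by (rule dimension_0_CC_D)
  then show ?case by (auto intro!: exI[of _ "{}"] exI[of _ 1])
next
  case (Suc n)
  from dimension_Suc_CC_D[OF Suc.prems] obtain v E' where
    E': "CC.dimension n K E'" "E = {k * v + e | k e. k \<in> K \<and> e \<in> E'}" by blast
  from Suc.IH[OF E'(1)] obtain S where z: "0 \<in> E'" and S: "finite S" "S \<subseteq> E'"
    "\<And>e. e \<in> E' \<Longrightarrow> \<exists>n :: int. n \<noteq> 0 \<and> of_int n * e \<in> zmod.span S" by blast
  \<comment> \<open>Rational generators of \<open>E'\<close> together with those of the line \<open>K v\<close>.\<close>
  define S' where "S' = S \<union> (\<lambda>k. v * k) ` T"
  have memE: "k * v + e \<in> E" if "k \<in> K" "e \<in> E'" for k e using that unfolding E'(2) by blast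
  have "S' \<subseteq> E"
  proof
    fix s assume "s \<in> S'"
    then consider "s \<in> S" | k where "k \<in> T" "s = v * k" by (auto simp: S'_def)
    then show "s \<in> E"
    proof cases
      case 1
      then show ?thesis using memE[OF T(3), of s] S(2) by auto
    next
      case 2
      then show ?thesis using memE[of k 0] T(2) z by (auto simp: mult.commute)
    qed
  qed
  moreover have "\<exists>n :: int. n \<noteq> 0 \<and> of_int n * w \<in> zmod.span S'" if "w \<in> E" for w
  proof -
    from that obtain k e where ke: "w = k * v + e" "k \<in> K" "e \<in> E'" unfolding E'(2) by blast
    from T(4)[OF ke(2)] obtain m :: int where m: "m \<noteq> 0" "of_int m * k \<in> zmod.span T" by blast
    from S(3)[OF ke(3)] obtain l :: int where l: "l \<noteq> 0" "of_int l * e \<in> zmod.span S" by blast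
    have vk: "v * (of_int m * k) \<in> zmod.span S'"
      using m(2) by (rule zmod_span_mult_closed[rotated]) (auto simp: S'_def intro: zmod.span_base)
    have e: "of_int l * e \<in> zmod.span S'"
      using l(2) zmod.span_mono[of S S'] by (auto simp: S'_def)
    have "of_int l * (v * (of_int m * k)) + of_int m * (of_int l * e) \<in> zmod.span S'"
      by (rule zmod.span_add[OF zmod.span_scale[OF vk] zmod.span_scale[OF e]])
    moreover have "of_int l * (v * (of_int m * k)) + of_int m * (of_int l * e) = of_int (l * m) * w"
      unfolding ke(1) by (simp add: algebra_simps)
    ultimately show ?thesis using m(1) l(1) by (metis mult_eq_0_iff)
  qed
  moreover have "finite S'" using S(1) T(1) by (simp add: S'_def)
  moreover have "0 \<in> E" using memE[OF T(3) z] by simp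
  ultimately show ?case by blast
qed

text \<open>
  A common denominator \<open>N\<close> of the finitely many products \<open>x s\<close> makes the span of \<open>S\<close> stable under
  \<open>N x\<close>.
\<close>

lemma algebraic_of_common_denominator:
  assumes S: "finite S" "S \<subseteq> L" "\<And>v. v \<in> L \<Longrightarrow> \<exists>n :: int. n \<noteq> 0 \<and> of_int n * v \<in> zmod.span S"
    and L: "1 \<in> L" "\<And>x y. x \<in> L \<Longrightarrow> y \<in> L \<Longrightarrow> x * y \<in> L" and x: "x \<in> L"
  shows "algebraic x"
proof -
  have "\<forall>s\<in>S. \<exists>n :: int. n \<noteq> 0 \<and> of_int n * (x * s) \<in> zmod.span S"
    using S L x by blast
  then obtain f :: "complex \<Rightarrow> int" where
    f: "\<And>s. s \<in> S \<Longrightarrow> f s \<noteq> 0 \<and> of_int (f s) * (x * s) \<in> zmod.span S" by metis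
  define N where "N = prod f S"
  have N: "N \<noteq> 0" using f S(1) by (simp add: N_def)
  have NS: "of_int N * x * s \<in> zmod.span S" if "s \<in> S" for s
  proof -
    have "N = prod f (S - {s}) * f s" unfolding N_def using S(1) that by (simp add: prod.remove mult.commute)
    then have eq: "of_int N * x * s = of_int (prod f (S - {s})) * (of_int (f s) * (x * s))"
      by (simp only: of_int_mult mult.assoc)
    show ?thesis unfolding eq by (rule zmod.span_scale) (use f[OF that] in blast)
  qed
  obtain s0 where "s0 \<in> S" "s0 \<noteq> 0"
  proof (rule ccontr)
    assume "\<not> thesis"
    then have "S \<subseteq> {0}" using that by auto
    then have "zmod.span S \<subseteq> {0}" by (intro zmod.span_minimal) auto
    then show False using S(3)[OF L(1)] by auto
  qed
  then have "algebraic_int (of_int N * x)" by (rule algebraic_int_of_stable_zmod[OF S(1) _ _ NS])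
  then show ?thesis by (rule algebraic_of_algebraic_int_multiple[OF N])
qed

lemma (in radicand) common_denominator:
  assumes "k \<in> E"
  shows "\<exists>n :: int. n \<noteq> 0 \<and> of_int n * k \<in> zmod.span {1, rt d}"
proof -
  from assms obtain a b where ab: "a \<in> \<rat>" "b \<in> \<rat>" "k = a + b * rt d" by (rule E_cases)
  obtain p q :: int where p: "q > 0" "a = of_int p / of_int q" using ab(1) by (rule Rats_cases')
  obtain p' q' :: int where p': "q' > 0" "b = of_int p' / of_int q'" using ab(2) by (rule Rats_cases')
  have "of_int (p * q') * 1 + of_int (q * p') * rt d \<in> zmod.span {1, rt d}"
    by (intro zmod.span_add zmod.span_scale zmod.span_base) auto
  moreover have "of_int (p * q') * 1 + of_int (q * p') * rt d = of_int (q * q') * k"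
  proof -
    have "(u * y) * 1 + (x * v) * r = (x * y) * (u / x + v / y * r)"
      if "x \<noteq> 0" "y \<noteq> 0" for u v x y r :: complex
      using that by (simp add: distrib_left)
    from this[of "of_int q" "of_int q'"] show ?thesis
      unfolding ab(3) p(2) p'(2) of_int_mult using p(1) p'(1) by simp
  qed
  ultimately have "of_int (q * q') * k \<in> zmod.span {1, rt d}" by (simp only:)
  then show ?thesis using p(1) p'(1) by (intro exI[of _ "q * q'"]) auto
qed

lemma (in radicand) finite_extension_algebraic:
  assumes "finite_extension E L"
  shows "L \<subseteq> Alg"
proof
  fix x assume x: "x \<in> L"
  have L: "subfield L CC" and fd: "CC.finite_dimension E L"
    using assms by (auto simp: finite_extension_def)
  from fd obtain n where n: "CC.dimension n E L" by (auto simp: CC.finite_dimension_def)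
  have "0 \<in> L \<and> (\<exists>S. finite S \<and> S \<subseteq> L \<and> (\<forall>v\<in>L. \<exists>n :: int. n \<noteq> 0 \<and> of_int n * v \<in> zmod.span S))"
    by (rule dimension_common_denominator[OF _ _ ED(1) common_denominator n]) (use ED t_in in auto)
  then obtain S where S: "finite S" "S \<subseteq> L" "\<And>v. v \<in> L \<Longrightarrow> \<exists>n :: int. n \<noteq> 0 \<and> of_int n * v \<in> zmod.span S"
    by blast
  have "algebraic x"
    by (rule algebraic_of_common_denominator[OF S subfield_CC_D(2)[OF L] subfield_CC_D(6)[OF L] x])
  then show "x \<in> Alg" by simp
qed

text \<open>
  An automorphism of the algebraic numbers over \<open>K\<close>. Everything in the definition of an unramified
  extension of \<open>K\<close> is carried along by such a map.
\<close>

locale conjugation =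
  fixes K :: "complex set" and \<sigma> :: "complex \<Rightarrow> complex"
  assumes \<sigma>: "Alg_automorphism \<sigma>" and K: "subfield K CC" "K \<subseteq> Alg" and fixes_K: "\<And>x. x \<in> K \<Longrightarrow> \<sigma> x = x"
begin

lemma hom: "\<sigma> \<in> Ring.ring_hom (field_ring Alg) CC" using \<sigma> by (simp add: Alg_automorphism_def)
lemma bij: "bij_betw \<sigma> Alg Alg" using \<sigma> by (simp add: Alg_automorphism_def)
lemma inj: "inj_on \<sigma> Alg" using bij by (rule bij_betw_imp_inj_on)

lemmas H = ring_hom_CC_D[OF hom subfield_Alg]

lemma image_subset_iff:
  assumes "A \<subseteq> Alg" "B \<subseteq> Alg"
  shows "\<sigma> ` A \<subseteq> \<sigma> ` B \<longleftrightarrow> A \<subseteq> B"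
proof
  assume sub: "\<sigma> ` A \<subseteq> \<sigma> ` B"
  show "A \<subseteq> B"
  proof
    fix x assume "x \<in> A"
    then have "\<sigma> x \<in> \<sigma> ` B" "x \<in> Alg" using sub assms(1) by auto
    then show "x \<in> B" using inj_on_image_mem_iff[OF inj _ assms(2)] by simp
  qed
qed (rule image_mono)

lemma algebraic_int_iff:
  assumes "x \<in> Alg"
  shows "algebraic_int (\<sigma> x) \<longleftrightarrow> algebraic_int x"
proof
  assume "algebraic_int (\<sigma> x)"
  then obtain p where p: "poly (map_poly of_int p) (\<sigma> x) = 0" "lead_coeff p = (1 :: int)"
    by (auto simp: algebraic_int_altdef_ipoly)
  have "\<sigma> (poly (map_poly of_int p) x) = 0"
    unfolding ring_hom_CC_poly[OF hom subfield_Alg assms] by (rule p(1))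
  moreover have "poly (map_poly of_int p) x \<in> Alg"
    unfolding poly_altdef
    by (intro subfield_CC_sum[OF subfield_Alg] subfield_CC_D(6)[OF subfield_Alg]
        subfield_CC_power[OF subfield_Alg assms]) (simp add: coeff_map_poly)
  ultimately have "poly (map_poly of_int p) x = 0" by (rule H(9)[rotated])
  then show "algebraic_int x" unfolding algebraic_int_altdef_ipoly using p(2) by blast
qed (rule ring_hom_CC_algebraic_int[OF hom subfield_Alg assms])

lemma subfield_image:
  assumes L: "subfield L CC" "L \<subseteq> Alg"
  shows "subfield (\<sigma> ` L) CC"
proof (rule subfield_CC_I)
  note LD = subfield_CC_D[OF L(1)]
  have m: "x \<in> L \<Longrightarrow> x \<in> Alg" for x using L(2) by blast
  show "1 \<in> \<sigma> ` L" using LD(2) H(1) by (metis image_eqI)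
  show "- y \<in> \<sigma> ` L" if "y \<in> \<sigma> ` L" for y
  proof -
    from that obtain x where x: "x \<in> L" "y = \<sigma> x" by blast
    then have "- y = \<sigma> (- x)" using H(5) m by simp
    then show ?thesis using LD(3) x by blast
  qed
  show "y * y' \<in> \<sigma> ` L" "y + y' \<in> \<sigma> ` L" if "y \<in> \<sigma> ` L" "y' \<in> \<sigma> ` L" for y y'
  proof -
    from that obtain x x' where x: "x \<in> L" "y = \<sigma> x" "x' \<in> L" "y' = \<sigma> x'" by blast
    then have "y * y' = \<sigma> (x * x')" "y + y' = \<sigma> (x + x')" using H(3,4) m by simp_all
    then show "y * y' \<in> \<sigma> ` L" "y + y' \<in> \<sigma> ` L" using LD(4,6) x by blast+
  qed
  show "inverse y \<in> \<sigma> ` L" if "y \<in> \<sigma> ` L" for y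
  proof -
    from that obtain x where x: "x \<in> L" "y = \<sigma> x" by blast
    then have "inverse y = \<sigma> (inverse x)" using H(11) m by simp
    then show ?thesis using LD(7) x by blast
  qed
qed

lemma dimension_image:
  assumes "CC.dimension n K L" "L \<subseteq> Alg"
  shows "0 \<in> L \<and> CC.dimension n K (\<sigma> ` L)"
  using assms
proof (induction n arbitrary: L)
  case 0
  then have "L = {0}" by (auto dest: dimension_0_CC_D)
  then show ?case using H(2) CC.dimension.zero_dim[of K] by simp
next
  case (Suc n)
  from dimension_Suc_CC_D[OF Suc.prems(1)] obtain v E where
    E: "v \<notin> E" "CC.dimension n K E" "L = {k * v + e | k e. k \<in> K \<and> e \<in> E}" by blast
  note KD = subfield_CC_D[OF K(1)]
  have "E \<subseteq> L" unfolding E(3) using KD(1) by force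
  then have EA: "E \<subseteq> Alg" using Suc.prems(2) by blast
  from Suc.IH[OF E(2) EA] have z: "0 \<in> E" and dim: "CC.dimension n K (\<sigma> ` E)" by auto
  have "1 * v + 0 \<in> L" unfolding E(3) using KD(2) z by blast
  then have vA: "v \<in> Alg" using Suc.prems(2) by auto
  have "\<sigma> v \<notin> \<sigma> ` E"
  proof
    assume "\<sigma> v \<in> \<sigma> ` E"
    then have "v \<in> E" using inj_on_image_mem_iff[OF inj vA EA] by simp
    then show False using E(1) by simp
  qed
  then have "CC.dimension (Suc n) K (CC.line_extension K (\<sigma> v) (\<sigma> ` E))"
    using dim by (intro CC.dimension.Suc_dim) auto
  moreover have lin: "\<sigma> (k * v + e) = k * \<sigma> v + \<sigma> e" if "k \<in> K" "e \<in> E" for k e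
  proof -
    have kA: "k \<in> Alg" "e \<in> Alg" using that K(2) EA by auto
    have "\<sigma> (k * v + e) = \<sigma> (k * v) + \<sigma> e"
      by (rule H(3)[OF subfield_CC_D(6)[OF subfield_Alg kA(1) vA] kA(2)])
    also have "\<sigma> (k * v) = k * \<sigma> v" using H(4)[OF kA(1) vA] fixes_K[OF that(1)] by simp
    finally show ?thesis .
  qed
  have "CC.line_extension K (\<sigma> v) (\<sigma> ` E) = \<sigma> ` L"
  proof
    show "\<sigma> ` L \<subseteq> CC.line_extension K (\<sigma> v) (\<sigma> ` E)"
      unfolding line_extension_CC E(3) using lin by blast
    show "CC.line_extension K (\<sigma> v) (\<sigma> ` E) \<subseteq> \<sigma> ` L"
    proof
      fix y assume "y \<in> CC.line_extension K (\<sigma> v) (\<sigma> ` E)"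
      then obtain k e where ke: "k \<in> K" "e \<in> E" "y = k * \<sigma> v + \<sigma> e" unfolding line_extension_CC by blast
      then have "y = \<sigma> (k * v + e)" using lin by simp
      moreover have "k * v + e \<in> L" unfolding E(3) using ke by blast
      ultimately show "y \<in> \<sigma> ` L" by blast
    qed
  qed
  ultimately have "CC.dimension (Suc n) K (\<sigma> ` L)" by simp
  moreover have "0 \<in> L" using \<open>E \<subseteq> L\<close> z by blast
  ultimately show ?case by blast
qed

lemma integers_image:
  assumes "L \<subseteq> Alg"
  shows "carrier (integers (\<sigma> ` L)) = \<sigma> ` carrier (integers L)"
proof -
  have "algebraic_int (\<sigma> x) \<longleftrightarrow> algebraic_int x" if "x \<in> L" for x
    using that assms by (intro algebraic_int_iff) auto
  then show ?thesis by (auto simp: set_eq_iff carrier_integers)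
qed

lemma ideal_prod_image:
  assumes L: "L \<subseteq> Alg" and IJ: "I \<subseteq> L" "J \<subseteq> L"
    and sub: "ideal_prod (integers L) I J \<subseteq> L"
  shows "ideal_prod (integers (\<sigma> ` L)) (\<sigma> ` I) (\<sigma> ` J) = \<sigma> ` ideal_prod (integers L) I J"
proof
  show "ideal_prod (integers (\<sigma> ` L)) (\<sigma> ` I) (\<sigma> ` J) \<subseteq> \<sigma> ` ideal_prod (integers L) I J"
  proof
    fix y assume "y \<in> ideal_prod (integers (\<sigma> ` L)) (\<sigma> ` I) (\<sigma> ` J)"
    then show "y \<in> \<sigma> ` ideal_prod (integers L) I J"
    proof (induction rule: ideal_prod.induct)
      case (prod i j)
      then obtain a b where ab: "a \<in> I" "b \<in> J" "i = \<sigma> a" "j = \<sigma> b" by blast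
      then have "a \<in> Alg" "b \<in> Alg" using IJ L by blast+
      then have "i * j = \<sigma> (a * b)" by (simp only: ab(3,4) H(4))
      moreover have "a * b \<in> ideal_prod (integers L) I J"
        using ideal_prod.prod[OF ab(1,2), of "integers L"] by simp
      ultimately show ?case by auto
    next
      case (sum s1 s2)
      then obtain a b where ab: "a \<in> ideal_prod (integers L) I J" "b \<in> ideal_prod (integers L) I J"
        "s1 = \<sigma> a" "s2 = \<sigma> b" by blast
      then have "a \<in> Alg" "b \<in> Alg" using sub L by blast+
      then have "s1 + s2 = \<sigma> (a + b)" by (simp only: ab(3,4) H(3))
      moreover have "a + b \<in> ideal_prod (integers L) I J"
        using ideal_prod.sum[OF ab(1,2)] by simp
      ultimately show ?case by auto
    qed
  qed
  show "\<sigma> ` ideal_prod (integers L) I J \<subseteq> ideal_prod (integers (\<sigma> ` L)) (\<sigma> ` I) (\<sigma> ` J)"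
  proof (rule image_subsetI)
    fix x assume "x \<in> ideal_prod (integers L) I J"
    then have "x \<in> L \<and> \<sigma> x \<in> ideal_prod (integers (\<sigma> ` L)) (\<sigma> ` I) (\<sigma> ` J)"
    proof (induction rule: ideal_prod.induct)
      case (prod i j)
      have "i \<in> Alg" "j \<in> Alg" using prod IJ L by blast+
      then have "\<sigma> (i * j) = \<sigma> i * \<sigma> j" by (rule H(4))
      moreover have "\<sigma> i * \<sigma> j \<in> ideal_prod (integers (\<sigma> ` L)) (\<sigma> ` I) (\<sigma> ` J)"
        using ideal_prod.prod[of "\<sigma> i" "\<sigma> ` I" "\<sigma> j" "\<sigma> ` J" "integers (\<sigma> ` L)"] prod by simp
      moreover have "i * j \<in> L" using ideal_prod.prod[OF prod, of "integers L"] sub by auto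
      ultimately show ?case by simp
    next
      case (sum s1 s2)
      have "s1 \<in> Alg" "s2 \<in> Alg" using sum.IH L by blast+
      then have "\<sigma> (s1 + s2) = \<sigma> s1 + \<sigma> s2" by (rule H(3))
      moreover have "\<sigma> s1 + \<sigma> s2 \<in> ideal_prod (integers (\<sigma> ` L)) (\<sigma> ` I) (\<sigma> ` J)"
        using ideal_prod.sum[of "\<sigma> s1" "integers (\<sigma> ` L)" "\<sigma> ` I" "\<sigma> ` J" "\<sigma> s2"] sum by simp
      moreover have "s1 + s2 \<in> L" using ideal_prod.sum[OF sum(1,2)] sub by auto
      ultimately show ?case by simp
    qed
    then show "\<sigma> x \<in> ideal_prod (integers (\<sigma> ` L)) (\<sigma> ` I) (\<sigma> ` J)" by simp
  qed
qed

lemma ideal_power_image: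
  assumes L: "subfield L CC" "L \<subseteq> Alg" and P: "ideal P (integers L)"
  shows "ideal_power (integers (\<sigma> ` L)) (\<sigma> ` P) e = \<sigma> ` ideal_power (integers L) P e"
proof (induction e)
  case 0
  then show ?case using integers_image[OF L(2)] by (simp add: ideal_power_def)
next
  case (Suc e)
  have OL: "carrier (integers L) \<subseteq> L" by (auto simp: carrier_integers)
  have sub: "I \<subseteq> L" if "ideal I (integers L)" for I
    using ideal_integers_D(1)[OF that L(1)] OL by blast
  have pow: "ideal_power R I (Suc e) = ideal_prod R I (ideal_power R I e)" for R :: "complex ring" and I
    by (simp add: ideal_power_def)
  show ?case unfolding pow Suc.IH
    using ideal_power_ideal[OF L(1) P, of "Suc e"] unfolding pow
    by (intro ideal_prod_image[OF L(2)] sub P ideal_power_ideal[OF L(1) P])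
qed

text \<open>
  A prime \<open>P'\<close> of the conjugate field is the image of its preimage \<open>P\<close>, and \<open>P' \<inter> K\<close> and the powers
  of \<open>P'\<close> are the images of \<open>P \<inter> K\<close> and of the powers of \<open>P\<close>, so the ramification indices agree. An
  embedding of the conjugate field restricts to \<open>K\<close> in the same way as its composition with \<open>\<sigma>\<close>.
\<close>

lemma unramified_image:
  assumes unr: "unramified_extension K L" and LA: "L \<subseteq> Alg"
  shows "unramified_extension K (\<sigma> ` L)"
proof -
  have L: "subfield L CC" and KL: "K \<subseteq> L" and fd: "CC.finite_dimension K L"
    using unr by (auto simp: unramified_extension_def finite_extension_def)
  note LD = subfield_CC_D[OF L]
  have sL: "subfield (\<sigma> ` L) CC" by (rule subfield_image[OF L LA])
  have KsL: "K \<subseteq> \<sigma> ` L" using KL fixes_K by force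
  have LmA: "x \<in> Alg" if "x \<in> L" for x using that LA by blast
  have "CC.finite_dimension K (\<sigma> ` L)"
    using fd dimension_image[OF _ LA] unfolding CC.finite_dimension_def by blast
  then have fin: "finite_extension K (\<sigma> ` L)"
    using K(1) sL KsL by (simp add: finite_extension_def)
  have ram: "ramification_index K (\<sigma> ` L) P' = 1"
    if P': "primeideal P' (integers (\<sigma> ` L))" "P' \<noteq> {0}" for P'
  proof -
    define P where "P = {x \<in> carrier (integers L). \<sigma> x \<in> P'}"
    note ID' = ideal_integers_D[OF prime_integers_D(1)[OF P'(1)] sL]
    have "ring_hom_ring (integers L) (integers (\<sigma> ` L)) \<sigma>"
    proof (rule ring_hom_ringI)
      show "ring (integers L)" "ring (integers (\<sigma> ` L))"
        using cring_integers[OF L] cring_integers[OF sL] cring.axioms(1) by blast+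
      show "\<sigma> x \<in> carrier (integers (\<sigma> ` L))" if "x \<in> carrier (integers L)" for x
        using that unfolding integers_image[OF LA] by blast
      fix x y assume "x \<in> carrier (integers L)" "y \<in> carrier (integers L)"
      then have "x \<in> Alg" "y \<in> Alg" using LmA by (auto simp: carrier_integers)
      then show "\<sigma> (x \<otimes>\<^bsub>integers L\<^esub> y) = \<sigma> x \<otimes>\<^bsub>integers (\<sigma> ` L)\<^esub> \<sigma> y"
        "\<sigma> (x \<oplus>\<^bsub>integers L\<^esub> y) = \<sigma> x \<oplus>\<^bsub>integers (\<sigma> ` L)\<^esub> \<sigma> y"
        using H(3,4) by simp_all
    qed (simp add: H(1))
    then have P: "primeideal P (integers L)"
      unfolding P_def using ring_hom_ring.primeideal_vimage cring_integers[OF L] P'(1) by blast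
    note ID = ideal_integers_D[OF prime_integers_D(1)[OF P] L]
    have P'_eq: "P' = \<sigma> ` P"
      using ID'(1) unfolding P_def integers_image[OF LA] by blast
    have "P \<noteq> {0}"
    proof
      assume "P = {0}"
      then have "P' = {0}" unfolding P'_eq using H(2) by simp
      then show False using P'(2) by simp
    qed
    then have 1: "ramification_index K L P = 1" using unr P by (simp add: unramified_extension_def)
    have OA: "carrier (integers L) \<subseteq> Alg" by (auto simp: carrier_integers)
    have PKO: "P \<inter> K \<subseteq> carrier (integers L)" using ID(1) by blast
    have PK: "P' \<inter> K = \<sigma> ` (P \<inter> K)"
    proof
      show "\<sigma> ` (P \<inter> K) \<subseteq> P' \<inter> K" unfolding P'_eq
      proof (rule image_subsetI)
        fix x assume x: "x \<in> P \<inter> K"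
        then have "\<sigma> x \<in> K" by (simp add: fixes_K)
        then show "\<sigma> x \<in> \<sigma> ` P \<inter> K" using x by blast
      qed
      show "P' \<inter> K \<subseteq> \<sigma> ` (P \<inter> K)"
      proof
        fix y assume y: "y \<in> P' \<inter> K"
        then have "algebraic_int y" using ID'(1) by (auto simp: carrier_integers)
        then have "y \<in> carrier (integers L)" using y KL by (auto simp: carrier_integers)
        moreover have "\<sigma> y = y" using y fixes_K by simp
        ultimately show "y \<in> \<sigma> ` (P \<inter> K)" using y unfolding P_def by force
      qed
    qed
    have P'KO: "P' \<inter> K \<subseteq> carrier (integers (\<sigma> ` L))" using ID'(1) by blast
    have "(genideal (integers (\<sigma> ` L)) (P' \<inter> K) \<subseteq> ideal_power (integers (\<sigma> ` L)) P' e) =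
        (genideal (integers L) (P \<inter> K) \<subseteq> ideal_power (integers L) P e)" for e
    proof -
      have pow: "ideal (ideal_power (integers L) P e) (integers L)"
        by (rule ideal_power_ideal[OF L prime_integers_D(1)[OF P]])
      have pow': "ideal (ideal_power (integers (\<sigma> ` L)) P' e) (integers (\<sigma> ` L))"
        by (rule ideal_power_ideal[OF sL prime_integers_D(1)[OF P'(1)]])
      have eq: "ideal_power (integers (\<sigma> ` L)) P' e = \<sigma> ` ideal_power (integers L) P e"
        unfolding P'_eq by (rule ideal_power_image[OF L LA prime_integers_D(1)[OF P]])
      have "genideal (integers (\<sigma> ` L)) (P' \<inter> K) \<subseteq> ideal_power (integers (\<sigma> ` L)) P' e \<longleftrightarrow>
          \<sigma> ` (P \<inter> K) \<subseteq> \<sigma> ` ideal_power (integers L) P e"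
        unfolding PK[symmetric] eq[symmetric] by (rule genideal_subset_iff[OF sL pow' P'KO])
      also have "\<dots> \<longleftrightarrow> P \<inter> K \<subseteq> ideal_power (integers L) P e"
        by (rule image_subset_iff[OF subset_trans[OF PKO OA] subset_trans[OF ideal_integers_D(1)[OF pow L] OA]])
      also have "\<dots> \<longleftrightarrow> genideal (integers L) (P \<inter> K) \<subseteq> ideal_power (integers L) P e"
        by (rule genideal_subset_iff[OF L pow PKO, symmetric])
      finally show ?thesis .
    qed
    then have "ramification_index K (\<sigma> ` L) P' = ramification_index K L P"
      unfolding ramification_index_def by simp
    then show ?thesis using 1 by simp
  qed
  have real: "\<rho> ` (\<sigma> ` L) \<subseteq> \<real>" if \<rho>: "\<rho> \<in> embeddings (\<sigma> ` L)" "\<rho> ` K \<subseteq> \<real>" for \<rho>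
  proof -
    have \<rho>hom: "\<rho> 1 = 1" "\<And>x y. x \<in> \<sigma> ` L \<Longrightarrow> y \<in> \<sigma> ` L \<Longrightarrow> \<rho> (x * y) = \<rho> x * \<rho> y \<and> \<rho> (x + y) = \<rho> x + \<rho> y"
      using \<rho>(1) by (auto simp: embeddings_def ring_hom_field_ring_CC_iff)
    define \<tau> where "\<tau> = restrict (\<lambda>x. \<rho> (\<sigma> x)) L"
    have \<tau>: "\<tau> x = \<rho> (\<sigma> x)" if "x \<in> L" for x using that by (simp add: \<tau>_def)
    have "\<tau> \<in> embeddings L"
      unfolding embeddings_def
    proof
      show "\<tau> \<in> extensional L" by (simp add: \<tau>_def)
      show "\<tau> \<in> Ring.ring_hom (field_ring L) CC"
        unfolding ring_hom_field_ring_CC_iff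
      proof (intro conjI ballI)
        show "\<tau> 1 = 1" using \<tau>[OF LD(2)] H(1) \<rho>hom(1) by simp
        fix x y assume xy: "x \<in> L" "y \<in> L"
        have s: "\<sigma> (x * y) = \<sigma> x * \<sigma> y" "\<sigma> (x + y) = \<sigma> x + \<sigma> y"
          using H(3,4) LmA xy by simp_all
        have "\<rho> (\<sigma> x * \<sigma> y) = \<rho> (\<sigma> x) * \<rho> (\<sigma> y) \<and> \<rho> (\<sigma> x + \<sigma> y) = \<rho> (\<sigma> x) + \<rho> (\<sigma> y)"
          by (rule \<rho>hom(2)) (use xy in auto)
        then show "\<tau> (x * y) = \<tau> x * \<tau> y" "\<tau> (x + y) = \<tau> x + \<tau> y"
          using s \<tau>[OF xy(1)] \<tau>[OF xy(2)] \<tau>[OF LD(6)[OF xy]] \<tau>[OF LD(4)[OF xy]] by simp_all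
      qed
    qed
    moreover have "\<tau> ` K \<subseteq> \<real>"
    proof (rule image_subsetI)
      fix x assume "x \<in> K"
      then have "\<tau> x = \<rho> x" using \<tau> KL fixes_K by auto
      then show "\<tau> x \<in> \<real>" using \<rho>(2) \<open>x \<in> K\<close> by auto
    qed
    ultimately have "\<tau> ` L \<subseteq> \<real>" using unr by (simp add: unramified_extension_def)
    then show ?thesis using \<tau> by (force simp: image_subset_iff)
  qed
  show ?thesis using fin ram real by (simp add: unramified_extension_def)
qed

text \<open>
  Applying invariance under conjugation to the inverse as well turns inclusions into equalities.
\<close>

lemma inverse_conjugation: "conjugation K (inv_into Alg \<sigma>)"
proof (rule conjugation.intro)
  let ?\<tau> = "inv_into Alg \<sigma>"
  have left: "?\<tau> (\<sigma> x) = x" if "x \<in> Alg" for x by (rule inv_into_f_f[OF inj that])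
  have bij': "bij_betw ?\<tau> Alg Alg" by (rule bij_betw_inv_into[OF bij])
  have surj: "\<exists>x\<in>Alg. y = \<sigma> x" if "y \<in> Alg" for y
    using that bij unfolding bij_betw_def by blast
  have "?\<tau> \<in> Ring.ring_hom (field_ring Alg) CC"
    unfolding ring_hom_field_ring_CC_iff
  proof (intro conjI ballI)
    show "?\<tau> 1 = 1" using left[of 1] H(1) by simp
    fix y y' assume "y \<in> Alg" "y' \<in> Alg"
    then obtain x x' where x: "x \<in> Alg" "x' \<in> Alg" "y = \<sigma> x" "y' = \<sigma> x'" using surj by meson
    have "x * x' \<in> Alg" "x + x' \<in> Alg" using x(1,2) subfield_CC_D(4,6)[OF subfield_Alg] by blast+
    then show "?\<tau> (y * y') = ?\<tau> y * ?\<tau> y'" "?\<tau> (y + y') = ?\<tau> y + ?\<tau> y'"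
      unfolding x(3,4) H(3)[OF x(1,2), symmetric] H(4)[OF x(1,2), symmetric] using left x(1,2) by simp_all
  qed
  then show "Alg_automorphism ?\<tau>" using bij' by (simp add: Alg_automorphism_def)
  show "?\<tau> x = x" if "x \<in> K" for x
  proof -
    have "?\<tau> (\<sigma> x) = x" using left K(2) that by blast
    then show ?thesis by (simp add: fixes_K[OF that])
  qed
qed (rule K)+

end

lemma max_unramified_subfield: "subfield (max_unramified K) CC"
  unfolding max_unramified_def by (rule field.generate_field_is_subfield[OF field_CC]) simp

lemma max_unramified_subset:
  assumes "subfield M CC" "\<And>L. unramified_extension K L \<Longrightarrow> L \<subseteq> M"
  shows "max_unramified K \<subseteq> M"
  unfolding max_unramified_def
  by (rule field.generate_field_min_subfield1[OF field_CC _ assms(1)]) (use assms(2) in auto)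

lemma unramified_subset_max: "unramified_extension K L \<Longrightarrow> L \<subseteq> max_unramified K"
  unfolding max_unramified_def by (auto intro: generate_field.incl)

lemma (in conjugation) max_unramified_image:
  assumes alg: "\<And>L. unramified_extension K L \<Longrightarrow> L \<subseteq> Alg"
  shows "\<sigma> ` max_unramified K \<subseteq> max_unramified K"
proof -
  let ?M = "max_unramified K"
  note MD = subfield_CC_D[OF max_unramified_subfield[of K]]
  note AD = subfield_CC_D[OF subfield_Alg]
  have "subfield {x \<in> Alg. \<sigma> x \<in> ?M} CC"
  proof (rule subfield_CC_I)
    show "1 \<in> {x \<in> Alg. \<sigma> x \<in> ?M}" using H(1) MD(2) by simp
    show "- x \<in> {x \<in> Alg. \<sigma> x \<in> ?M}" if "x \<in> {x \<in> Alg. \<sigma> x \<in> ?M}" for x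
      using that H(5)[of x] MD(3) AD(3)[of x] by simp
    show "inverse x \<in> {x \<in> Alg. \<sigma> x \<in> ?M}" if "x \<in> {x \<in> Alg. \<sigma> x \<in> ?M}" for x
      using that H(11)[of x] MD(7) AD(7)[of x] by simp
    fix x y assume xy: "x \<in> {x \<in> Alg. \<sigma> x \<in> ?M}" "y \<in> {x \<in> Alg. \<sigma> x \<in> ?M}"
    show "x + y \<in> {x \<in> Alg. \<sigma> x \<in> ?M}" using xy H(3)[of x y] MD(4) AD(4)[of x y] by simp
    show "x * y \<in> {x \<in> Alg. \<sigma> x \<in> ?M}" using xy H(4)[of x y] MD(6) AD(6)[of x y] by simp
  qed
  moreover have "L \<subseteq> {x \<in> Alg. \<sigma> x \<in> ?M}" if "unramified_extension K L" for L
    using alg[OF that] unramified_subset_max[OF unramified_image[OF that alg[OF that]]] by blast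
  ultimately have "?M \<subseteq> {x \<in> Alg. \<sigma> x \<in> ?M}" by (rule max_unramified_subset)
  then show ?thesis by blast
qed

text \<open>
  \<open>K\<^sup>u\<^sup>n\<close> is normal over \<open>K\<close>: conjugation permutes the unramified extensions that generate it.
\<close>

lemma (in conjugation) restrict_in_Gal:
  assumes alg: "\<And>L. unramified_extension K L \<Longrightarrow> L \<subseteq> Alg"
    and KM: "K \<subseteq> max_unramified K"
  shows "restrict \<sigma> (max_unramified K) \<in> carrier (Gal (max_unramified K) K)"
proof -
  let ?M = "max_unramified K"
  note MD = subfield_CC_D[OF max_unramified_subfield[of K]]
  have MA: "?M \<subseteq> Alg" by (rule max_unramified_subset[OF subfield_Alg alg])
  interpret inv: conjugation K "inv_into Alg \<sigma>" by (rule inverse_conjugation)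
  have "?M \<subseteq> \<sigma> ` ?M"
  proof
    fix y assume y: "y \<in> ?M"
    then have "inv_into Alg \<sigma> y \<in> ?M" using inv.max_unramified_image[OF alg] by blast
    moreover have "\<sigma> (inv_into Alg \<sigma> y) = y"
    proof (rule f_inv_into_f)
      show "y \<in> \<sigma> ` Alg" using y MA bij by (auto simp: bij_betw_def)
    qed
    ultimately show "y \<in> \<sigma> ` ?M" by (metis image_eqI)
  qed
  then have img: "\<sigma> ` ?M = ?M" using max_unramified_image[OF alg] by blast
  have "bij_betw \<sigma> ?M ?M" using img inj_on_subset[OF inj MA] by (simp add: bij_betw_def)
  then have "restrict \<sigma> ?M \<in> Bij ?M" by (simp add: Bij_def)
  moreover have "restrict \<sigma> ?M \<in> Ring.ring_hom (field_ring ?M) (field_ring ?M)"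
  proof -
    have "\<sigma> x \<in> ?M" if "x \<in> ?M" for x using img that by blast
    moreover have "x \<in> Alg" if "x \<in> ?M" for x using MA that by blast
    ultimately show ?thesis using MD(2,4,6) H(1,3,4) by (auto simp: Ring.ring_hom_def)
  qed
  moreover have "\<forall>x\<in>K. restrict \<sigma> ?M x = x" using KM fixes_K by auto
  ultimately show ?thesis by (simp add: Gal_def)
qed

section \<open>Genus theory: many ramified primes force many unramified extensions\<close>

lemma algebraic_int_of_square:
  assumes "z * z = of_int m"
  shows "algebraic_int (z :: complex)"
proof (rule algebraic_int.intros[of "[:- of_int m, 0, 1:]"])
  show "poly [:- of_int m, 0, 1:] z = 0" using assms by simp
qed (auto simp: coeff_pCons split: nat.splits)

lemma squarefree_coprime_factors:
  fixes a b :: int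
  assumes "squarefree (a * b)"
  shows "coprime a b"
proof -
  have "gcd a b * gcd a b dvd a * b" by (intro mult_dvd_mono) auto
  then have "(gcd a b)\<^sup>2 dvd a * b" by (simp add: power2_eq_square)
  then have "gcd a b dvd 1" using assms by (rule squarefreeD[rotated])
  then show ?thesis by (simp add: coprime_iff_gcd_eq_1)
qed

lemma squarefree_prime_product:
  fixes p q :: int
  assumes "prime p" "prime q" "p \<noteq> q"
  shows "squarefree (p * q)"
  using assms by (intro squarefree_mult_coprime primes_coprime squarefree_prime) auto

context radicand
begin

text \<open>
  Otherwise \<open>p q\<close> or \<open>p q / d\<close> is the square of a rational number. Both \<open>p q\<close> and \<open>d\<close> are squarefree,
  so \<open>p q = 1\<close> or \<open>p q = d\<close>.
\<close>

lemma sqrt_prime_product_not_in: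
  assumes pq: "prime p" "prime q" "p \<noteq> q" and d: "d \<noteq> p * q"
  shows "rt (p * q) \<notin> E"
proof
  have sf: "squarefree (p * q)" by (rule squarefree_prime_product[OF pq])
  have "p > 1" "q > 1" using pq prime_gt_1_int by auto
  then have pq1: "p * q > 1" by (simp add: less_1_mult)
  assume "rt (p * q) \<in> E"
  then consider c :: complex where "c \<in> \<rat>" "of_int (p * q) = c * c"
    | c :: complex where "c \<in> \<rat>" "of_int (p * q) = of_int d * (c * c)"
    using rt_in_imp by blast
  then show False
  proof cases
    case 1
    have eq: "of_int 1 * c\<^sup>2 = of_int (p * q)" unfolding 1(2) by (simp add: power2_eq_square)
    have "c \<in> \<int>" by (rule rational_int_square[of 1]) (use 1(1) eq in \<open>simp_all only: Ints_of_int squarefree_1\<close>)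
    then obtain k where k: "c = of_int k" by (auto elim: Ints_cases)
    have "(of_int (p * q) :: complex) = of_int (k\<^sup>2)" unfolding 1(2) k by (simp add: power2_eq_square)
    then have pk: "p * q = k\<^sup>2" by (simp only: of_int_eq_iff)
    then have "k dvd 1" using sf by (intro squarefreeD[of "p * q"]) simp_all
    then have "k = 1 \<or> k = - 1" by auto
    then show False using pk pq1 by auto
  next
    case 2
    have eq: "of_int d * c\<^sup>2 = of_int (p * q)" unfolding 2(2) by (simp add: power2_eq_square)
    have "c \<in> \<int>" by (rule rational_int_square[OF squarefree 2(1)]) (simp only: eq Ints_of_int)
    then obtain k where k: "c = of_int k" by (auto elim: Ints_cases)
    have "(of_int (p * q) :: complex) = of_int (d * k\<^sup>2)" unfolding 2(2) k by (simp add: power2_eq_square)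
    then have pk: "p * q = d * k\<^sup>2" by (simp only: of_int_eq_iff)
    then have "k dvd 1" using sf by (intro squarefreeD[of "p * q"]) simp_all
    then have "k = 1 \<or> k = - 1" by auto
    then show False using pk d by auto
  qed
qed

lemma integers_base_finitely_generated: "\<exists>S. finite S \<and> carrier (integers E) \<subseteq> zmod.span S"
proof (rule integers_finitely_generated[of "{1}"])
  show "carrier (integers \<rat>) \<subseteq> zmod.span {1}"
  proof
    fix x assume "x \<in> carrier (integers \<rat>)"
    then obtain m where "x = of_int m" using rational_algebraic_int_eq_of_int by (auto simp: carrier_integers)
    then have "x = of_int m * 1" by simp
    then show "x \<in> zmod.span {1}" using zmod.span_scale[OF zmod.span_base, of 1 "{1}" m] by simp
  qed
qed (auto intro: algebraic_int_csqrt)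

text \<open>
  \<open>d = n m\<close> with \<open>n\<close> odd and coprime to \<open>m\<close>, so no prime of \<open>L = E(\<surd>n)\<close> contains both \<open>n\<close> and \<open>4 m\<close>. Off
  \<open>n\<close> the integer \<open>(1 + \<surd>n)/2\<close> differs from its conjugate by \<open>\<surd>n\<close>, which is not in the prime; over \<open>n\<close> the
  integer \<open>\<surd>d/\<surd>n\<close>, a square root of \<open>m\<close>, differs from its conjugate by twice itself. At the infinite
  places there is no ramification because \<open>n > 0\<close>.
\<close>

lemma unramified_sqrt:
  assumes n: "n > 0" "n mod 4 = 1" "n dvd d" "rt n \<notin> E"
  shows "\<exists>L. unramified_extension E L \<and> rt n \<in> L"
proof -
  have "quadratic_extension E (rt n)"
  proof (rule quadratic_extension.intro[OF E_subfield _ n(4)])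
    show "rt n * rt n \<in> E" unfolding rt_square by (rule ED(9))
  qed
  then interpret L: quadratic_extension E "rt n" .
  obtain m where m: "d = n * m" using n(3) by (rule dvdE)
  have cop: "coprime n m" using squarefree unfolding m by (rule squarefree_coprime_factors)
  have rtn0: "rt n \<noteq> 0" using n(1) by simp
  have alg_n: "algebraic_int (rt n)" by (rule algebraic_int_of_square[OF rt_square])
  obtain S0 where S0: "finite S0" "carrier (integers E) \<subseteq> zmod.span S0"
    using integers_base_finitely_generated by blast
  from L.integers_finitely_generated[OF S0 alg_n] obtain S where
    S: "finite S" "carrier (integers L.E) \<subseteq> zmod.span S" by blast
  have ram: "ramification_index E L.E P = 1" if P: "primeideal P (integers L.E)" "P \<noteq> {0}" for P
  proof -
    note ID = ideal_integers_D[OF prime_integers_D(1)[OF P(1)] L.E_subfield]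
    note O = integers_closed[OF L.E_subfield]
    have nO: "rt n \<in> carrier (integers L.E)" using L.t_in alg_n by (simp add: carrier_integers)
    show ?thesis
    proof (cases "of_int n \<in> P")
      case False
      define \<theta> where "\<theta> = (1 + rt n) / 2"
      have "\<theta> \<in> L.E" unfolding \<theta>_def using L.ED(2,4,8,10) L.t_in by blast
      then have \<theta>: "\<theta> \<in> carrier (integers L.E)"
        using half_one_plus_sqrt_algebraic_int[OF n(2)] by (simp add: carrier_integers \<theta>_def)
      have half: "1 / 2 \<in> E" using ED(2,8,10) by blast
      have "\<theta> = 1 / 2 + 1 / 2 * rt n" by (simp add: \<theta>_def add_divide_distrib)
      then have "L.conj \<theta> = 1 / 2 - 1 / 2 * rt n" using L.conj_eq[OF half half] by simp
      then have diff: "\<theta> - L.conj \<theta> = rt n" by (simp add: \<theta>_def add_divide_distrib)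
      have "\<theta> - L.conj \<theta> \<notin> P"
      proof
        assume "\<theta> - L.conj \<theta> \<in> P"
        then have "rt n \<in> P" unfolding diff .
        then have "rt n * rt n \<in> P" using nO by (rule ID(5))
        then show False using False unfolding rt_square by simp
      qed
      then show ?thesis by (rule L.unramified_at_prime[OF P S \<theta>])
    next
      case True
      define \<theta> where "\<theta> = rt d / rt n"
      have dE: "rt d \<in> L.E" using t_in L.F_subset by blast
      have \<theta>E: "\<theta> \<in> L.E" unfolding \<theta>_def by (rule L.ED(8)[OF dE L.t_in])
      have "\<theta> * \<theta> = (rt d * rt d) / (rt n * rt n)" by (simp add: \<theta>_def)
      also have "\<dots> = of_int m" unfolding rt_square m using n(1) by simp
      finally have sq: "\<theta> * \<theta> = of_int m" .
      have \<theta>: "\<theta> \<in> carrier (integers L.E)"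
        using \<theta>E algebraic_int_of_square[OF sq] by (simp add: carrier_integers)
      have "\<theta> = 0 + rt d / of_int n * rt n"
      proof -
        have "rt d / of_int n * rt n = rt d * rt n / (rt n * rt n)" unfolding rt_square by simp
        also have "\<dots> = \<theta>" using rtn0 by (simp add: \<theta>_def)
        finally show ?thesis by simp
      qed
      moreover have "rt d / of_int n \<in> E" by (rule ED(8)[OF t_in ED(9)])
      ultimately have "L.conj \<theta> = 0 - rt d / of_int n * rt n" "\<theta> = 0 + rt d / of_int n * rt n"
        using L.conj_eq[OF ED(1)] by (metis, metis)
      then have diff: "\<theta> - L.conj \<theta> = 2 * \<theta>" by simp
      have "\<theta> - L.conj \<theta> \<notin> P"
      proof
        assume "\<theta> - L.conj \<theta> \<in> P"
        then have "2 * \<theta> \<in> P" unfolding diff .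
        moreover have "2 * \<theta> \<in> carrier (integers L.E)" using O(7)[OF O(3)[of 2] \<theta>] by simp
        ultimately have "(2 * \<theta>) * (2 * \<theta>) \<in> P" by (rule ID(5))
        moreover have "(2 * \<theta>) * (2 * \<theta>) = 4 * (\<theta> * \<theta>)" by simp
        ultimately have m4: "of_int (4 * m) \<in> P" unfolding sq by simp
        have "coprime n 4"
        proof -
          have "odd n" using n(2) by presburger
          then have "coprime n (2 * 2)" by (simp only: coprime_mult_right_iff coprime_right_2_iff_odd simp_thms)
          then show ?thesis by simp
        qed
        then have "coprime n (4 * m)" using cop by simp
        then obtain u v where "u * n + v * (4 * m) = 1" by (metis bezout_int coprime_iff_gcd_eq_1)
        then have "of_int (u * n + v * (4 * m)) = (1 :: complex)" by simp
        then have one: "of_int u * of_int n + of_int v * of_int (4 * m) = (1 :: complex)"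
          by (simp only: of_int_add of_int_mult)
        have "of_int u * of_int n + of_int v * of_int (4 * m) \<in> P"
          by (rule ID(3)[OF ID(4)[OF True O(3)] ID(4)[OF m4 O(3)]])
        then show False unfolding one using prime_integers_D(2)[OF P(1)] by simp
      qed
      then show ?thesis by (rule L.unramified_at_prime[OF P S \<theta>])
    qed
  qed
  have real: "\<rho> ` L.E \<subseteq> \<real>" if \<rho>: "\<rho> \<in> embeddings L.E" "\<rho> ` E \<subseteq> \<real>" for \<rho>
  proof (rule image_subsetI)
    have hom: "\<rho> \<in> Ring.ring_hom (field_ring L.E) CC" using \<rho>(1) by (simp add: embeddings_def)
    note h = ring_hom_CC_D[OF hom L.E_subfield]
    have "\<rho> (rt n) * \<rho> (rt n) = \<rho> (rt n * rt n)" by (rule h(4)[OF L.t_in L.t_in, symmetric])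
    also have "\<dots> = rt n * rt n" unfolding rt_square by (rule h(7))
    finally have "\<rho> (rt n) = rt n \<or> \<rho> (rt n) = - rt n" by (simp only: square_eq_iff)
    moreover have "rt n \<in> \<real>"
    proof -
      have "rt n = of_real (sqrt (real_of_int n))"
        using csqrt_of_real_nonneg[of "of_int n"] n(1) by simp
      then show ?thesis by (simp only: Reals_of_real)
    qed
    ultimately have rn: "\<rho> (rt n) \<in> \<real>" by auto
    fix x assume "x \<in> L.E"
    then obtain a b where ab: "a \<in> E" "b \<in> E" "x = a + b * rt n" by (rule L.E_cases)
    have abL: "a \<in> L.E" "b \<in> L.E" using ab(1,2) L.F_subset by blast+
    have "\<rho> x = \<rho> a + \<rho> (b * rt n)" unfolding ab(3) by (rule h(3)[OF abL(1) L.ED(6)[OF abL(2) L.t_in]])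
    also have "\<rho> (b * rt n) = \<rho> b * \<rho> (rt n)" by (rule h(4)[OF abL(2) L.t_in])
    finally have "\<rho> x = \<rho> a + \<rho> b * \<rho> (rt n)" .
    moreover have "\<rho> a \<in> \<real>" "\<rho> b \<in> \<real>" using \<rho>(2) ab(1,2) by blast+
    ultimately show "\<rho> x \<in> \<real>" using rn by simp
  qed
  have "unramified_extension E L.E"
    using L.finite_extension ram real by (simp add: unramified_extension_def)
  then show ?thesis using L.t_in by blast
qed

text \<open>
  The injection \<open>p \<mapsto> {\<sigma> \<in> G. \<sigma> \<surd>(p\<^sub>0 p) = \<surd>(p\<^sub>0 p)}\<close> from \<open>T\<close> without \<open>p\<^sub>0\<close> to the subsets of the
  Galois group \<open>G\<close> gives the bound \<open>2 ^ |G| + 1\<close>. With three primes in \<open>T\<close>, \<open>d\<close> is not the product of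
  two of them, so their products have no square root in \<open>E\<close>, as the
  argument requires; adding 2 covers the sets \<open>T\<close> with at most two elements.
\<close>

lemma card_congruent_ramified_primes:
  assumes fin: "finite (carrier (Gal (max_unramified E) E))"
    and T: "finite T" "\<And>p. p \<in> T \<Longrightarrow> prime p \<and> p dvd d \<and> p mod 4 = r" and r: "r = 1 \<or> r = 3"
  shows "card T \<le> 2 ^ card (carrier (Gal (max_unramified E) E)) + 2"
proof (cases "card T \<le> 2")
  case False
  then obtain p0 where p0: "p0 \<in> T" by (metis card.empty equals0I zero_le)
  define G where "G = carrier (Gal (max_unramified E) E)"
  let ?M = "max_unramified E"
  note MD = subfield_CC_D[OF max_unramified_subfield[of E]]
  have three: "\<exists>s\<in>T. s \<noteq> p \<and> s \<noteq> q" for p q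
  proof (rule ccontr)
    assume "\<not> ?thesis"
    then have "T \<subseteq> {p, q}" by blast
    then have "card T \<le> card {p, q}" by (intro card_mono) auto
    also have "\<dots> \<le> 2" by (simp add: card_insert_if)
    finally show False using False by simp
  qed
  have not_in: "rt (p * q) \<notin> E" if "p \<in> T" "q \<in> T" "p \<noteq> q" for p q
  proof (rule sqrt_prime_product_not_in)
    show "prime p" "prime q" "p \<noteq> q" using T(2) that by auto
    obtain s where s: "s \<in> T" "s \<noteq> p" "s \<noteq> q" using three by blast
    show "d \<noteq> p * q"
    proof
      assume "d = p * q"
      then have "s dvd p * q" using T(2)[OF s(1)] by simp
      then have "s dvd p \<or> s dvd q" using T(2)[OF s(1)] prime_dvd_mult_iff by blast
      then show False using T(2) s that primes_dvd_imp_eq by blast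
    qed
  qed
  define u where "u = (\<lambda>p. rt (p0 * p))"
  have ext: "\<exists>L. unramified_extension E L \<and> u p \<in> L" if p: "p \<in> T - {p0}" for p
  proof -
    have pp: "prime p" "prime p0" "p \<noteq> p0" using p p0 T(2) by auto
    have "coprime p0 p" using pp by (intro primes_coprime) auto
    then have "p0 * p dvd d" using T(2) p p0 by (intro divides_mult) auto
    moreover have "p0 * p > 0" using pp prime_gt_0_int by simp
    moreover have "p0 * p mod 4 = 1"
    proof -
      have "p0 * p mod 4 = (p0 mod 4) * (p mod 4) mod 4" by (simp add: mod_mult_eq)
      also have "\<dots> = r * r mod 4" using T(2) p p0 by simp
      also have "\<dots> = 1" using r by auto
      finally show ?thesis .
    qed
    moreover have "rt (p0 * p) \<notin> E" using not_in p p0 by auto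
    ultimately show ?thesis unfolding u_def by (intro unramified_sqrt)
  qed
  have u_M: "u p \<in> ?M" if "p \<in> T - {p0}" for p
    using ext[OF that] unramified_subset_max by blast
  have EM: "E \<subseteq> ?M"
  proof -
    obtain s where "s \<in> T - {p0}" using three[of p0 p0] by blast
    then obtain L where L: "unramified_extension E L" using ext by blast
    then have "E \<subseteq> L" by (simp add: unramified_extension_def finite_extension_def)
    then show ?thesis using unramified_subset_max[OF L] by (rule subset_trans)
  qed
  have EAlg: "E \<subseteq> Alg"
  proof
    fix x assume "x \<in> E"
    then obtain a b where ab: "a \<in> \<rat>" "b \<in> \<rat>" "x = a + b * rt d" by (rule E_cases)
    have "algebraic (rt d)" by (intro algebraic_csqrt algebraic_of_int)
    then have "algebraic (a + b * rt d)"
      using rat_imp_algebraic[OF ab(1)] rat_imp_algebraic[OF ab(2)] by (intro algebraic_add_mult)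
    then show "x \<in> Alg" unfolding ab(3) by simp
  qed
  have alg: "L \<subseteq> Alg" if "unramified_extension E L" for L
    using that finite_extension_algebraic by (simp add: unramified_extension_def)
  define stab where "stab = (\<lambda>p. {\<sigma> \<in> G. \<sigma> (u p) = u p})"
  have "inj_on stab (T - {p0})"
  proof (rule inj_onI, rule ccontr)
    fix p q assume p: "p \<in> T - {p0}" and q: "q \<in> T - {p0}" and eq: "stab p = stab q" and "p \<noteq> q"
    have "rt (p * q) \<notin> E" using not_in p q \<open>p \<noteq> q\<close> by auto
    then have "quadratic_extension E (rt (p * q))"
      using ED(9)[of "p * q"] by (intro quadratic_extension.intro E_subfield) (simp_all only: rt_square not_False_eq_True)
    then interpret L: quadratic_extension E "rt (p * q)" .
    obtain \<sigma> where auto_\<sigma>: "Alg_automorphism \<sigma>" and \<sigma>_L: "\<And>x. x \<in> L.E \<Longrightarrow> \<sigma> x = L.conj x"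
      using L.conj_extends[OF EAlg] by blast
    have fix_E: "\<sigma> x = x" if "x \<in> E" for x
    proof -
      have "x \<in> L.E" using that L.F_subset by blast
      then show ?thesis using \<sigma>_L L.conj_F[OF that] by simp
    qed
    interpret conjugation E \<sigma> by (rule conjugation.intro[OF auto_\<sigma> E_subfield EAlg fix_E])
    define \<tau> where "\<tau> = restrict \<sigma> ?M"
    have \<tau>G: "\<tau> \<in> G" unfolding \<tau>_def G_def by (rule restrict_in_Gal[OF alg EM])
    have \<tau>_u: "\<tau> (u p) = \<sigma> (u p)" "\<tau> (u q) = \<sigma> (u q)" using u_M p q by (simp_all add: \<tau>_def)
    have MA: "?M \<subseteq> Alg" by (rule max_unramified_subset[OF subfield_Alg alg])
    have uA: "u p \<in> Alg" "u q \<in> Alg" using u_M p q MA by blast+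
    have sign: "\<sigma> (rt n) = rt n \<or> \<sigma> (rt n) = - rt n" if "rt n \<in> Alg" for n
    proof -
      have "\<sigma> (rt n) * \<sigma> (rt n) = \<sigma> (rt n * rt n)" by (rule H(4)[OF that that, symmetric])
      also have "\<dots> = rt n * rt n" unfolding rt_square by (rule H(7))
      finally show ?thesis by (simp only: square_eq_iff)
    qed
    have "\<tau> \<in> stab p \<longleftrightarrow> \<tau> \<in> stab q" by (simp only: eq)
    then have "\<sigma> (u p) = u p \<longleftrightarrow> \<sigma> (u q) = u q"
      unfolding stab_def mem_Collect_eq \<tau>_u by (simp only: \<tau>G simp_thms)
    moreover have "\<sigma> (u p) = u p \<or> \<sigma> (u p) = - u p" "\<sigma> (u q) = u q \<or> \<sigma> (u q) = - u q"
      using sign uA unfolding u_def by blast+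
    ultimately have "\<sigma> (u p) * \<sigma> (u q) = u p * u q" by auto
    then have fixed: "\<sigma> (u p * u q) = u p * u q" unfolding H(4)[OF uA] .
    \<comment> \<open>But \<open>u p * u q\<close> is \<open>p0\<close> times a square root of \<open>p * q\<close>, which \<open>\<sigma>\<close> negates.\<close>
    have "(u p * u q) * (u p * u q) = (u p * u p) * (u q * u q)" by simp
    also have "\<dots> = of_int p0 * of_int p0 * of_int (p * q)" unfolding u_def rt_square by simp
    also have "\<dots> = of_int p0 * of_int p0 * (rt (p * q) * rt (p * q))" by (simp only: rt_square)
    also have "\<dots> = (of_int p0 * rt (p * q)) * (of_int p0 * rt (p * q))" by (simp only: mult_ac)
    finally have pm: "u p * u q = of_int p0 * rt (p * q) \<or> u p * u q = - (of_int p0 * rt (p * q))"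
      by (simp only: square_eq_iff)
    have cj: "L.conj (of_int p0 * rt (p * q)) = - (of_int p0 * rt (p * q))"
      using L.conj_eq[OF ED(1) ED(9)[of p0]] by simp
    have in_L: "of_int p0 * rt (p * q) \<in> L.E" by (rule L.ED(6)[OF L.ED(9) L.t_in])
    then have "of_int p0 * rt (p * q) \<in> Alg \<and> \<sigma> (of_int p0 * rt (p * q)) = - (of_int p0 * rt (p * q))"
    proof -
      have "algebraic (of_int p0 * rt (p * q))"
        by (intro algebraic_add_mult(2) algebraic_csqrt algebraic_of_int)
      then show ?thesis using \<sigma>_L[OF in_L] cj by simp
    qed
    then have "\<sigma> (u p * u q) = - (u p * u q)"
      using pm H(5)[of "of_int p0 * rt (p * q)"] by auto
    then have "u p * u q = 0" unfolding fixed by simp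
    moreover have "u x \<noteq> 0" if "x \<in> T" for x
      using T(2)[OF that] T(2)[OF p0] by (auto simp: u_def)
    ultimately show False using p q by auto
  qed
  moreover have "stab ` (T - {p0}) \<subseteq> Pow G" by (auto simp: stab_def)
  moreover have "finite (Pow G)" using fin by (simp add: G_def)
  ultimately have "card (T - {p0}) \<le> card (Pow G)" by (rule card_inj_on_le)
  then have "card (T - {p0}) \<le> 2 ^ card G" using fin by (simp add: card_Pow G_def)
  then show ?thesis using p0 T(1) by (simp add: G_def)
qed simp

text \<open>
  The products \<open>p\<^sub>0 p\<close> have to be \<open>1 mod 4\<close>, so the residue classes 1 and 3 are treated separately.
\<close>

lemma card_odd_ramified_primes:
  assumes fin: "finite (carrier (Gal (max_unramified E) E))"
  shows "card {p :: nat. prime p \<and> odd p \<and> p dvd nat \<bar>d\<bar>} \<le>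
    2 * (2 ^ card (carrier (Gal (max_unramified E) E)) + 2)"
proof -
  define T where "T = (\<lambda>r. {p :: int. prime p \<and> p dvd d \<and> p mod 4 = r})"
  have finT: "finite (T r)" for r
  proof (rule finite_subset)
    show "T r \<subseteq> {p. p dvd d}" by (auto simp: T_def)
    show "finite {p. p dvd d}" using d_nonzero by (rule finite_divisors_int)
  qed
  have bound: "card (T r) \<le> 2 ^ card (carrier (Gal (max_unramified E) E)) + 2" if "r = 1 \<or> r = 3" for r
    by (rule card_congruent_ramified_primes[OF fin finT _ that]) (auto simp: T_def)
  have "int ` {p :: nat. prime p \<and> odd p \<and> p dvd nat \<bar>d\<bar>} \<subseteq> T 1 \<union> T 3"
  proof
    fix x assume "x \<in> int ` {p :: nat. prime p \<and> odd p \<and> p dvd nat \<bar>d\<bar>}"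
    then obtain p :: nat where p: "x = int p" "prime p" "odd p" "p dvd nat \<bar>d\<bar>" by blast
    have "int p dvd d" using p(4) by (simp add: dvd_nat_abs_iff)
    moreover have "prime (int p)" using p(2) by simp
    moreover have "int p mod 4 = 1 \<or> int p mod 4 = 3" using p(3) by presburger
    ultimately show "x \<in> T 1 \<union> T 3" unfolding p(1) T_def by blast
  qed
  then have "card (int ` {p :: nat. prime p \<and> odd p \<and> p dvd nat \<bar>d\<bar>}) \<le> card (T 1 \<union> T 3)"
    by (intro card_mono) (simp_all add: finT)
  also have "\<dots> \<le> card (T 1) + card (T 3)" by (rule card_Un_le)
  also have "\<dots> \<le> 2 * (2 ^ card (carrier (Gal (max_unramified E) E)) + 2)"
    using bound[of 1] bound[of 3] by simp
  finally show ?thesis by (simp add: card_image)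
qed

end

section \<open>Integers with few prime factors\<close>

lemma card_coprime_multiple:
  fixes M t :: nat
  shows "card {u \<in> {1..t * M}. coprime u M} = t * totient M"
proof (induction t)
  case 0
  then show ?case by simp
next
  case (Suc t)
  have split: "{u \<in> {1..Suc t * M}. coprime u M} =
      {u \<in> {1..t * M}. coprime u M} \<union> (\<lambda>u. t * M + u) ` totatives M"
  proof (intro equalityI subsetI)
    fix u assume u: "u \<in> {u \<in> {1..Suc t * M}. coprime u M}"
    show "u \<in> {u \<in> {1..t * M}. coprime u M} \<union> (\<lambda>u. t * M + u) ` totatives M"
    proof (cases "u \<le> t * M")
      case False
      then have "u = t * M + (u - t * M)" by simp
      moreover from this u have "coprime (t * M + (u - t * M)) M" by simp
      then have "coprime (u - t * M) M"
        by (metis add.commute coprime_iff_gcd_eq_1 gcd_add_mult mult.commute gcd.commute)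
      ultimately have "u - t * M \<in> totatives M" "u = t * M + (u - t * M)"
        using u False by (auto simp: in_totatives_iff)
      then show ?thesis by blast
    qed (use u in auto)
  next
    fix u assume "u \<in> {u \<in> {1..t * M}. coprime u M} \<union> (\<lambda>u. t * M + u) ` totatives M"
    then show "u \<in> {u \<in> {1..Suc t * M}. coprime u M}"
    proof
      assume "u \<in> (\<lambda>u. t * M + u) ` totatives M"
      then obtain v where v: "v \<in> totatives M" "u = t * M + v" by auto
      then have "coprime v M" by (simp add: in_totatives_iff)
      then have "coprime (t * M + v) M"
        by (metis add.commute coprime_iff_gcd_eq_1 gcd_add_mult mult.commute gcd.commute)
      then show ?thesis using v by (auto simp: in_totatives_iff)
    qed auto
  qed
  have "card {u \<in> {1..Suc t * M}. coprime u M} =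
      card {u \<in> {1..t * M}. coprime u M} + card ((\<lambda>u. t * M + u) ` totatives M)"
    unfolding split by (rule card_Un_disjoint) (auto simp: in_totatives_iff)
  also have "card ((\<lambda>u. t * M + u) ` totatives M) = totient M"
    by (simp add: card_image totient_def)
  finally show ?case using Suc by simp
qed

lemma card_coprime_le:
  fixes M N :: nat
  assumes "M > 0"
  shows "card {u \<in> {1..N}. coprime u M} \<le> (N div M + 1) * totient M"
proof -
  have "N \<le> (N div M + 1) * M"
    using assms by (metis add.commute dividend_less_div_times less_imp_le mult.commute distrib_right mult_1)
  then have "card {u \<in> {1..N}. coprime u M} \<le> card {u \<in> {1..(N div M + 1) * M}. coprime u M}"
    by (intro card_mono) auto
  then show ?thesis by (simp only: card_coprime_multiple)
qed

text \<open>
  The products \<open>d u\<close> with \<open>d\<close> dividing \<open>M\<close>, \<open>u\<close> coprime to \<open>M\<close> and \<open>u \<le> M\<^sup>2/d\<close> are distinct numbers up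
  to \<open>M\<^sup>2\<close>, and for each \<open>d\<close> there are \<open>(M/d) totient M\<close> of them. Dividing by \<open>M\<^sup>2\<close>, this bounds
  \<open>totient M / M\<close> by the inverse of the sum of \<open>1/d\<close> over the divisors \<open>d\<close> of \<open>M\<close>.
\<close>

lemma totient_mult_divisor_sum_le:
  fixes M :: nat
  assumes "M > 0"
  shows "totient M * (\<Sum>d | d dvd M. M div d) \<le> M * M"
proof -
  define S where "S = Sigma {d. d dvd M} (\<lambda>d. {u \<in> {1..(M div d) * M}. coprime u M})"
  have fin: "finite {d. d dvd M}" using assms by simp
  have "card S = (\<Sum>d | d dvd M. (M div d) * totient M)"
    unfolding S_def using fin by (subst card_SigmaI) (auto simp del: mult_Suc simp: card_coprime_multiple[simplified])
  also have "\<dots> = totient M * (\<Sum>d | d dvd M. M div d)"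
    by (simp add: sum_distrib_left mult.commute)
  finally have cardS: "card S = totient M * (\<Sum>d | d dvd M. M div d)" .
  have "inj_on (\<lambda>(d, u). d * u) S"
  proof (rule inj_onI, clarify)
    fix d u e v
    assume a: "(d, u) \<in> S" "(e, v) \<in> S" and eq: "d * u = e * v"
    have "d dvd M" "e dvd M" "coprime M u" "coprime M v"
      using a by (auto simp: S_def coprime_commute)
    then have "coprime d v" "coprime e u"
      using coprime_divisors[OF \<open>d dvd M\<close> dvd_refl] coprime_divisors[OF \<open>e dvd M\<close> dvd_refl] by blast+
    have "d dvd e * v" "e dvd d * u"
      using eq by (metis dvd_triv_left)+
    then have "d dvd e" "e dvd d"
      using \<open>coprime d v\<close> \<open>coprime e u\<close> by (auto simp: coprime_dvd_mult_left_iff)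
    then have "d = e" by (rule dvd_antisym)
    moreover have "d > 0" using a assms by (auto simp: S_def intro: dvd_pos_nat)
    ultimately show "d = e \<and> u = v" using eq by simp
  qed
  moreover have "(\<lambda>(d, u). d * u) ` S \<subseteq> {1..M * M}"
  proof clarify
    fix d u assume a: "(d, u) \<in> S"
    then have "d > 0" "u \<ge> 1" "d dvd M" "u \<le> (M div d) * M"
      using assms by (auto simp: S_def intro: dvd_pos_nat)
    then have "d * u \<le> d * ((M div d) * M)" by simp
    also have "\<dots> = M * M" using \<open>d dvd M\<close> by (metis dvd_mult_div_cancel mult.assoc)
    finally show "d * u \<in> {1..M * M}" using \<open>d > 0\<close> \<open>u \<ge> 1\<close> by (simp add: Suc_leI)
  qed
  ultimately have "card S \<le> card {1..M * M}" by (rule card_inj_on_le) simp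
  then show ?thesis using cardS by simp
qed

text \<open>
  The divisors of \<open>N!\<close> include \<open>1, \<dots>, N\<close>. As the harmonic series diverges, \<open>totient M / M\<close> gets
  arbitrarily small, without any use of the distribution of primes.
\<close>

lemma totient_fact_mult_harmonic_le:
  "real (totient (fact N)) * (\<Sum>d\<in>{1..N}. 1 / real d) \<le> real (fact N)"
proof -
  define M :: nat where "M = fact N"
  have M: "M > 0" by (simp add: M_def)
  have "real M * (\<Sum>d\<in>{1..N}. 1 / real d) = (\<Sum>d\<in>{1..N}. real (M div d))"
    unfolding sum_distrib_left
  proof (rule sum.cong[OF refl])
    fix d assume "d \<in> {1..N}"
    then have "d dvd M" unfolding M_def by (intro dvd_fact) auto
    then show "real M * (1 / real d) = real (M div d)"
      by (simp add: real_of_nat_div)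
  qed
  also have "\<dots> \<le> (\<Sum>d | d dvd M. real (M div d))"
    using M by (intro sum_mono2) (auto simp: M_def intro: dvd_fact)
  finally have "real (totient M) * (real M * (\<Sum>d\<in>{1..N}. 1 / real d)) \<le>
      real (totient M) * (\<Sum>d | d dvd M. real (M div d))"
    by (intro mult_left_mono) auto
  also have "\<dots> = real (totient M * (\<Sum>d | d dvd M. M div d))" by simp
  also have "\<dots> \<le> real (M * M)"
    using totient_mult_divisor_sum_le[OF M] by (simp only: of_nat_le_iff)
  finally have "real M * (real (totient M) * (\<Sum>d\<in>{1..N}. 1 / real d)) \<le> real M * real M"
    by (simp add: mult_ac)
  then show ?thesis using M unfolding M_def by (simp del: of_nat_fact)
qed

lemma ln_le_harmonic_sum: "ln (real (Suc N)) \<le> (\<Sum>d\<in>{1..N}. 1 / real d)"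
proof (induction N)
  case 0
  then show ?case by simp
next
  case (Suc N)
  have "real (Suc (Suc N)) = real (Suc N) * (1 + 1 / real (Suc N))" by (simp add: field_simps)
  then have "ln (real (Suc (Suc N))) = ln (real (Suc N) * (1 + 1 / real (Suc N)))" by (rule arg_cong)
  also have "\<dots> = ln (real (Suc N)) + ln (1 + 1 / real (Suc N))"
    by (rule ln_mult_pos) (simp_all add: add_pos_nonneg)
  also have "ln (1 + 1 / real (Suc N)) \<le> 1 / real (Suc N)"
    by (rule ln_add_one_self_le_self) simp
  finally show ?case using Suc.IH by simp
qed

text \<open>
  Removing from \<open>N!\<close> the primes that divide \<open>Q\<close> changes the Euler product \<open>\<Prod> (1 - 1/p)\<close> at most by
  the factor that belongs to \<open>Q\<close>, which is independent of \<open>N\<close>.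
\<close>

lemma exists_coprime_small_totient:
  fixes Q :: nat and \<epsilon> :: real
  assumes Q: "Q > 0" and \<epsilon>: "\<epsilon> > 0"
  shows "\<exists>M > 0. coprime M Q \<and> real (totient M) \<le> \<epsilon> * real M"
proof -
  define f :: "nat set \<Rightarrow> real" where "f = (\<lambda>S. \<Prod>p\<in>S. (1 - 1 / real p))"
  have fpos: "f S > 0" if "\<And>p. p \<in> S \<Longrightarrow> prime p" for S
    unfolding f_def
  proof (rule prod_pos)
    fix p assume "p \<in> S"
    then have "p > 1" using that prime_gt_1_nat by blast
    then show "0 < 1 - 1 / real p" by simp
  qed
  have fle1: "f S \<le> 1" if "\<And>p. p \<in> S \<Longrightarrow> prime p" for S
    unfolding f_def
  proof (rule prod_le_1)
    fix p assume "p \<in> S"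
    then have "p > 1" using that prime_gt_1_nat by blast
    then show "0 \<le> 1 - 1 / real p \<and> 1 - 1 / real p \<le> 1" by simp
  qed
  have tot: "real (totient n) = real n * f (prime_factors n)" for n
    using totient_formula2[of n] by (simp add: f_def)
  define c where "c = f (prime_factors Q)"
  have c: "c > 0" unfolding c_def by (rule fpos) auto
  \<comment> \<open>The harmonic sum up to \<open>N\<close> is at least \<open>ln (N + 1)\<close>, which makes \<open>N \<ge> exp y\<close> large enough.\<close>
  define y where "y = 1 / (\<epsilon> * c)"
  define N where "N = nat \<lceil>exp y\<rceil>"
  define h where "h = (\<Sum>d\<in>{1..N}. 1 / real d)"
  have "exp y \<le> real (Suc N)" unfolding N_def by linarith
  then have "y \<le> ln (real (Suc N))" by (simp add: ln_ge_iff)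
  then have N: "1 / (\<epsilon> * c) \<le> h"
    using ln_le_harmonic_sum[of N] unfolding y_def h_def by linarith
  define S where "S = prime_factors (fact N :: nat) - prime_factors Q"
  have finS: "finite S" and primeS: "\<And>p. p \<in> S \<Longrightarrow> prime p" by (auto simp: S_def)
  define M where "M = \<Prod>S"
  have Mpos: "M > 0" unfolding M_def using primeS by (intro prod_pos) (auto intro: prime_gt_0_nat)
  have dvdM: "p \<in> S" if "prime p" "p dvd M" for p
  proof -
    from that obtain q where "q \<in> S" "p dvd q"
      unfolding M_def using prime_dvd_prod_iff[OF finS \<open>prime p\<close>, of "\<lambda>x. x"] by auto
    then show ?thesis using primeS that primes_dvd_imp_eq by blast
  qed
  have pf: "prime_factors M = S"
  proof
    show "prime_factors M \<subseteq> S" using dvdM by (auto simp: prime_factors_dvd)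
    show "S \<subseteq> prime_factors M"
      using primeS Mpos dvd_prodI[OF finS, of _ "\<lambda>x. x"] by (auto simp: prime_factors_dvd M_def)
  qed
  have "coprime M Q"
  proof (rule ccontr)
    assume "\<not> coprime M Q"
    then obtain p where "prime p" "p dvd M" "p dvd Q"
      by (metis coprime_iff_gcd_eq_1 gcd_dvd1 gcd_dvd2 prime_factor_nat dvd_trans)
    then show False using dvdM[of p] Q by (auto simp: S_def prime_factors_dvd)
  qed
  moreover have "real (totient M) \<le> \<epsilon> * real M"
  proof -
    let ?F = "prime_factors (fact N :: nat)"
    have "real (fact N) * (f ?F * h) \<le> real (fact N) * 1"
      using totient_fact_mult_harmonic_le[of N] tot[of "fact N"] unfolding h_def by simp
    then have h: "f ?F * h \<le> 1" by (rule mult_left_le_imp_le) simp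
    have "f ?F \<ge> 0" using fpos[of ?F] by force
    then have "f ?F * (1 / (\<epsilon> * c)) \<le> 1"
      using mult_left_mono[OF N] h order_trans by blast
    then have fF: "f ?F \<le> \<epsilon> * c" using \<epsilon> c by (simp add: field_simps)
    have "f (?F \<inter> prime_factors Q) \<ge> c"
    proof -
      have "c = f (prime_factors Q - ?F) * f (?F \<inter> prime_factors Q)"
        unfolding c_def f_def by (subst prod.union_disjoint[symmetric]) (auto intro: prod.cong)
      also have "\<dots> \<le> 1 * f (?F \<inter> prime_factors Q)"
        by (intro mult_right_mono fle1 less_imp_le[OF fpos]) auto
      finally show ?thesis by simp
    qed
    moreover have "f ?F = f S * f (?F \<inter> prime_factors Q)"
      unfolding S_def f_def by (subst prod.union_disjoint[symmetric]) (auto intro: prod.cong)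
    ultimately have "f S * c \<le> \<epsilon> * c"
      using fF fpos[OF primeS] by (smt (verit) mult_left_mono)
    then have "f S \<le> \<epsilon>" using c by simp
    then show ?thesis using tot[of M] pf Mpos by (simp add: mult.commute mult_right_mono)
  qed
  ultimately show ?thesis using Mpos by blast
qed

lemma exists_pairwise_coprime_small_totient:
  fixes \<epsilon> :: real and k :: nat
  assumes \<epsilon>: "\<epsilon> > 0"
  shows "\<exists>M :: nat \<Rightarrow> nat. (\<forall>i<k. M i > 0 \<and> odd (M i) \<and> real (totient (M i)) \<le> \<epsilon> * real (M i)) \<and>
      (\<forall>i<k. \<forall>j<k. i \<noteq> j \<longrightarrow> coprime (M i) (M j))"
proof (induction k)
  case 0
  then show ?case by simp
next
  case (Suc k)
  then obtain M :: "nat \<Rightarrow> nat" where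
    M: "\<And>i. i < k \<Longrightarrow> M i > 0 \<and> odd (M i) \<and> real (totient (M i)) \<le> \<epsilon> * real (M i)"
    and cop: "\<And>i j. i < k \<Longrightarrow> j < k \<Longrightarrow> i \<noteq> j \<Longrightarrow> coprime (M i) (M j)" by blast
  have "2 * (\<Prod>i<k. M i) > 0" using M by (simp add: prod_pos)
  from exists_coprime_small_totient[OF this \<epsilon>] obtain L where
    L: "L > 0" "coprime L (2 * (\<Prod>i<k. M i))" "real (totient L) \<le> \<epsilon> * real L" by blast
  have "odd L" using L(2) by (auto simp: coprime_right_2_iff_odd)
  moreover have copL: "coprime L (M i)" if "i < k" for i
  proof -
    have "M i dvd (\<Prod>i<k. M i)" using that by (intro dvd_prodI) auto
    then show ?thesis
      using L(2) coprime_divisors[of L L "M i" "2 * (\<Prod>i<k. M i)"] by simp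
  qed
  ultimately show ?case
    using L M cop
    by (intro exI[of _ "\<lambda>i. if i = k then L else M i"])
      (auto simp: less_Suc_eq coprime_commute)
qed

text \<open>
  Choose odd, pairwise coprime \<open>M\<^sub>0, \<dots>, M\<^sub>k\<close> with \<open>totient M\<^sub>i \<le> \<epsilon> M\<^sub>i\<close>. An integer that shares a
  prime with each of them has at least \<open>k + 1\<close> odd prime factors, so an integer with at most \<open>k\<close> is
  coprime to some \<open>M\<^sub>i\<close>, and the integers coprime to \<open>M\<^sub>i\<close> have density at most \<open>\<epsilon>\<close>.
\<close>

theorem few_odd_prime_factors_density_zero:
  "(\<lambda>N. real (card {n \<in> {1..N}. card {p. prime p \<and> odd p \<and> p dvd n} \<le> k}) / real N) \<longlonglongrightarrow> 0"
proof (rule LIMSEQ_I)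
  fix r :: real assume r: "r > 0"
  define \<epsilon> where "\<epsilon> = r / (2 * (real k + 1))"
  have \<epsilon>: "\<epsilon> > 0" using r by (simp add: \<epsilon>_def)
  from exists_pairwise_coprime_small_totient[OF \<epsilon>, of "Suc k"]
  obtain M :: "nat \<Rightarrow> nat" where
    M: "\<And>i. i < Suc k \<Longrightarrow> M i > 0 \<and> odd (M i) \<and> real (totient (M i)) \<le> \<epsilon> * real (M i)"
    and cop: "\<And>i j. i < Suc k \<Longrightarrow> j < Suc k \<Longrightarrow> i \<noteq> j \<Longrightarrow> coprime (M i) (M j)" by blast
  define C where "C = (\<Sum>i<Suc k. real (totient (M i)))"
  let ?A = "\<lambda>N. {n \<in> {1..N}. card {p. prime p \<and> odd p \<and> p dvd n} \<le> k}"
  have sub: "?A N \<subseteq> (\<Union>i<Suc k. {n \<in> {1..N}. coprime n (M i)})" for N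
  proof (rule subsetI, rule ccontr)
    fix n assume n: "n \<in> ?A N" and "n \<notin> (\<Union>i<Suc k. {n \<in> {1..N}. coprime n (M i)})"
    then have nc: "\<forall>i<Suc k. \<not> coprime n (M i)" by auto
    have "\<forall>i<Suc k. \<exists>p. prime p \<and> p dvd n \<and> p dvd M i"
      using nc by (metis coprime_iff_gcd_eq_1 gcd_dvd1 gcd_dvd2 prime_factor_nat dvd_trans)
    then obtain p where p: "\<And>i. i < Suc k \<Longrightarrow> prime (p i) \<and> p i dvd n \<and> p i dvd M i" by metis
    have "inj_on p {..<Suc k}"
    proof (rule inj_onI, rule ccontr)
      fix i j assume "i \<in> {..<Suc k}" "j \<in> {..<Suc k}" "p i = p j" "i \<noteq> j"
      then have "is_unit (p i)"
        using cop p by (metis coprime_common_divisor lessThan_iff)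
      then show False using p \<open>i \<in> {..<Suc k}\<close> by (meson lessThan_iff not_prime_unit)
    qed
    moreover have "p ` {..<Suc k} \<subseteq> {p. prime p \<and> odd p \<and> p dvd n}"
      using p M dvd_trans by blast
    moreover have "finite {p. prime p \<and> odd p \<and> p dvd n}"
      using n by (intro finite_subset[OF _ finite_divisors_nat[of n]]) auto
    ultimately have "card {..<Suc k} \<le> card {p. prime p \<and> odd p \<and> p dvd n}"
      by (metis card_inj_on_le)
    then show False using n by simp
  qed
  have bound: "real (card (?A N)) \<le> r / 2 * real N + C" for N
  proof -
    have "card (?A N) \<le> card (\<Union>i<Suc k. {n \<in> {1..N}. coprime n (M i)})"
      using sub by (intro card_mono) auto
    also have "\<dots> \<le> (\<Sum>i<Suc k. card {n \<in> {1..N}. coprime n (M i)})"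
      by (intro card_UN_le) auto
    finally have "real (card (?A N)) \<le> real (\<Sum>i<Suc k. card {n \<in> {1..N}. coprime n (M i)})"
      by (rule of_nat_mono)
    also have "\<dots> = (\<Sum>i<Suc k. real (card {n \<in> {1..N}. coprime n (M i)}))"
      by (rule of_nat_sum)
    also have "\<dots> \<le> (\<Sum>i<Suc k. \<epsilon> * real N + real (totient (M i)))"
    proof (rule sum_mono)
      fix i assume "i \<in> {..<Suc k}"
      then have Mi: "M i > 0" "real (totient (M i)) \<le> \<epsilon> * real (M i)" using M by auto
      have "real (card {n \<in> {1..N}. coprime n (M i)}) \<le> real ((N div M i + 1) * totient (M i))"
        using card_coprime_le[OF Mi(1), of N] by (simp only: of_nat_le_iff)
      also have "\<dots> = real (N div M i) * real (totient (M i)) + real (totient (M i))"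
        by (simp add: algebra_simps)
      also have "real (N div M i) * real (totient (M i)) \<le> (real N / real (M i)) * (\<epsilon> * real (M i))"
        using Mi \<epsilon> by (intro mult_mono of_nat_div_le_of_nat) auto
      also have "\<dots> = \<epsilon> * real N" using Mi by simp
      finally show "real (card {n \<in> {1..N}. coprime n (M i)}) \<le> \<epsilon> * real N + real (totient (M i))" by simp
    qed
    also have "\<dots> = real (Suc k) * (\<epsilon> * real N) + C"
      unfolding C_def by (simp add: sum.distrib del: sum.lessThan_Suc)
    also have "real (Suc k) * (\<epsilon> * real N) = r / 2 * real N"
      unfolding \<epsilon>_def by (simp add: field_simps)
    finally show ?thesis .
  qed
  have C: "C \<ge> 0" unfolding C_def by (intro sum_nonneg) auto
  obtain N0 :: nat where N0: "real N0 > 2 * C / r" using reals_Archimedean2 by blast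
  show "\<exists>no. \<forall>N\<ge>no. norm (real (card (?A N)) / real N - 0) < r"
  proof (intro exI[of _ "Suc N0"] allI impI)
    fix N assume N: "Suc N0 \<le> N"
    then have "real N > 2 * C / r" using N0 by linarith
    then have "C < r / 2 * real N" using r by (simp add: field_simps)
    then have "real (card (?A N)) < r * real N" using bound[of N] by simp
    then show "norm (real (card (?A N)) / real N - 0) < r" using N by (simp add: field_simps)
  qed
qed

text \<open>
  At most \<open>N/q\<^sup>2\<close> integers up to \<open>N\<close> are divisible by \<open>q\<^sup>2\<close>, and the sum of \<open>1/q\<^sup>2\<close> over \<open>q \<ge> 2\<close> is at
  most \<open>3/4\<close>.
\<close>

lemma card_squarefree_ge:
  "real N / 4 \<le> real (card {n \<in> {1..N}. squarefree n})"
proof -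
  \<comment> \<open>Telescoping with \<open>1/q\<^sup>2 \<le> 1/(q - 1) - 1/q\<close> for \<open>q \<ge> 3\<close>; the term \<open>1/4\<close> for \<open>q = 2\<close> is kept exact.\<close>
  have tele: "N \<ge> 2 \<Longrightarrow> (\<Sum>q\<in>{2..N}. 1 / real (q\<^sup>2)) \<le> 3/4 - 1 / real N" for N
  proof (induction N rule: nat_induct_at_least)
    case base
    then show ?case by (simp add: numeral_2_eq_2 [symmetric])
  next
    case (Suc N)
    have "1 / real ((Suc N)\<^sup>2) \<le> 1 / (real N * real (Suc N))"
    proof -
      have "real N * real (Suc N) \<le> real (Suc N) * real (Suc N)" by (intro mult_right_mono) auto
      then have "real N * real (Suc N) \<le> real ((Suc N)\<^sup>2)" by (simp only: power2_eq_square of_nat_mult)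
      then show ?thesis using Suc.hyps by (intro frac_le) auto
    qed
    also have "\<dots> = 1 / real N - 1 / real (Suc N)"
      using Suc.hyps by (simp add: field_simps)
    finally have "1 / real ((Suc N)\<^sup>2) \<le> 1 / real N - 1 / real (Suc N)" .
    then show ?case using Suc by (simp add: sum.cl_ivl_Suc del: of_nat_Suc of_nat_power)
  qed
  have sum34: "(\<Sum>q\<in>{2..N}. 1 / real (q\<^sup>2)) \<le> 3/4"
  proof (cases "N \<ge> 2")
    case True
    have "1 / real N \<ge> 0" by simp
    then show ?thesis using tele[OF True] by linarith
  qed simp
  have "{n \<in> {1..N}. \<not> squarefree n} \<subseteq> (\<Union>q\<in>{2..N}. {n \<in> {1..N}. q\<^sup>2 dvd n})"
  proof
    fix n assume n: "n \<in> {n \<in> {1..N}. \<not> squarefree n}"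
    then obtain q where q: "q\<^sup>2 dvd n" "\<not> q dvd 1" by (auto simp: squarefree_def)
    have "q \<noteq> 0" using q n by (auto simp: power2_eq_square)
    moreover have "q \<noteq> 1" using q by auto
    moreover have "q \<le> q\<^sup>2" by (simp add: power2_nat_le_imp_le power2_eq_square)
    moreover have "q\<^sup>2 \<le> n" using q n by (intro dvd_imp_le) auto
    ultimately show "n \<in> (\<Union>q\<in>{2..N}. {n \<in> {1..N}. q\<^sup>2 dvd n})" using q n by auto
  qed
  then have "card {n \<in> {1..N}. \<not> squarefree n} \<le> card (\<Union>q\<in>{2..N}. {n \<in> {1..N}. q\<^sup>2 dvd n})"
    by (intro card_mono) auto
  also have "\<dots> \<le> (\<Sum>q\<in>{2..N}. card {n \<in> {1..N}. q\<^sup>2 dvd n})"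
    by (intro card_UN_le) auto
  finally have "real (card {n \<in> {1..N}. \<not> squarefree n}) \<le> real (\<Sum>q\<in>{2..N}. card {n \<in> {1..N}. q\<^sup>2 dvd n})"
    by (rule of_nat_mono)
  also have "\<dots> = (\<Sum>q\<in>{2..N}. real (card {n \<in> {1..N}. q\<^sup>2 dvd n}))"
    by (rule of_nat_sum)
  also have "\<dots> \<le> (\<Sum>q\<in>{2..N}. real N * (1 / real (q\<^sup>2)))"
  proof (rule sum_mono)
    fix q :: nat assume q: "q \<in> {2..N}"
    have "{n \<in> {1..N}. q\<^sup>2 dvd n} \<subseteq> (\<lambda>i. q\<^sup>2 * i) ` {1..N div q\<^sup>2}"
    proof
      fix n assume n: "n \<in> {n \<in> {1..N}. q\<^sup>2 dvd n}"
      then obtain i where i: "n = q\<^sup>2 * i" by (auto elim: dvdE)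
      then have "i \<le> N div q\<^sup>2" using n q by (simp add: less_eq_div_iff_mult_less_eq mult.commute)
      moreover have "i \<ge> 1" using i n by (cases i) auto
      ultimately show "n \<in> (\<lambda>i. q\<^sup>2 * i) ` {1..N div q\<^sup>2}" using i by auto
    qed
    then have "card {n \<in> {1..N}. q\<^sup>2 dvd n} \<le> N div q\<^sup>2"
      using surj_card_le[of "{1..N div q\<^sup>2}"] by fastforce
    then have "real (card {n \<in> {1..N}. q\<^sup>2 dvd n}) \<le> real (N div q\<^sup>2)" by simp
    also have "\<dots> \<le> real N / real (q\<^sup>2)" by (rule of_nat_div_le_of_nat)
    finally show "real (card {n \<in> {1..N}. q\<^sup>2 dvd n}) \<le> real N * (1 / real (q\<^sup>2))" by simp
  qed
  also have "\<dots> = real N * (\<Sum>q\<in>{2..N}. 1 / real (q\<^sup>2))" by (simp add: sum_distrib_left)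
  also have "\<dots> \<le> real N * (3 / 4)" by (intro mult_left_mono sum34) simp
  finally have "real (card {n \<in> {1..N}. \<not> squarefree n}) \<le> real N * (3 / 4)" .
  moreover have "card {n \<in> {1..N}. squarefree n} + card {n \<in> {1..N}. \<not> squarefree n} = N"
    by (subst card_Un_disjoint[symmetric]) (auto intro!: arg_cong[where f=card, of _ "{1..N}", simplified])
  ultimately show ?thesis by linarith
qed

section \<open>Counting quadratic fields\<close>

lemma quadratic_field_cases:
  assumes "quadratic_field K"
  obtains d where "squarefree d" "d \<noteq> 1" "K = quad_field d" "\<bar>d\<bar> \<le> \<bar>disc K\<bar>"
proof -
  from quadratic_field_imp[OF assms] obtain d where d: "squarefree d" "d \<noteq> 1" "K = quad_field d" by blast
  interpret radicand d using d by unfold_locales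
  have "\<bar>d\<bar> \<le> \<bar>disc K\<bar>" unfolding d(3) by (rule disc_bounds(1))
  then show thesis using that d by blast
qed

lemma finite_quadratic_fields: "finite {K. quadratic_field K \<and> real_of_int \<bar>disc K\<bar> < x}"
proof (rule finite_subset)
  show "{K. quadratic_field K \<and> real_of_int \<bar>disc K\<bar> < x} \<subseteq> quad_field ` {- \<lceil>x\<rceil>..\<lceil>x\<rceil>}"
  proof
    fix K assume K: "K \<in> {K. quadratic_field K \<and> real_of_int \<bar>disc K\<bar> < x}"
    then obtain d where d: "K = quad_field d" "\<bar>d\<bar> \<le> \<bar>disc K\<bar>" by (auto elim: quadratic_field_cases)
    then have "real_of_int \<bar>d\<bar> < x" using K by (smt (verit) mem_Collect_eq of_int_le_iff)
    then have "d \<in> {- \<lceil>x\<rceil>..\<lceil>x\<rceil>}" by (simp add: abs_less_iff) linarith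
    then show "K \<in> quad_field ` {- \<lceil>x\<rceil>..\<lceil>x\<rceil>}" using d(1) by blast
  qed
qed simp

text \<open>
  The fields \<open>\<rat>(\<surd>n)\<close> for squarefree \<open>n\<close> with \<open>1 < n \<le> x/8\<close> are distinct, and their discriminants are
  at most \<open>4 n < x\<close>. The constant \<open>5/4\<close> pays for rounding and for excluding \<open>n = 1\<close>.
\<close>

lemma card_quadratic_fields_ge:
  assumes "x > 0"
  shows "x / 32 - 5 / 4 \<le> real (card {K. quadratic_field K \<and> real_of_int \<bar>disc K\<bar> < x})"
proof -
  define N where "N = nat \<lfloor>x / 8\<rfloor>"
  have N: "real N \<le> x / 8" "x / 8 < real N + 1" using assms unfolding N_def by linarith+
  define A where "A = {n \<in> {1..N}. squarefree n} - {1}"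
  have mem: "quad_field (int n) \<in> {K. quadratic_field K \<and> real_of_int \<bar>disc K\<bar> < x}"
    and rad: "squarefree (int n)" "int n \<noteq> 1" if "n \<in> A" for n
  proof -
    have n: "squarefree n" "n \<noteq> 1" "n \<le> N" using that by (auto simp: A_def)
    show sf: "squarefree (int n)"
    proof (rule squarefreeI)
      fix y :: int assume y: "y\<^sup>2 dvd int n"
      have "int ((nat \<bar>y\<bar>)\<^sup>2) = y\<^sup>2" by simp
      then have "int ((nat \<bar>y\<bar>)\<^sup>2) dvd int n" using y by (simp only:)
      then have "(nat \<bar>y\<bar>)\<^sup>2 dvd n" by (simp only: int_dvd_int_iff)
      then have "nat \<bar>y\<bar> dvd 1" by (rule squarefreeD[OF n(1)])
      then show "y dvd 1" by simp
    qed
    show n1: "int n \<noteq> 1" using n(2) by simp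
    interpret radicand "int n" using sf n1 by unfold_locales
    have "real_of_int \<bar>disc E\<bar> \<le> real_of_int (4 * \<bar>int n\<bar>)"
      using disc_bounds(2) by (simp only: of_int_le_iff)
    also have "\<dots> \<le> 4 * real N" using n(3) by simp
    also have "\<dots> < x" using N(1) assms by simp
    finally show "quad_field (int n) \<in> {K. quadratic_field K \<and> real_of_int \<bar>disc K\<bar> < x}"
      using quadratic_field by simp
  qed
  have "inj_on (\<lambda>n. quad_field (int n)) A"
  proof (rule inj_onI)
    fix a b assume "a \<in> A" "b \<in> A" "quad_field (int a) = quad_field (int b)"
    then have "int a = int b" by (intro quad_field_inject rad)
    then show "a = b" by simp
  qed
  then have "card A \<le> card {K. quadratic_field K \<and> real_of_int \<bar>disc K\<bar> < x}"
    by (rule card_inj_on_le) (use mem finite_quadratic_fields in auto)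
  moreover have "card {n \<in> {1..N}. squarefree n} - 1 \<le> card A"
    unfolding A_def using diff_card_le_card_Diff[of "{1 :: nat}" "{n \<in> {1..N}. squarefree n}"] by simp
  moreover have "real N / 4 \<le> real (card {n \<in> {1..N}. squarefree n})" by (rule card_squarefree_ge)
  ultimately show ?thesis using N(2) by linarith
qed

lemma card_quadratic_fields_few_primes_le:
  assumes few: "\<And>d. squarefree d \<Longrightarrow> d \<noteq> 1 \<Longrightarrow> P (quad_field d) \<Longrightarrow>
      card {p :: nat. prime p \<and> odd p \<and> p dvd nat \<bar>d\<bar>} \<le> k"
  shows "card {K. quadratic_field K \<and> real_of_int \<bar>disc K\<bar> < x \<and> P K} \<le>
    2 * card {n \<in> {1..nat \<lfloor>x\<rfloor>}. card {p. prime p \<and> odd p \<and> p dvd n} \<le> k}"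
proof -
  define A where "A = {n \<in> {1..nat \<lfloor>x\<rfloor>}. card {p. prime p \<and> odd p \<and> p dvd n} \<le> k}"
  have fin: "finite A" by (simp add: A_def)
  have "{K. quadratic_field K \<and> real_of_int \<bar>disc K\<bar> < x \<and> P K} \<subseteq>
      (\<lambda>n. quad_field (int n)) ` A \<union> (\<lambda>n. quad_field (- int n)) ` A"
  proof
    fix K assume K: "K \<in> {K. quadratic_field K \<and> real_of_int \<bar>disc K\<bar> < x \<and> P K}"
    then obtain d where d: "squarefree d" "d \<noteq> 1" "K = quad_field d" "\<bar>d\<bar> \<le> \<bar>disc K\<bar>"
      by (auto elim: quadratic_field_cases)
    have "real_of_int \<bar>d\<bar> \<le> real_of_int \<bar>disc K\<bar>" using d(4) by (simp only: of_int_le_iff)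
    then have "real_of_int \<bar>d\<bar> < x" using K by simp
    then have "\<bar>d\<bar> \<le> \<lfloor>x\<rfloor>" by linarith
    moreover have "d \<noteq> 0" using d(1) by auto
    ultimately have "nat \<bar>d\<bar> \<in> {1..nat \<lfloor>x\<rfloor>}" by simp linarith
    moreover have "card {p. prime p \<and> odd p \<and> p dvd nat \<bar>d\<bar>} \<le> k"
      by (rule few[OF d(1,2)]) (use K d(3) in auto)
    ultimately have "nat \<bar>d\<bar> \<in> A" by (simp add: A_def)
    moreover have "d = int (nat \<bar>d\<bar>) \<or> d = - int (nat \<bar>d\<bar>)" by linarith
    ultimately show "K \<in> (\<lambda>n. quad_field (int n)) ` A \<union> (\<lambda>n. quad_field (- int n)) ` A"
      unfolding d(3) by (metis (no_types, lifting) UnI1 UnI2 image_eqI)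
  qed
  then have "card {K. quadratic_field K \<and> real_of_int \<bar>disc K\<bar> < x \<and> P K} \<le>
      card ((\<lambda>n. quad_field (int n)) ` A \<union> (\<lambda>n. quad_field (- int n)) ` A)"
    using fin by (intro card_mono) auto
  also have "\<dots> \<le> card ((\<lambda>n. quad_field (int n)) ` A) + card ((\<lambda>n. quad_field (- int n)) ` A)"
    by (rule card_Un_le)
  also have "\<dots> \<le> card A + card A" by (intro add_mono card_image_le fin)
  finally show ?thesis by (simp add: A_def)
qed

text \<open>
  The numerator is at most twice the number of integers up to \<open>x\<close> with at most \<open>k\<close> odd prime factors,
  twice because of the sign of \<open>d\<close>; the denominator is at least \<open>x/64\<close> as soon as \<open>x \<ge> 80\<close>.
\<close>

theorem few_odd_primes_has_quadratic_density_0: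
  assumes few: "\<And>d. squarefree d \<Longrightarrow> d \<noteq> 1 \<Longrightarrow> P (quad_field d) \<Longrightarrow>
      card {p :: nat. prime p \<and> odd p \<and> p dvd nat \<bar>d\<bar>} \<le> k"
  shows "has_quadratic_density P 0"
proof -
  define a where "a = (\<lambda>N. real (card {n \<in> {1..N}. card {p :: nat. prime p \<and> odd p \<and> p dvd n} \<le> k}))"
  let ?num = "\<lambda>x :: real. real (card {K. quadratic_field K \<and> real_of_int \<bar>disc K\<bar> < x \<and> P K})"
  let ?den = "\<lambda>x :: real. real (card {K. quadratic_field K \<and> real_of_int \<bar>disc K\<bar> < x})"
  have lim: "(\<lambda>N. a N / real N) \<longlonglongrightarrow> 0"
    unfolding a_def by (rule few_odd_prime_factors_density_zero)
  have fl: "filterlim (\<lambda>x :: real. nat \<lfloor>x\<rfloor>) sequentially at_top"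
    unfolding filterlim_at_top
  proof
    fix Z :: nat
    show "\<forall>\<^sub>F x :: real in at_top. Z \<le> nat \<lfloor>x\<rfloor>"
      using eventually_ge_at_top[of "real Z"] by eventually_elim linarith
  qed
  have "((\<lambda>x :: real. a (nat \<lfloor>x\<rfloor>) / real (nat \<lfloor>x\<rfloor>)) \<longlongrightarrow> 0) at_top"
    by (rule filterlim_compose[OF lim fl])
  then have lim': "((\<lambda>x :: real. 128 * (a (nat \<lfloor>x\<rfloor>) / real (nat \<lfloor>x\<rfloor>))) \<longlongrightarrow> 0) at_top"
    by (rule tendsto_mult_right_zero)
  have "((\<lambda>x. ?num x / ?den x) \<longlongrightarrow> 0) at_top"
  proof (rule tendsto_sandwich[OF _ _ tendsto_const lim'])
    show "\<forall>\<^sub>F x in at_top. 0 \<le> ?num x / ?den x" by simp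
    show "\<forall>\<^sub>F x in at_top. ?num x / ?den x \<le> 128 * (a (nat \<lfloor>x\<rfloor>) / real (nat \<lfloor>x\<rfloor>))"
      using eventually_ge_at_top[of 80]
    proof eventually_elim
      case (elim x)
      define N where "N = nat \<lfloor>x\<rfloor>"
      have N: "0 < real N" "real N \<le> x" using elim unfolding N_def by linarith+
      have "card {K. quadratic_field K \<and> real_of_int \<bar>disc K\<bar> < x \<and> P K} \<le>
          2 * card {n \<in> {1..nat \<lfloor>x\<rfloor>}. card {p :: nat. prime p \<and> odd p \<and> p dvd n} \<le> k}"
        by (rule card_quadratic_fields_few_primes_le[OF few])
      then have num: "?num x \<le> 2 * a N" unfolding a_def N_def by linarith
      have den: "x / 64 \<le> ?den x" using card_quadratic_fields_ge[of x] elim by linarith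
      have a0: "a N \<ge> 0" by (simp add: a_def)
      have "?num x / ?den x \<le> (2 * a N) / (x / 64)"
        using num den elim a0 by (intro frac_le) auto
      also have "\<dots> = 128 * (a N / x)" by simp
      also have "\<dots> \<le> 128 * (a N / real N)"
        using N a0 by (intro mult_left_mono divide_left_mono) auto
      finally show ?case unfolding N_def .
    qed
  qed
  then show ?thesis by (simp add: has_quadratic_density_def)
qed

text \<open>
  An isomorphism with \<open>H\<^sub>8\<^sup>m\<close> fixes the order of the Galois group, hence bounds the number of odd primes
  dividing \<open>d\<close>.
\<close>

theorem corollary4:
  fixes m :: nat
  assumes "m \<ge> 1"
  shows "has_quadratic_density (\<lambda>K. Gal (max_unramified K) K \<cong> quaternion_power m) 0"
proof (rule few_odd_primes_has_quadratic_density_0)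
  fix d :: int
  assume "squarefree d" "d \<noteq> 1" and iso: "Gal (max_unramified (quad_field d)) (quad_field d) \<cong> quaternion_power m"
  then interpret radicand d by unfold_locales
  have "finite (carrier (quaternion_power m))"
    unfolding quaternion_power_def by (simp add: quaternion_group_def finite_PiE)
  then have fin: "finite (carrier (Gal (max_unramified E) E))"
    using iso_finite[OF iso] by simp
  show "card {p :: nat. prime p \<and> odd p \<and> p dvd nat \<bar>d\<bar>} \<le>
      2 * (2 ^ card (carrier (quaternion_power m)) + 2)"
    using card_odd_ramified_primes[OF fin] unfolding iso_same_card[OF iso] .
qed

end
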